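(* Let $d,n\geq 1$ be integers and let $\tau>d/n$. Then \[ \dim_F E(\tau,d,n)=\frac{2d}{1+\tau}. \] In particular, $E(\tau,d,n)$ is not a Salem set unless $n=d=1$.
   Context: For a Borel probability measure $\mu$ on $\mathbb{R}^m$, its Fourier transform is $\hat\mu(\xi)=\int e^{-2\pi i x\cdot\xi}\,d\mu(x)$, and its Fourier dimension is $\dim_F\mu=\sup\{s\in[0,m]: |\hat\mu(\xi)|\ll|\xi|^{-s/2}\}$. For a set $E\subset\mathbb{R}^m$, $\dim_F E=\sup\{\dim_F\mu:\mu\in\mathcal P(E)\}$, where $\mathcal P(E)$ is the set of Borel probability measures $\mu$ on $\mathbb{R}^m$ whose support (the largest closed set $C$ with $\mu(\mathbb{R}^m\setminus C)=0$) is a compact subset of $E$. A Borel set $E\subset\mathbb{R}^m$ is a Salem set if $\dim_{\mathrm H}E=\dim_F E$ (Hausdorff dimension equals Fourier dimension). For integers $d,n\ge1$ and $\tau>0$, \[ E(\tau,d,n)=\{x\in\mathbb{R}^{nd}: |xq-r|_\infty<|q|_\infty^{-\tau}\text{ for infinitely many }(q,r)\in\mathbb{Z}^d\times\mathbb{Z}^n\}, \] where $x\in\mathbb{R}^{nd}$ is regarded as an $n\times d$ real matrix and $|\cdot|_\infty$ is the maximum norm. It is known that for $\tau>d/n$, $\dim_{\mathrm H}E(\tau,d,n)=n(d-1)+\frac{n+d}{\tau+1}$.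
   Formalization: The support of a measure is taken to be the smallest (not "largest") closed set whose complement has measure zero, and q = 0, for which |q|^{-τ} is undefined, is excluded in the definition of E(τ,d,n). *)

theory Defs
  imports "HOL-Probability.Probability"
begin

section \<open>Fourier dimension\<close>

definition fourier_transform :: "'a::euclidean_space measure \<Rightarrow> 'a \<Rightarrow> complex" where
  "fourier_transform \<mu> \<xi> = (LINT x|\<mu>. exp (- 2 * of_real pi * \<i> * of_real (x \<bullet> \<xi>)))"

text \<open>The bound is imposed for all nonzero frequencies. For a probability measure and
  \<open>s \<ge> 0\<close> this is the same as imposing it for all large frequencies.\<close>

definition fourier_dim_measure :: "'a::euclidean_space measure \<Rightarrow> real" where
  "fourier_dim_measure \<mu> =
     Sup {s \<in> {0..real DIM('a)}.
       \<exists>C. \<forall>\<xi>. \<xi> \<noteq> 0 \<longrightarrow> norm (fourier_transform \<mu> \<xi>) \<le> C * norm \<xi> powr (- s / 2)}"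

definition measure_support :: "'a::topological_space measure \<Rightarrow> 'a set" where
  "measure_support \<mu> = \<Inter>{C. closed C \<and> emeasure \<mu> (UNIV - C) = 0}"

definition prob_measures_on :: "'a::euclidean_space set \<Rightarrow> 'a measure set" where
  "prob_measures_on E =
     {\<mu>. prob_space \<mu> \<and> sets \<mu> = sets borel \<and>
          compact (measure_support \<mu>) \<and> measure_support \<mu> \<subseteq> E}"

text \<open>All Fourier dimensions of measures are nonnegative, so the inserted \<open>0\<close> only fixes the
  value for the empty set.\<close>

definition fourier_dim :: "'a::euclidean_space set \<Rightarrow> real" where
  "fourier_dim E = Sup (insert 0 (fourier_dim_measure ` prob_measures_on E))"

section \<open>Hausdorff dimension and Salem sets\<close>

text \<open>The power \<open>(diam U)\<^sup>s\<close> with the usual conventions that the empty set has weight \<open>0\<close>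
  and that \<open>0\<^sup>0 = 1\<close> for nonempty \<open>U\<close> (whereas \<open>0 powr 0 = 0\<close>).\<close>

definition diam_power :: "real \<Rightarrow> 'a::metric_space set \<Rightarrow> ennreal" where
  "diam_power s U =
     (if U = {} then 0 else if s = 0 then 1 else ennreal (diameter U powr s))"

definition hausdorff_premeasure ::
  "real \<Rightarrow> real \<Rightarrow> 'a::metric_space set \<Rightarrow> ennreal" where
  "hausdorff_premeasure s \<delta> E =
     Inf {(\<Sum>i. diam_power s (U i)) | U :: nat \<Rightarrow> 'a set.
       E \<subseteq> (\<Union>i. U i) \<and> (\<forall>i. bounded (U i) \<and> diameter (U i) \<le> \<delta>)}"

definition hausdorff_measure :: "real \<Rightarrow> 'a::metric_space set \<Rightarrow> ennreal" where
  "hausdorff_measure s E = (SUP \<delta>\<in>{0<..}. hausdorff_premeasure s \<delta> E)"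

definition hausdorff_dim :: "'a::euclidean_space set \<Rightarrow> real" where
  "hausdorff_dim E = Inf {s. 0 \<le> s \<and> hausdorff_measure s E = 0}"

definition salem_set :: "'a::euclidean_space set \<Rightarrow> bool" where
  "salem_set E \<longleftrightarrow> E \<in> sets borel \<and> hausdorff_dim E = fourier_dim E"

section \<open>Well approximable matrices\<close>

definition real_vec :: "int ^ 'k \<Rightarrow> real ^ 'k" where
  "real_vec v = (\<chi> i. real_of_int (v $ i))"

text \<open>The type \<open>real ^ 'd ^ 'n\<close> is the space of matrices with \<open>n\<close> rows and \<open>d\<close> columns, with the
  Euclidean structure of \<open>\<real>\<close> to the power \<open>n d\<close>. The vector \<open>q = 0\<close>, for which the power of
  the norm is undefined, is excluded.\<close>

definition well_approximable :: "real \<Rightarrow> (real ^ 'd ^ 'n) set" where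
  "well_approximable \<tau> =
     {x. infinite {(q :: int ^ 'd, r :: int ^ 'n).
        q \<noteq> 0 \<and> infnorm (x *v real_vec q - real_vec r) < infnorm (real_vec q) powr (- \<tau>)}}"

lemma well_approximable_borel: "(well_approximable \<tau> :: (real ^ 'd ^ 'n) set) \<in> sets borel"
proof -
  define A :: "(int ^ 'd) \<times> (int ^ 'n) \<Rightarrow> (real ^ 'd ^ 'n) set" where
    "A p = {x. fst p \<noteq> 0 \<and> infnorm (x *v real_vec (fst p) - real_vec (snd p))
                 < infnorm (real_vec (fst p)) powr (- \<tau>)}" for p
  have "open (A p)" for p
  proof -
    have "continuous_on UNIV (\<lambda>x :: real ^ 'd ^ 'n. x *v real_vec (fst p))"
      unfolding matrix_vector_mult_def by (intro continuous_intros)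
    then have "continuous_on UNIV
        (\<lambda>x :: real ^ 'd ^ 'n. infnorm (x *v real_vec (fst p) - real_vec (snd p)))"
      by (intro continuous_intros)
    then show ?thesis
      unfolding A_def by (cases "fst p = 0") (auto intro: open_Collect_less continuous_on_const)
  qed
  then have borel: "A p \<in> sets borel" for p by simp
  have "(well_approximable \<tau> :: (real ^ 'd ^ 'n) set) = {x. infinite {p. x \<in> A p}}"
    unfolding well_approximable_def A_def by (simp add: case_prod_unfold)
  also have "\<dots> = (\<Inter>F\<in>{F. finite F}. \<Union>p\<in>-F. A p)"
  proof (intro set_eqI iffI)
    fix x assume "x \<in> {x. infinite {p. x \<in> A p}}"
    then have "\<not> {p. x \<in> A p} \<subseteq> F" if "finite F" for F
      using that finite_subset by auto
    then show "x \<in> (\<Inter>F\<in>{F. finite F}. \<Union>p\<in>-F. A p)" by blast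
  next
    fix x assume x: "x \<in> (\<Inter>F\<in>{F. finite F}. \<Union>p\<in>-F. A p)"
    show "x \<in> {x. infinite {p. x \<in> A p}}"
    proof (intro CollectI notI)
      assume "finite {p. x \<in> A p}"
      with x have "x \<in> (\<Union>p\<in>-{p. x \<in> A p}. A p)" by blast
      then show False by blast
    qed
  qed
  also have "\<dots> \<in> sets borel"
    by (intro sets.countable_INT'' sets.countable_INT' sets.countable_UN' borel)
       (auto intro: countable_Collect_finite borel sets.countable_UN')
  finally show ?thesis .
qed

end

theory Submission
  imports Defs "HOL-Computational_Algebra.Primes"
begin

text \<open>
  \<^bold>\<open>Upper bound.\<close> Let \<open>\<mu>\<close> live on the set and have Fourier transform \<open>O(|\<xi>|\<^bsup>-\<sigma>\<^esup>)\<close>. Majorising the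
  indicator of \<open>{y. \<parallel>y\<parallel> \<le> |q|\<^bsup>-\<tau>\<^esup>}\<close> on the torus by a product of Fejer kernels of degree
  \<open>N \<approx> |q|\<^bsup>\<tau>\<^esup>\<close> bounds the \<open>\<mu>\<close>-measure of the matrices approximable with denominator \<open>q\<close> by
  \<open>N\<^bsup>-n\<^esup> + |q|\<^bsup>-\<sigma>\<^esup> N\<^bsup>\<epsilon>-\<sigma>\<^esup>\<close>. This is summable over \<open>q\<close> when \<open>\<tau> n > d\<close> and \<open>(1 + \<tau>) \<sigma> > d\<close>,
  so the Borel--Cantelli lemma forces \<open>\<sigma> \<le> d / (1 + \<tau>)\<close>.

  \<^bold>\<open>Lower bound.\<close> Start with a rapidly decaying measure and multiply it successively by functions
  \<open>F\<^sub>M\<close>, the average over the \<open>M\<^sup>d\<close> vectors \<open>q \<in> [M, 2M)\<^sup>d\<close> of a periodised bump of width \<open>M\<^bsup>-\<tau>\<^esup>\<close>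
  evaluated at \<open>x q\<close>. The nonconstant Fourier modes of \<open>F\<^sub>M\<close> sit at the integer matrices
  \<open>k \<otimes> q\<close>. By the divisor bound each matrix \<open>l\<close> has at most \<open>|l|\<^sup>\<epsilon>\<close> such representations, so
  the coefficients are at most \<open>M\<^bsup>-d\<^esup> |l|\<^sup>\<epsilon>\<close> up to \<open>|l| \<approx> M\<^bsup>1+\<tau>\<^esup>\<close>, hence roughly
  \<open>|l|\<^bsup>-d/(1+\<tau>)\<^esup>\<close>. If \<open>M\<close> grows fast enough, every weak limit keeps this decay and is supported
  on the set.

  \<^bold>\<open>Hausdorff dimension.\<close> There are only about \<open>M\<^sup>d (R/M)\<^sup>n\<close> modes \<open>k \<otimes> q\<close> of norm at most \<open>R\<close>,
  so the sum of \<open>|l|\<^bsup>-p\<^esup>\<close> times the squared Fourier transform of the same measure over the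
  integer matrices \<open>l\<close> is finite for every \<open>p > (n \<tau> - d) / (1 + \<tau>)\<close>. By Frostman's argument the
  set has dimension at least \<open>n d - p\<close>. The supremum \<open>n (d - 1) + (n + d) / (1 + \<tau>)\<close> of these
  values exceeds \<open>2 d / (1 + \<tau>)\<close> unless \<open>n = d = 1\<close>.
\<close>

section \<open>Characters and Fourier transforms\<close>

definition unit_exp :: "real \<Rightarrow> complex" where
  "unit_exp t = cis (2 * pi * t)"

lemma unit_exp_add: "unit_exp (s + t) = unit_exp s * unit_exp t"
  by (simp add: unit_exp_def cis_mult distrib_left)

lemma unit_exp_0 [simp]: "unit_exp 0 = 1"
  by (simp add: unit_exp_def)

lemma norm_unit_exp [simp]: "norm (unit_exp t) = 1"
  by (simp add: unit_exp_def)

lemma unit_exp_minus: "unit_exp (- t) = cnj (unit_exp t)"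
  by (simp add: unit_exp_def cis_cnj)

lemma unit_exp_of_int [simp]: "unit_exp (of_int k) = 1"
  using cis_multiple_2pi[of "of_int k"] by (simp add: unit_exp_def)

lemma unit_exp_half: "unit_exp (1 / 2) = - 1"
  by (simp add: unit_exp_def)

lemma unit_exp_sum: "unit_exp (\<Sum>i\<in>A. f i) = (\<Prod>i\<in>A. unit_exp (f i))"
  by (induction A rule: infinite_finite_induct) (auto simp: unit_exp_add)

lemma Re_unit_exp: "Re (unit_exp t) = cos (2 * pi * t)"
  by (simp add: unit_exp_def)

lemma continuous_on_unit_exp [continuous_intros]:
  "continuous_on A f \<Longrightarrow> continuous_on A (\<lambda>x. unit_exp (f x))"
  unfolding unit_exp_def by (intro continuous_intros)

lemma borel_measurable_unit_exp [measurable]: "unit_exp \<in> borel_measurable borel"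
  by (intro borel_measurable_continuous_onI continuous_intros)

lemma fourier_transform_unit_exp: "fourier_transform \<mu> \<xi> = (LINT x|\<mu>. unit_exp (- (x \<bullet> \<xi>)))"
proof -
  have "exp (- 2 * of_real pi * \<i> * of_real (x \<bullet> \<xi>)) = unit_exp (- (x \<bullet> \<xi>))" for x
    by (simp add: unit_exp_def cis_conv_exp mult_ac)
  then show ?thesis by (simp add: fourier_transform_def)
qed

lemma norm_fourier_transform_le: "norm (fourier_transform \<mu> \<xi>) \<le> measure \<mu> (space \<mu>)"
proof -
  have "norm (fourier_transform \<mu> \<xi>) \<le> (LINT x|\<mu>. norm (unit_exp (- (x \<bullet> \<xi>))))"
    unfolding fourier_transform_unit_exp by (rule integral_norm_bound)
  then show ?thesis by simp
qed

lemma norm_fourier_transform_le_1: "prob_space \<mu> \<Longrightarrow> norm (fourier_transform \<mu> \<xi>) \<le> 1"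
  using norm_fourier_transform_le[of \<mu> \<xi>] by (simp add: prob_space.prob_space)

lemma fourier_transform_0: "fourier_transform \<mu> 0 = of_real (measure \<mu> (space \<mu>))"
  by (simp add: fourier_transform_unit_exp of_real_def)

lemma (in finite_measure) integrable_bounded_borel:
  fixes f :: "'a \<Rightarrow> 'b::{banach, second_countable_topology}"
  assumes "f \<in> borel_measurable M" and "\<And>x. norm (f x) \<le> B"
  shows "integrable M f"
  using assms by (intro integrable_const_bound[where B = B]) auto

lemma (in finite_measure) integrable_unit_exp:
  assumes "f \<in> borel_measurable M"
  shows "integrable M (\<lambda>x. unit_exp (f x))"
proof (rule integrable_bounded_borel[where B = 1])
  show "(\<lambda>x. unit_exp (f x)) \<in> borel_measurable M" using assms by measurable
qed simp

section \<open>Decaying functions and lattice sums\<close>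

definition bracket :: "'a::real_normed_vector \<Rightarrow> real" (\<open>\<langle>_\<rangle>\<close>) where
  "\<langle>v\<rangle> = 1 + norm v"

lemma bracket_ge_1 [simp]: "1 \<le> \<langle>v\<rangle>"
  by (simp add: bracket_def)

lemma bracket_pos [simp]: "0 < \<langle>v\<rangle>"
  using bracket_ge_1[of v] by linarith

lemma bracket_nonneg [simp]: "0 \<le> \<langle>v\<rangle>"
  using bracket_pos[of v] by linarith

lemma bracket_neq_0 [simp]: "\<langle>v\<rangle> \<noteq> 0"
  using bracket_pos[of v] by linarith

lemma bracket_0 [simp]: "\<langle>0\<rangle> = 1"
  by (simp add: bracket_def)

lemma bracket_minus [simp]: "\<langle>- v\<rangle> = \<langle>v\<rangle>"
  by (simp add: bracket_def)

lemma bracket_minus_commute: "\<langle>v - w\<rangle> = \<langle>w - v\<rangle>"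
  by (simp add: bracket_def norm_minus_commute)

lemma bracket_powr_cancel [simp]: "\<langle>v\<rangle> powr p * \<langle>v\<rangle> powr (- p) = 1"
  by (simp flip: powr_add)

lemma bracket_powr_anti_mono: "a \<le> b \<Longrightarrow> \<langle>v\<rangle> powr (- b) \<le> \<langle>v\<rangle> powr (- a)"
  by (intro powr_mono) auto

lemma bracket_powr_le_1: "0 \<le> a \<Longrightarrow> \<langle>v\<rangle> powr (- a) \<le> 1"
  using bracket_powr_anti_mono[of 0 a v] by simp

lemma bracket_submult: "\<langle>v\<rangle> \<le> \<langle>w\<rangle> * \<langle>v - w\<rangle>"
proof -
  have "\<langle>v\<rangle> \<le> 1 + norm w + norm (v - w)"
    using norm_triangle_sub[of v w] by (simp add: bracket_def)
  also have "\<dots> \<le> \<langle>w\<rangle> * \<langle>v - w\<rangle>" by (simp add: bracket_def distrib_left distrib_right)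
  finally show ?thesis .
qed

lemma Peetre_inequality:
  assumes "0 \<le> a"
  shows "\<langle>w\<rangle> powr (- a) \<le> \<langle>v\<rangle> powr (- a) * \<langle>v - w\<rangle> powr a"
proof -
  have "(\<langle>w\<rangle> * \<langle>v - w\<rangle>) powr (- a) \<le> \<langle>v\<rangle> powr (- a)"
    using bracket_submult[of v w] assms by (intro powr_mono2') auto
  then have "\<langle>w\<rangle> powr (- a) * \<langle>v - w\<rangle> powr (- a) * \<langle>v - w\<rangle> powr a \<le> \<langle>v\<rangle> powr (- a) * \<langle>v - w\<rangle> powr a"
    by (intro mult_right_mono) (auto simp: powr_mult)
  then show ?thesis by (simp add: mult.assoc flip: powr_add)
qed

lemma norm_powr_le_bracket:
  assumes "1 \<le> norm v" "0 \<le> a"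
  shows "norm v powr (- a) \<le> 2 powr a * \<langle>v\<rangle> powr (- a)"
proof -
  have "norm v > 0" using assms by linarith
  have "(2 * norm v) powr (- a) \<le> \<langle>v\<rangle> powr (- a)"
    using assms by (intro powr_mono2') (auto simp: bracket_def)
  then have "2 powr a * (2 powr (- a) * norm v powr (- a)) \<le> 2 powr a * \<langle>v\<rangle> powr (- a)"
    by (intro mult_left_mono) (auto simp: powr_mult)
  then show ?thesis by (simp flip: mult.assoc powr_add)
qed

definition decay_bound :: "real \<Rightarrow> real \<Rightarrow> ('a::real_normed_vector \<Rightarrow> complex) \<Rightarrow> bool" where
  "decay_bound C a f \<longleftrightarrow> (\<forall>\<xi>. norm (f \<xi>) \<le> C * \<langle>\<xi>\<rangle> powr (- a))"

lemma decay_boundI: "(\<And>\<xi>. norm (f \<xi>) \<le> C * \<langle>\<xi>\<rangle> powr (- a)) \<Longrightarrow> decay_bound C a f"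
  by (simp add: decay_bound_def)

lemma decay_boundD: "decay_bound C a f \<Longrightarrow> norm (f \<xi>) \<le> C * \<langle>\<xi>\<rangle> powr (- a)"
  by (simp add: decay_bound_def)

lemma decay_bound_const_nonneg: "decay_bound C a f \<Longrightarrow> 0 \<le> C"
  using order_trans[OF norm_ge_zero decay_boundD[of C a f 0]] by simp

lemma decay_bound_weaken:
  assumes "decay_bound C b f" "a \<le> b" "C \<le> D"
  shows "decay_bound D a f"
proof (rule decay_boundI)
  fix \<xi>
  have "norm (f \<xi>) \<le> C * \<langle>\<xi>\<rangle> powr (- b)" using assms(1) by (rule decay_boundD)
  also have "\<dots> \<le> D * \<langle>\<xi>\<rangle> powr (- a)"
    using assms decay_bound_const_nonneg[OF assms(1)]
    by (intro mult_mono bracket_powr_anti_mono) auto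
  finally show "norm (f \<xi>) \<le> D * \<langle>\<xi>\<rangle> powr (- a)" .
qed

lemma decay_bound_add:
  assumes "decay_bound C a f" "decay_bound D a g"
  shows "decay_bound (C + D) a (\<lambda>\<xi>. f \<xi> + g \<xi>)"
  using add_mono[OF assms[THEN decay_boundD]]
  by (intro decay_boundI order_trans[OF norm_triangle_ineq]) (simp add: distrib_right)

lemma decay_bound_mult:
  assumes "decay_bound C a f" "decay_bound D b g"
  shows "decay_bound (C * D) (a + b) (\<lambda>\<xi>. f \<xi> * g \<xi>)"
proof (rule decay_boundI)
  fix \<xi>
  have "norm (f \<xi> * g \<xi>) \<le> (C * \<langle>\<xi>\<rangle> powr (- a)) * (D * \<langle>\<xi>\<rangle> powr (- b))"
    unfolding norm_mult using assms decay_bound_const_nonneg[OF assms(1)]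
    by (intro mult_mono decay_boundD) auto
  also have "\<dots> = C * D * \<langle>\<xi>\<rangle> powr (- (a + b))" by (simp add: powr_diff powr_minus divide_simps)
  finally show "norm (f \<xi> * g \<xi>) \<le> C * D * \<langle>\<xi>\<rangle> powr (- (a + b))" .
qed

lemma decay_bound_scale:
  assumes "decay_bound C a f" "\<And>\<xi>. norm (g \<xi>) \<le> K * norm (f \<xi>)" "0 \<le> K"
  shows "decay_bound (K * C) a g"
  using order_trans[OF assms(2) mult_left_mono[OF decay_boundD[OF assms(1)] assms(3)]]
  by (intro decay_boundI) (simp add: mult.assoc)

lemma decay_bound_lim:
  assumes "\<And>k. decay_bound C a (f k)" "\<And>\<xi>. (\<lambda>k. f k \<xi>) \<longlonglongrightarrow> g \<xi>"
  shows "decay_bound C a g"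
  by (intro decay_boundI Lim_bounded[OF tendsto_norm[OF assms(2)]])
    (use assms(1) in \<open>auto intro: decay_boundD\<close>)

definition int_lattice :: "'a::euclidean_space set" where
  "int_lattice = {v. \<forall>b\<in>Basis. v \<bullet> b \<in> \<int>}"

lemma norm_ge_1_int_lattice:
  assumes "v \<in> int_lattice" "v \<noteq> 0"
  shows "1 \<le> norm v"
proof -
  obtain b where b: "b \<in> Basis" "v \<bullet> b \<noteq> 0"
    using assms(2) euclidean_all_zero_iff by blast
  then have "v \<bullet> b \<in> \<int>" using assms(1) by (auto simp: int_lattice_def)
  then have "\<bar>v \<bullet> b\<bar> \<ge> 1" using b(2) Ints_nonzero_abs_ge1 by blast
  then show ?thesis using Basis_le_norm[OF b(1), of v] by linarith
qed

lemma sum_int_le_sum_nat: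
  fixes f :: "int \<Rightarrow> real"
  assumes "finite T" "\<And>k. 0 \<le> f k" "\<And>k. f (- k) = f k"
  shows "(\<Sum>k\<in>T. f k) \<le> 2 * (\<Sum>n\<in>(\<lambda>k. nat \<bar>k\<bar>) ` T. f (int n))"
proof -
  define N where "N = (\<lambda>k. nat \<bar>k\<bar>) ` T"
  have finite_N: "finite N" using assms(1) by (simp add: N_def)
  have "T \<subseteq> int ` N \<union> (\<lambda>n. - int n) ` N"
  proof
    fix k assume "k \<in> T"
    then have "nat \<bar>k\<bar> \<in> N" by (simp add: N_def)
    moreover have "k = int (nat \<bar>k\<bar>) \<or> k = - int (nat \<bar>k\<bar>)" by linarith
    ultimately show "k \<in> int ` N \<union> (\<lambda>n. - int n) ` N" by blast
  qed
  then have "(\<Sum>k\<in>T. f k) \<le> (\<Sum>k\<in>int ` N \<union> (\<lambda>n. - int n) ` N. f k)"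
    using finite_N assms(2) by (intro sum_mono2) auto
  also have "\<dots> \<le> (\<Sum>k\<in>int ` N. f k) + (\<Sum>k\<in>(\<lambda>n. - int n) ` N. f k)"
    using finite_N assms(2) sum.union_inter[of "int ` N" "(\<lambda>n. - int n) ` N" f]
      sum_nonneg[of "int ` N \<inter> (\<lambda>n. - int n) ` N" f] by auto
  also have "\<dots> = 2 * (\<Sum>n\<in>N. f (int n))"
    by (simp add: sum.reindex inj_on_def assms(3))
  finally show ?thesis by (simp add: N_def)
qed

lemma sum_int_bracket_powr_bounded:
  assumes "p > 1"
  obtains C where "C > 0"
    and "\<And>t T. finite T \<Longrightarrow> (\<Sum>k\<in>T. \<langle>t - real_of_int k\<rangle> powr (- p)) \<le> C"
proof -
  define D where "D = (\<Sum>n. \<langle>real n\<rangle> powr (- p))"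
  have "summable (\<lambda>n. real n powr (- p))" using assms by (simp add: summable_real_powr_iff)
  then have "summable (\<lambda>n. real (Suc n) powr (- p))" by (subst summable_Suc_iff)
  then have summable: "summable (\<lambda>n. \<langle>real n\<rangle> powr (- p))" by (simp add: bracket_def add.commute)
  have centred: "(\<Sum>k\<in>T. \<langle>real_of_int k\<rangle> powr (- p)) \<le> 2 * D" if "finite T" for T
  proof -
    have "(\<Sum>k\<in>T. \<langle>real_of_int k\<rangle> powr (- p)) \<le>
        2 * (\<Sum>n\<in>(\<lambda>k. nat \<bar>k\<bar>) ` T. \<langle>real_of_int (int n)\<rangle> powr (- p))"
      using that by (intro sum_int_le_sum_nat) auto
    also have "\<dots> \<le> 2 * D"
      unfolding D_def using that by (intro mult_left_mono) (auto intro!: sum_le_suminf summable)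
    finally show ?thesis .
  qed
  have translated: "(\<Sum>k\<in>T. \<langle>t - real_of_int k\<rangle> powr (- p)) \<le> 2 powr p * (2 * D)"
    if "finite T" for t T
  proof -
    have "\<langle>t - real_of_int k\<rangle> powr (- p) \<le> 2 powr p * \<langle>real_of_int (\<lfloor>t\<rfloor> - k)\<rangle> powr (- p)" for k
    proof -
      have "\<langle>t - real_of_int k\<rangle> powr (- p) \<le>
          \<langle>real_of_int (\<lfloor>t\<rfloor> - k)\<rangle> powr (- p) * \<langle>real_of_int \<lfloor>t\<rfloor> - t\<rangle> powr p"
        using Peetre_inequality[of p "t - real_of_int k" "real_of_int (\<lfloor>t\<rfloor> - k)"] assms by simp
      also have "\<langle>real_of_int \<lfloor>t\<rfloor> - t\<rangle> powr p \<le> 2 powr p"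
        using assms by (intro powr_mono2) (auto simp: bracket_def, linarith)
      finally show ?thesis by (simp add: mult_left_mono mult.commute)
    qed
    then have "(\<Sum>k\<in>T. \<langle>t - real_of_int k\<rangle> powr (- p)) \<le>
        2 powr p * (\<Sum>k\<in>T. \<langle>real_of_int (\<lfloor>t\<rfloor> - k)\<rangle> powr (- p))"
      unfolding sum_distrib_left by (intro sum_mono)
    also have "(\<Sum>k\<in>T. \<langle>real_of_int (\<lfloor>t\<rfloor> - k)\<rangle> powr (- p)) =
        (\<Sum>k\<in>(\<lambda>k. \<lfloor>t\<rfloor> - k) ` T. \<langle>real_of_int k\<rangle> powr (- p))"
      by (simp add: sum.reindex inj_on_def)
    also have "\<dots> \<le> 2 * D" using that by (intro centred) auto
    finally show ?thesis by simp
  qed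
  have "D \<ge> 0" using centred[of "{}"] by simp
  then have "2 powr p * (2 * D) + 1 > 0" by (intro add_nonneg_pos) auto
  then show ?thesis by (rule that) (simp add: order_trans[OF translated])
qed

lemma bracket_powr_le_prod_Basis:
  fixes v :: "'a::euclidean_space"
  assumes "0 \<le> p"
  shows "\<langle>v\<rangle> powr (- p) \<le> (\<Prod>b\<in>Basis. \<langle>v \<bullet> b\<rangle> powr (- (p / real DIM('a))))"
proof -
  have "\<langle>v\<rangle> powr (- p) = (\<Prod>b\<in>(Basis::'a set). \<langle>v\<rangle> powr (- (p / real DIM('a))))"
    by (simp add: powr_power powr_powr)
  also have "\<dots> \<le> (\<Prod>b\<in>Basis. \<langle>v \<bullet> b\<rangle> powr (- (p / real DIM('a))))"
    using assms by (intro prod_mono conjI powr_mono2') (auto simp: bracket_def Basis_le_norm)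
  finally show ?thesis .
qed

lemma sum_prod_int_lattice_le:
  fixes g :: "'a::euclidean_space \<Rightarrow> int \<Rightarrow> real"
  assumes nonneg: "\<And>b k. 0 \<le> g b k" and bound: "\<And>b S. finite S \<Longrightarrow> (\<Sum>k\<in>S. g b k) \<le> C"
    and T: "finite T" "T \<subseteq> int_lattice"
  shows "(\<Sum>l\<in>T. \<Prod>b\<in>Basis. g b \<lfloor>l \<bullet> b\<rfloor>) \<le> C ^ DIM('a)"
proof -
  define S where "S = (\<lambda>(l, b). \<lfloor>l \<bullet> b\<rfloor>) ` (T \<times> Basis)"
  define coords where "coords l = restrict (\<lambda>b. \<lfloor>l \<bullet> b\<rfloor>) Basis" for l :: 'a
  have finite_S: "finite S" using T by (auto simp: S_def)
  have "inj_on coords T"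
  proof (rule inj_onI, rule euclidean_eqI)
    fix l l' b :: 'a assume l: "l \<in> T" "l' \<in> T" and "coords l = coords l'" and b: "b \<in> Basis"
    then have "\<lfloor>l \<bullet> b\<rfloor> = \<lfloor>l' \<bullet> b\<rfloor>" by (auto simp: coords_def dest: fun_cong[of _ _ b])
    moreover have "l \<bullet> b \<in> \<int>" "l' \<bullet> b \<in> \<int>" using l b T(2) by (auto simp: int_lattice_def)
    ultimately show "l \<bullet> b = l' \<bullet> b" by (metis floor_of_int Ints_cases)
  qed
  then have "(\<Sum>l\<in>T. \<Prod>b\<in>Basis. g b \<lfloor>l \<bullet> b\<rfloor>) = (\<Sum>f\<in>coords ` T. \<Prod>b\<in>Basis. g b (f b))"
    by (subst sum.reindex) (auto simp: coords_def)
  also have "\<dots> \<le> (\<Sum>f\<in>PiE Basis (\<lambda>_. S). \<Prod>b\<in>Basis. g b (f b))"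
    using finite_S nonneg
    by (intro sum_mono2 finite_PiE prod_nonneg) (auto simp: coords_def S_def PiE_def)
  also have "\<dots> = (\<Prod>b\<in>Basis. \<Sum>k\<in>S. g b k)"
    using finite_S by (subst prod_sum_PiE) auto
  also have "\<dots> \<le> (\<Prod>b\<in>(Basis::'a set). C)"
    using finite_S by (intro prod_mono conjI bound sum_nonneg nonneg) auto
  finally show ?thesis by simp
qed

lemma sum_int_lattice_bracket_powr_bounded:
  fixes p :: real
  assumes "p > real DIM('a::euclidean_space)"
  obtains C where "C > 0"
    and "\<And>(\<xi>::'a) T. finite T \<Longrightarrow> T \<subseteq> int_lattice \<Longrightarrow> (\<Sum>l\<in>T. \<langle>\<xi> - l\<rangle> powr (- p)) \<le> C"
proof -
  define s where "s = p / real DIM('a)"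
  have "s > 1" using assms by (simp add: s_def)
  then obtain C where C: "C > 0" "\<And>t T. finite T \<Longrightarrow> (\<Sum>k\<in>T. \<langle>t - real_of_int k\<rangle> powr (- s)) \<le> C"
    by (rule sum_int_bracket_powr_bounded) (rule that)
  have "(\<Sum>l\<in>T. \<langle>\<xi> - l\<rangle> powr (- p)) \<le> C ^ DIM('a)"
    if T: "finite T" "T \<subseteq> int_lattice" for \<xi> :: 'a and T
  proof -
    have "(\<Sum>l\<in>T. \<langle>\<xi> - l\<rangle> powr (- p)) \<le>
        (\<Sum>l\<in>T. \<Prod>b\<in>Basis. \<langle>\<xi> \<bullet> b - real_of_int \<lfloor>l \<bullet> b\<rfloor>\<rangle> powr (- s))"
    proof (rule sum_mono)
      fix l assume "l \<in> T"
      then have "\<langle>(\<xi> - l) \<bullet> b\<rangle> = \<langle>\<xi> \<bullet> b - real_of_int \<lfloor>l \<bullet> b\<rfloor>\<rangle>" if "b \<in> Basis" for b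
        using that T(2) by (auto simp: int_lattice_def inner_diff_left elim!: Ints_cases)
      then show "\<langle>\<xi> - l\<rangle> powr (- p) \<le> (\<Prod>b\<in>Basis. \<langle>\<xi> \<bullet> b - real_of_int \<lfloor>l \<bullet> b\<rfloor>\<rangle> powr (- s))"
        using bracket_powr_le_prod_Basis[of p "\<xi> - l"] assms by (simp add: s_def)
    qed
    also have "\<dots> \<le> C ^ DIM('a)" by (intro sum_prod_int_lattice_le C T) auto
    finally show ?thesis .
  qed
  with C(1) show ?thesis by (intro that[of "C ^ DIM('a)"]) auto
qed

lemma lattice_convolution_bound:
  assumes "0 \<le> a" "A > a + real DIM('a::euclidean_space)"
  obtains \<Lambda> where "\<Lambda> > 0"
    and "\<And>L (\<xi>::'a). finite L \<Longrightarrow> L \<subseteq> int_lattice \<Longrightarrow>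
      (\<Sum>l\<in>L. \<langle>l\<rangle> powr (- a) * \<langle>\<xi> - l\<rangle> powr (- A)) \<le> \<Lambda> * \<langle>\<xi>\<rangle> powr (- a)"
    and "\<And>L (\<xi>::'a). finite L \<Longrightarrow> L \<subseteq> int_lattice \<Longrightarrow>
      (\<Sum>l\<in>L. \<langle>l\<rangle> powr (- A) * \<langle>\<xi> - l\<rangle> powr (- a)) \<le> \<Lambda> * \<langle>\<xi>\<rangle> powr (- a)"
proof -
  have "A - a > real DIM('a)" using assms by simp
  then obtain \<Lambda> where \<Lambda>: "\<Lambda> > 0"
    "\<And>(\<xi>::'a) T. finite T \<Longrightarrow> T \<subseteq> int_lattice \<Longrightarrow> (\<Sum>l\<in>T. \<langle>\<xi> - l\<rangle> powr (- (A - a))) \<le> \<Lambda>"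
    by (rule sum_int_lattice_bracket_powr_bounded) (rule that)
  have exchange: "\<langle>v\<rangle> powr (- a) * \<langle>\<xi> - v\<rangle> powr (- A) \<le> \<langle>\<xi>\<rangle> powr (- a) * \<langle>\<xi> - v\<rangle> powr (- (A - a))"
    for v \<xi> :: 'a
  proof -
    have "\<langle>v\<rangle> powr (- a) * \<langle>\<xi> - v\<rangle> powr (- A) \<le>
        (\<langle>\<xi>\<rangle> powr (- a) * \<langle>\<xi> - v\<rangle> powr a) * \<langle>\<xi> - v\<rangle> powr (- A)"
      using assms by (intro mult_right_mono Peetre_inequality) auto
    then show ?thesis by (simp add: mult.assoc flip: powr_add)
  qed
  show ?thesis
  proof (rule that[OF \<Lambda>(1)])
    fix L :: "'a set" and \<xi> assume L: "finite L" "L \<subseteq> int_lattice"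
    have "(\<Sum>l\<in>L. \<langle>l\<rangle> powr (- a) * \<langle>\<xi> - l\<rangle> powr (- A)) \<le>
        \<langle>\<xi>\<rangle> powr (- a) * (\<Sum>l\<in>L. \<langle>\<xi> - l\<rangle> powr (- (A - a)))"
      unfolding sum_distrib_left by (intro sum_mono exchange)
    also have "\<dots> \<le> \<langle>\<xi>\<rangle> powr (- a) * \<Lambda>" by (intro mult_left_mono \<Lambda> L) auto
    finally show "(\<Sum>l\<in>L. \<langle>l\<rangle> powr (- a) * \<langle>\<xi> - l\<rangle> powr (- A)) \<le> \<Lambda> * \<langle>\<xi>\<rangle> powr (- a)"
      by (simp add: mult.commute)
    have "(\<Sum>l\<in>L. \<langle>l\<rangle> powr (- A) * \<langle>\<xi> - l\<rangle> powr (- a)) \<le>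
        \<langle>\<xi>\<rangle> powr (- a) * (\<Sum>l\<in>L. \<langle>0 - l\<rangle> powr (- (A - a)))"
      unfolding sum_distrib_left
      by (intro sum_mono) (use exchange[of "\<xi> - _" \<xi>] in \<open>simp add: mult.commute\<close>)
    also have "\<dots> \<le> \<langle>\<xi>\<rangle> powr (- a) * \<Lambda>" by (intro mult_left_mono \<Lambda> L) auto
    finally show "(\<Sum>l\<in>L. \<langle>l\<rangle> powr (- A) * \<langle>\<xi> - l\<rangle> powr (- a)) \<le> \<Lambda> * \<langle>\<xi>\<rangle> powr (- a)"
      by (simp add: mult.commute)
  qed
qed

lemma Schur_test_sum:
  fixes u :: "'i \<Rightarrow> 'j \<Rightarrow> real"
  assumes u: "\<And>i j. 0 \<le> u i j" and w: "\<And>i. 0 \<le> w i" and "0 \<le> R"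
    and rows: "\<And>i. i \<in> T \<Longrightarrow> (\<Sum>j\<in>L. u i j) \<le> R"
    and columns: "\<And>j. j \<in> L \<Longrightarrow> (\<Sum>i\<in>T. w i * u i j) \<le> R * v j"
  shows "(\<Sum>i\<in>T. (\<Sum>j\<in>L. b j * u i j)\<^sup>2 * w i) \<le> R\<^sup>2 * (\<Sum>j\<in>L. (b j)\<^sup>2 * v j)"
proof -
  have row_bound: "(\<Sum>j\<in>L. b j * u i j)\<^sup>2 \<le> R * (\<Sum>j\<in>L. (b j)\<^sup>2 * u i j)" if "i \<in> T" for i
  proof -
    have "(\<Sum>j\<in>L. b j * u i j)\<^sup>2 = (\<Sum>j\<in>L. (b j * sqrt (u i j)) * sqrt (u i j))\<^sup>2"
      using u by (simp add: mult.assoc)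
    also have "\<dots> \<le> (\<Sum>j\<in>L. (b j * sqrt (u i j))\<^sup>2) * (\<Sum>j\<in>L. (sqrt (u i j))\<^sup>2)"
      by (rule Cauchy_Schwarz_ineq_sum)
    also have "\<dots> = (\<Sum>j\<in>L. (b j)\<^sup>2 * u i j) * (\<Sum>j\<in>L. u i j)"
      using u by (simp add: power_mult_distrib)
    also have "\<dots> \<le> (\<Sum>j\<in>L. (b j)\<^sup>2 * u i j) * R"
      using u rows[OF that] by (intro mult_left_mono sum_nonneg) auto
    finally show ?thesis by (simp add: mult.commute)
  qed
  have "(\<Sum>i\<in>T. (\<Sum>j\<in>L. b j * u i j)\<^sup>2 * w i) \<le> (\<Sum>i\<in>T. R * (\<Sum>j\<in>L. (b j)\<^sup>2 * u i j) * w i)"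
    using w by (intro sum_mono mult_right_mono row_bound)
  also have "\<dots> = R * (\<Sum>i\<in>T. \<Sum>j\<in>L. (b j)\<^sup>2 * (w i * u i j))"
    by (simp add: sum_distrib_left sum_distrib_right mult_ac)
  also have "\<dots> = R * (\<Sum>j\<in>L. (b j)\<^sup>2 * (\<Sum>i\<in>T. w i * u i j))"
    by (subst sum.swap) (simp add: sum_distrib_left)
  also have "\<dots> \<le> R * (\<Sum>j\<in>L. (b j)\<^sup>2 * (R * v j))"
    using \<open>0 \<le> R\<close> by (intro mult_left_mono sum_mono columns) auto
  also have "\<dots> = R\<^sup>2 * (\<Sum>j\<in>L. (b j)\<^sup>2 * v j)"
    by (simp add: sum_distrib_left power2_eq_square mult_ac)
  finally show ?thesis .
qed

lemma lattice_convolution_square_sum: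
  assumes "0 \<le> p" "A > p + real DIM('a::euclidean_space)"
  obtains \<Lambda> where "\<Lambda> > 0"
    and "\<And>L T (b :: 'a \<Rightarrow> real). finite L \<Longrightarrow> L \<subseteq> int_lattice \<Longrightarrow> finite T \<Longrightarrow> T \<subseteq> int_lattice \<Longrightarrow>
      (\<Sum>\<xi>\<in>T. (\<Sum>l\<in>L. b l * \<langle>\<xi> - l\<rangle> powr (- A))\<^sup>2 * \<langle>\<xi>\<rangle> powr (- p)) \<le>
      \<Lambda>\<^sup>2 * (\<Sum>l\<in>L. (b l)\<^sup>2 * \<langle>l\<rangle> powr (- p))"
proof -
  obtain \<Lambda>\<^sub>p where \<Lambda>p: "\<Lambda>\<^sub>p > 0" "\<And>L (l::'a). finite L \<Longrightarrow> L \<subseteq> int_lattice \<Longrightarrow>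
      (\<Sum>\<xi>\<in>L. \<langle>\<xi>\<rangle> powr (- p) * \<langle>l - \<xi>\<rangle> powr (- A)) \<le> \<Lambda>\<^sub>p * \<langle>l\<rangle> powr (- p)"
    by (rule lattice_convolution_bound[OF assms]) (rule that)
  have "A > real DIM('a)" using assms by simp
  then obtain \<Lambda>\<^sub>0 where \<Lambda>0: "\<Lambda>\<^sub>0 > 0"
    "\<And>(\<xi>::'a) L. finite L \<Longrightarrow> L \<subseteq> int_lattice \<Longrightarrow> (\<Sum>l\<in>L. \<langle>\<xi> - l\<rangle> powr (- A)) \<le> \<Lambda>\<^sub>0"
    by (rule sum_int_lattice_bracket_powr_bounded) (rule that)
  define \<Lambda> where "\<Lambda> = max \<Lambda>\<^sub>p \<Lambda>\<^sub>0"
  show ?thesis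
  proof (rule that[of \<Lambda>])
    show "\<Lambda> > 0" using \<Lambda>p(1) by (simp add: \<Lambda>_def)
    fix L T :: "'a set" and b
    assume L: "finite L" "L \<subseteq> int_lattice" and T: "finite T" "T \<subseteq> int_lattice"
    show "(\<Sum>\<xi>\<in>T. (\<Sum>l\<in>L. b l * \<langle>\<xi> - l\<rangle> powr (- A))\<^sup>2 * \<langle>\<xi>\<rangle> powr (- p)) \<le>
        \<Lambda>\<^sup>2 * (\<Sum>l\<in>L. (b l)\<^sup>2 * \<langle>l\<rangle> powr (- p))"
    proof (rule Schur_test_sum)
      show "(\<Sum>l\<in>L. \<langle>\<xi> - l\<rangle> powr (- A)) \<le> \<Lambda>" for \<xi>
        using \<Lambda>0(2)[OF L, of \<xi>] by (simp add: \<Lambda>_def)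
      fix l :: 'a
      have "(\<Sum>\<xi>\<in>T. \<langle>\<xi>\<rangle> powr (- p) * \<langle>\<xi> - l\<rangle> powr (- A)) \<le> \<Lambda>\<^sub>p * \<langle>l\<rangle> powr (- p)"
        using \<Lambda>p(2)[OF T, of l] by (simp add: bracket_minus_commute[of l])
      also have "\<dots> \<le> \<Lambda> * \<langle>l\<rangle> powr (- p)" by (intro mult_right_mono) (auto simp: \<Lambda>_def)
      finally show "(\<Sum>\<xi>\<in>T. \<langle>\<xi>\<rangle> powr (- p) * \<langle>\<xi> - l\<rangle> powr (- A)) \<le> \<Lambda> * \<langle>l\<rangle> powr (- p)" .
    qed (use \<Lambda>p(1) in \<open>auto simp: \<Lambda>_def\<close>)
  qed
qed

definition lattice_energy_le :: "real \<Rightarrow> ('a::euclidean_space \<Rightarrow> complex) \<Rightarrow> real \<Rightarrow> bool" where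
  "lattice_energy_le p f B \<longleftrightarrow> (\<forall>T. finite T \<longrightarrow> T \<subseteq> int_lattice \<longrightarrow>
     (\<Sum>l\<in>T. (norm (f l))\<^sup>2 * \<langle>l\<rangle> powr (- p)) \<le> B\<^sup>2)"

lemma lattice_energy_leI:
  "(\<And>T. finite T \<Longrightarrow> T \<subseteq> int_lattice \<Longrightarrow> (\<Sum>l\<in>T. (norm (f l))\<^sup>2 * \<langle>l\<rangle> powr (- p)) \<le> B\<^sup>2) \<Longrightarrow>
    lattice_energy_le p f B"
  by (simp add: lattice_energy_le_def)

lemma lattice_energy_leD:
  "lattice_energy_le p f B \<Longrightarrow> finite T \<Longrightarrow> T \<subseteq> int_lattice \<Longrightarrow>
    (\<Sum>l\<in>T. (norm (f l))\<^sup>2 * \<langle>l\<rangle> powr (- p)) \<le> B\<^sup>2"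
  by (simp add: lattice_energy_le_def)

lemma lattice_energy_le_weaken:
  assumes "lattice_energy_le p f B" "0 \<le> B" "B \<le> D"
  shows "lattice_energy_le p f D"
  using assms power_mono[of B D 2]
  by (auto intro!: lattice_energy_leI elim: order_trans[OF lattice_energy_leD])

lemma lattice_energy_le_iff_L2_set:
  assumes "0 \<le> B"
  shows "lattice_energy_le p f B \<longleftrightarrow> (\<forall>T. finite T \<longrightarrow> T \<subseteq> int_lattice \<longrightarrow>
    L2_set (\<lambda>l. norm (f l) * \<langle>l\<rangle> powr (- p / 2)) T \<le> B)"
proof -
  have "(norm (f l))\<^sup>2 * \<langle>l\<rangle> powr (- p) = (norm (f l) * \<langle>l\<rangle> powr (- p / 2))\<^sup>2" for l
    by (simp add: power_mult_distrib powr_power)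
  then have "(\<Sum>l\<in>T. (norm (f l))\<^sup>2 * \<langle>l\<rangle> powr (- p)) \<le> B\<^sup>2 \<longleftrightarrow>
      L2_set (\<lambda>l. norm (f l) * \<langle>l\<rangle> powr (- p / 2)) T \<le> B" for T
    unfolding L2_set_def using real_sqrt_le_iff[of _ "B\<^sup>2"] assms by simp
  then show ?thesis by (simp add: lattice_energy_le_def)
qed

lemma lattice_energy_le_add:
  assumes "lattice_energy_le p f B" "lattice_energy_le p g D" "0 \<le> B" "0 \<le> D"
  shows "lattice_energy_le p (\<lambda>l. f l + g l) (B + D)"
  unfolding lattice_energy_le_iff_L2_set[OF add_nonneg_nonneg[OF assms(3,4)]]
proof (intro allI impI)
  fix T :: "'a set" assume T: "finite T" "T \<subseteq> int_lattice"
  let ?w = "\<lambda>l. \<langle>l\<rangle> powr (- p / 2)"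
  have "L2_set (\<lambda>l. norm (f l + g l) * ?w l) T \<le>
      L2_set (\<lambda>l. norm (f l) * ?w l + norm (g l) * ?w l) T"
    unfolding distrib_right[symmetric]
    by (intro L2_set_mono mult_right_mono norm_triangle_ineq) auto
  also have "\<dots> \<le> L2_set (\<lambda>l. norm (f l) * ?w l) T + L2_set (\<lambda>l. norm (g l) * ?w l) T"
    by (rule L2_set_triangle_ineq)
  also have "\<dots> \<le> B + D"
    using assms T by (intro add_mono) (auto simp: lattice_energy_le_iff_L2_set)
  finally show "L2_set (\<lambda>l. norm (f l + g l) * ?w l) T \<le> B + D" .
qed

lemma lattice_energy_le_scale:
  assumes "lattice_energy_le p f B" "\<And>l. norm (g l) \<le> K * norm (f l)"
  shows "lattice_energy_le p g (K * B)"
proof (rule lattice_energy_leI)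
  fix T :: "'a set" assume T: "finite T" "T \<subseteq> int_lattice"
  have "(\<Sum>l\<in>T. (norm (g l))\<^sup>2 * \<langle>l\<rangle> powr (- p)) \<le> (\<Sum>l\<in>T. (K * norm (f l))\<^sup>2 * \<langle>l\<rangle> powr (- p))"
    using assms(2) by (intro sum_mono mult_right_mono power_mono) auto
  also have "\<dots> = K\<^sup>2 * (\<Sum>l\<in>T. (norm (f l))\<^sup>2 * \<langle>l\<rangle> powr (- p))"
    by (simp add: sum_distrib_left power_mult_distrib mult.assoc)
  also have "\<dots> \<le> K\<^sup>2 * B\<^sup>2" by (intro mult_left_mono lattice_energy_leD[OF assms(1)] T) auto
  finally show "(\<Sum>l\<in>T. (norm (g l))\<^sup>2 * \<langle>l\<rangle> powr (- p)) \<le> (K * B)\<^sup>2"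
    by (simp add: power_mult_distrib)
qed

lemma lattice_energy_le_lim:
  assumes "\<And>k. lattice_energy_le p (f k) B" "\<And>l. (\<lambda>k. f k l) \<longlonglongrightarrow> g l"
  shows "lattice_energy_le p g B"
proof (rule lattice_energy_leI, rule Lim_bounded)
  fix T :: "'a set" assume T: "finite T" "T \<subseteq> int_lattice"
  show "(\<lambda>k. \<Sum>l\<in>T. (norm (f k l))\<^sup>2 * \<langle>l\<rangle> powr (- p)) \<longlonglongrightarrow> (\<Sum>l\<in>T. (norm (g l))\<^sup>2 * \<langle>l\<rangle> powr (- p))"
    by (intro tendsto_intros assms)
  show "\<forall>k\<ge>0. (\<Sum>l\<in>T. (norm (f k l))\<^sup>2 * \<langle>l\<rangle> powr (- p)) \<le> B\<^sup>2"
    using assms(1) T by (auto intro: lattice_energy_leD)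
qed

lemma decay_bound_imp_lattice_energy_le:
  fixes f :: "'a::euclidean_space \<Rightarrow> complex"
  assumes "decay_bound C a f" "a > real DIM('a)" "0 \<le> p"
  obtains B where "0 \<le> B" "lattice_energy_le p f B"
proof -
  obtain \<Lambda> where \<Lambda>: "\<Lambda> > 0"
    "\<And>(\<xi>::'a) T. finite T \<Longrightarrow> T \<subseteq> int_lattice \<Longrightarrow> (\<Sum>l\<in>T. \<langle>\<xi> - l\<rangle> powr (- a)) \<le> \<Lambda>"
    by (rule sum_int_lattice_bracket_powr_bounded[OF assms(2)]) (rule that)
  have pointwise: "(norm (f l))\<^sup>2 * \<langle>l\<rangle> powr (- p) \<le> C\<^sup>2 * \<langle>0 - l\<rangle> powr (- a)" for l
  proof -
    have "(norm (f l))\<^sup>2 * \<langle>l\<rangle> powr (- p) \<le> (C * \<langle>l\<rangle> powr (- a))\<^sup>2 * 1"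
      using assms by (intro mult_mono power_mono decay_boundD bracket_powr_le_1) auto
    also have "\<dots> = C\<^sup>2 * (\<langle>l\<rangle> powr (- a) * \<langle>l\<rangle> powr (- a))"
      by (simp add: power_mult_distrib power2_eq_square)
    also have "\<dots> \<le> C\<^sup>2 * (\<langle>l\<rangle> powr (- a) * 1)"
      using assms(2) by (intro mult_left_mono bracket_powr_le_1) auto
    finally show ?thesis by simp
  qed
  have "lattice_energy_le p f (sqrt (C\<^sup>2 * \<Lambda>))"
  proof (rule lattice_energy_leI)
    fix T :: "'a set" assume T: "finite T" "T \<subseteq> int_lattice"
    have "(\<Sum>l\<in>T. (norm (f l))\<^sup>2 * \<langle>l\<rangle> powr (- p)) \<le> C\<^sup>2 * (\<Sum>l\<in>T. \<langle>0 - l\<rangle> powr (- a))"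
      unfolding sum_distrib_left by (intro sum_mono pointwise)
    also have "\<dots> \<le> C\<^sup>2 * \<Lambda>" by (intro mult_left_mono \<Lambda> T) auto
    finally show "(\<Sum>l\<in>T. (norm (f l))\<^sup>2 * \<langle>l\<rangle> powr (- p)) \<le> (sqrt (C\<^sup>2 * \<Lambda>))\<^sup>2" using \<Lambda>(1) by simp
  qed
  then show ?thesis using \<Lambda>(1) by (intro that) auto
qed

section \<open>The divisor bound\<close>

lemma card_divisors_prime_power_mult:
  fixes p m k :: nat
  assumes "prime p" "m > 0"
  shows "card {a. a dvd p ^ k * m} \<le> (k + 1) * card {a. a dvd m}"
proof -
  have "{a. a dvd p ^ k * m} \<subseteq> (\<lambda>(i, b). p ^ i * b) ` ({..k} \<times> {a. a dvd m})"
  proof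
    fix a assume "a \<in> {a. a dvd p ^ k * m}"
    then obtain b c where "a = b * c" "b dvd p ^ k" "c dvd m" using division_decomp by blast
    moreover from this obtain i where "i \<le> k" "b = p ^ i"
      using divides_primepow_nat[OF assms(1)] by blast
    ultimately show "a \<in> (\<lambda>(i, b). p ^ i * b) ` ({..k} \<times> {a. a dvd m})" by force
  qed
  then have "card {a. a dvd p ^ k * m} \<le> card ((\<lambda>(i, b). p ^ i * b) ` ({..k} \<times> {a. a dvd m}))"
    using assms by (intro card_mono) auto
  also have "\<dots> \<le> card ({..k} \<times> {a. a dvd m})" using assms by (intro card_image_le) auto
  finally show ?thesis by (simp add: card_cartesian_product)
qed

lemma prime_power_decomposition_nat:
  fixes n :: nat
  assumes "n > 1"
  obtains p k m where "prime p" "m > 0" "m < n" "n = p ^ k * m" "p \<notin> prime_factors m"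
    "prime_factors n = insert p (prime_factors m)"
proof -
  obtain p where p: "prime p" "p dvd n" using prime_factor_nat[of n] assms by auto
  define k where "k = multiplicity p n"
  obtain m where n: "n = p ^ k * m" and "\<not> p dvd m"
    unfolding k_def using multiplicity_decompose'[of n p] p assms
    by (metis not_one_less_zero not_prime_unit)
  have "m > 0" using n assms by (cases m) auto
  have "k > 0" using p assms by (simp add: k_def prime_multiplicity_gt_zero_iff)
  have "m < n"
    using n \<open>m > 0\<close> one_less_power[OF prime_gt_1_nat[OF p(1)] \<open>k > 0\<close>] by simp
  have "prime_factors n = prime_factors (p ^ k) \<union> prime_factors m"
    unfolding n using \<open>m > 0\<close> prime_gt_0_nat[OF p(1)] by (intro prime_factors_product) auto
  also have "prime_factors (p ^ k) = {p}"
    using p \<open>k > 0\<close> by (simp add: prime_factorization_prime_power)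
  finally have "prime_factors n = insert p (prime_factors m)" by simp
  with \<open>\<not> p dvd m\<close> show ?thesis
    by (intro that[of p m k] p(1) \<open>m > 0\<close> \<open>m < n\<close> n) auto
qed

lemma real_le_powr_of_2:
  assumes "\<epsilon> > 0"
  shows "real k + 1 \<le> (1 + 1 / (\<epsilon> * ln 2)) * 2 powr (\<epsilon> * k)"
proof -
  have pos: "\<epsilon> * ln 2 > 0" using assms by simp
  have "real k + 1 \<le> (1 + 1 / (\<epsilon> * ln 2)) * (1 + (\<epsilon> * ln 2) * k)"
    using pos assms by (simp add: distrib_left distrib_right)
  also have "1 + (\<epsilon> * ln 2) * k \<le> exp ((\<epsilon> * ln 2) * k)" by (rule exp_ge_add_one_self)
  also have "exp ((\<epsilon> * ln 2) * k) = 2 powr (\<epsilon> * k)" by (simp add: powr_def mult_ac)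
  finally show ?thesis using pos by (simp add: mult_left_mono)
qed

definition divisor_factor :: "real \<Rightarrow> nat \<Rightarrow> real" where
  "divisor_factor \<epsilon> p = (if real p powr \<epsilon> < 2 then 1 + 1 / (\<epsilon> * ln 2) else 1)"

lemma divisor_factor_ge_1: "\<epsilon> > 0 \<Longrightarrow> 1 \<le> divisor_factor \<epsilon> p"
  by (simp add: divisor_factor_def)

lemma card_prime_power_divisors_le:
  fixes p :: nat
  assumes "prime p" "\<epsilon> > 0"
  shows "real k + 1 \<le> divisor_factor \<epsilon> p * real (p ^ k) powr \<epsilon>"
proof -
  have power: "real (p ^ k) powr \<epsilon> = (real p powr \<epsilon>) ^ k"
    using assms(1) prime_gt_0_nat
    by (simp add: powr_power powr_realpow[symmetric] powr_powr mult.commute)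
  show ?thesis
  proof (cases "real p powr \<epsilon> < 2")
    case True
    have "2 powr (\<epsilon> * k) = (2 powr \<epsilon>) ^ k" by (simp add: powr_power mult.commute)
    also have "\<dots> \<le> real (p ^ k) powr \<epsilon>"
      unfolding power using assms prime_ge_2_nat[of p] by (intro power_mono powr_mono2) auto
    finally have "2 powr (\<epsilon> * k) \<le> real (p ^ k) powr \<epsilon>" .
    then have "(1 + 1 / (\<epsilon> * ln 2)) * 2 powr (\<epsilon> * k) \<le> (1 + 1 / (\<epsilon> * ln 2)) * real (p ^ k) powr \<epsilon>"
      using assms(2) by (intro mult_left_mono) auto
    then show ?thesis using real_le_powr_of_2[OF assms(2), of k] True
      by (simp add: divisor_factor_def)
  next
    case False
    have "real (Suc k) \<le> real (2 ^ k)" unfolding of_nat_le_iff using less_exp[of k]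
      by (rule Suc_leI)
    also have "\<dots> \<le> (real p powr \<epsilon>) ^ k" using False by (simp add: power_mono)
    finally show ?thesis using False power by (simp add: divisor_factor_def)
  qed
qed

lemma card_divisors_le_prod:
  fixes n :: nat
  assumes "\<epsilon> > 0" "n > 0"
  shows "real (card {a. a dvd n}) \<le> (\<Prod>p\<in>prime_factors n. divisor_factor \<epsilon> p) * real n powr \<epsilon>"
  using assms(2)
proof (induction n rule: less_induct)
  case (less n)
  show ?case
  proof (cases "n = 1")
    case False
    with less.prems have "n > 1" by simp
    then obtain p k m where p: "prime p" and m: "m > 0" "m < n" "n = p ^ k * m"
      and new: "p \<notin> prime_factors m" "prime_factors n = insert p (prime_factors m)"
      by (rule prime_power_decomposition_nat)
    have "real (card {a. a dvd n}) \<le> (real k + 1) * real (card {a. a dvd m})"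
      using of_nat_mono[OF card_divisors_prime_power_mult[OF p m(1), of k]]
      by (simp only: m(3) of_nat_mult of_nat_add of_nat_1)
    also have "\<dots> \<le> (divisor_factor \<epsilon> p * real (p ^ k) powr \<epsilon>) *
        ((\<Prod>p\<in>prime_factors m. divisor_factor \<epsilon> p) * real m powr \<epsilon>)"
      using divisor_factor_ge_1[OF assms(1), of p] m
      by (intro mult_mono card_prime_power_divisors_le p assms(1) less.IH) auto
    also have "\<dots> = (\<Prod>p\<in>prime_factors n. divisor_factor \<epsilon> p) * real n powr \<epsilon>"
      unfolding new(2) using new(1) by (simp add: m(3) powr_mult mult_ac)
    finally show ?thesis .
  qed simp
qed

text \<open>Only the primes \<open>p < 2\<^bsup>1/\<epsilon>\<^esup>\<close> contribute a factor exceeding \<open>p\<^bsup>\<epsilon>k\<^esup>\<close>.\<close>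

lemma divisor_bound:
  assumes "\<epsilon> > 0"
  obtains C where "C > 0" "\<And>n::nat. n > 0 \<Longrightarrow> real (card {a. a dvd n}) \<le> C * real n powr \<epsilon>"
proof -
  define P where "P = {p::nat. p > 0 \<and> real p powr \<epsilon> < 2}"
  have "P \<subseteq> {..nat \<lceil>2 powr (1 / \<epsilon>)\<rceil>}"
  proof
    fix p assume "p \<in> P"
    then have "(real p powr \<epsilon>) powr (1 / \<epsilon>) \<le> 2 powr (1 / \<epsilon>)" and "p > 0"
      using assms by (auto simp: P_def intro!: powr_mono2)
    then have "real p \<le> 2 powr (1 / \<epsilon>)" using assms by (simp add: powr_powr)
    then show "p \<in> {..nat \<lceil>2 powr (1 / \<epsilon>)\<rceil>}" by (simp add: le_nat_iff) linarith
  qed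
  then have finite_P: "finite P" by (rule finite_subset) simp
  have "(\<Prod>p\<in>prime_factors n. divisor_factor \<epsilon> p) \<le> (\<Prod>p\<in>P. divisor_factor \<epsilon> p)" for n
  proof -
    have "(\<Prod>p\<in>prime_factors n. divisor_factor \<epsilon> p) = (\<Prod>p\<in>prime_factors n \<inter> P. divisor_factor \<epsilon> p)"
      by (intro prod.mono_neutral_right)
        (auto simp: P_def divisor_factor_def in_prime_factors_iff prime_gt_0_nat)
    also have "\<dots> \<le> (\<Prod>p\<in>P. divisor_factor \<epsilon> p)"
      using finite_P order_trans[OF zero_le_one divisor_factor_ge_1[OF assms]]
        divisor_factor_ge_1[OF assms]
      by (intro prod_mono2) auto
    finally show ?thesis .
  qed
  then have "real (card {a. a dvd n}) \<le> (\<Prod>p\<in>P. divisor_factor \<epsilon> p) * real n powr \<epsilon>" if "n > 0" for n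
    using card_divisors_le_prod[OF assms that] by (meson mult_right_mono order_trans powr_ge_zero)
  moreover have "(\<Prod>p\<in>P. divisor_factor \<epsilon> p) > 0"
    using divisor_factor_ge_1[OF assms]
    by (intro prod_pos) (auto intro: less_le_trans[OF zero_less_one])
  ultimately show ?thesis by (intro that)
qed

section \<open>Trigonometric polynomials and periodic bump functions\<close>

lemma infdist_Ints_eq: "infdist t \<int> = \<bar>t - of_int (round t)\<bar>" for t :: real
proof (rule antisym)
  show "infdist t \<int> \<le> \<bar>t - of_int (round t)\<bar>"
    using infdist_le[of "of_int (round t)" \<int> t] by (simp add: dist_real_def)
  have "\<bar>t - of_int (round t)\<bar> \<le> dist t r" if "r \<in> \<int>" for r
    using that round_diff_minimal[of t] by (auto simp: dist_real_def elim!: Ints_cases)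
  then have "\<bar>t - of_int (round t)\<bar> \<le> (INF r\<in>\<int>. dist t r)"
    by (intro cINF_greatest) auto
  then show "\<bar>t - of_int (round t)\<bar> \<le> infdist t \<int>"
    by (subst infdist_notempty) auto
qed

lemma infdist_Ints_le_iff: "infdist t \<int> \<le> c \<longleftrightarrow> (\<exists>r::int. \<bar>t - of_int r\<bar> \<le> c)" for t :: real
  using round_diff_minimal[of t] by (auto simp: infdist_Ints_eq intro: order_trans)

definition trig_poly :: "(int \<Rightarrow> complex) \<Rightarrow> real \<Rightarrow> complex" where
  "trig_poly c t = (\<Sum>k | c k \<noteq> 0. c k * unit_exp (of_int k * t))"

lemma trig_poly_superset:
  assumes "finite S" "{k. c k \<noteq> 0} \<subseteq> S"
  shows "trig_poly c t = (\<Sum>k\<in>S. c k * unit_exp (of_int k * t))"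
  unfolding trig_poly_def using assms by (intro sum.mono_neutral_left) auto

lemma continuous_on_trig_poly [continuous_intros]:
  "continuous_on A f \<Longrightarrow> continuous_on A (\<lambda>x. trig_poly c (f x))"
  unfolding trig_poly_def by (intro continuous_intros)

lemma norm_trig_poly_le: "norm (trig_poly c t) \<le> (\<Sum>k | c k \<noteq> 0. norm (c k))"
  unfolding trig_poly_def by (intro order_trans[OF norm_sum] sum_mono) (simp add: norm_mult)

lemma trig_poly_update_0:
  assumes "finite {k. c k \<noteq> 0}"
  shows "trig_poly (c(0 := a)) t = trig_poly c t + (a - c 0)"
proof -
  define S where "S = insert 0 {k. c k \<noteq> 0}"
  have S: "finite S" using assms by (simp add: S_def)
  have "trig_poly (c(0 := a)) t = (\<Sum>k\<in>S. (c(0 := a)) k * unit_exp (of_int k * t))"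
    by (rule trig_poly_superset[OF S]) (auto simp: S_def split: if_splits)
  also have "\<dots> = (\<Sum>k\<in>S. c k * unit_exp (of_int k * t) + (if k = 0 then a - c 0 else 0))"
    by (intro sum.cong) (auto simp: algebra_simps)
  also have "\<dots> = (\<Sum>k\<in>S. c k * unit_exp (of_int k * t)) + (a - c 0)"
    using S by (simp add: sum.distrib S_def)
  also have "(\<Sum>k\<in>S. c k * unit_exp (of_int k * t)) = trig_poly c t"
    by (rule trig_poly_superset[OF S, symmetric]) (auto simp: S_def)
  finally show ?thesis .
qed

definition is_trig_poly :: "(real \<Rightarrow> complex) \<Rightarrow> bool" where
  "is_trig_poly f \<longleftrightarrow> (\<exists>c. finite {k. c k \<noteq> 0} \<and> f = trig_poly c)"

lemma is_trig_polyE: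
  assumes "is_trig_poly f"
  obtains c where "finite {k. c k \<noteq> 0}" "f = trig_poly c"
  using assms unfolding is_trig_poly_def by blast

lemma is_trig_polyI:
  assumes "finite S" "\<And>t. f t = (\<Sum>k\<in>S. c k * unit_exp (of_int k * t))"
  shows "is_trig_poly f"
  unfolding is_trig_poly_def
proof (intro exI conjI ext)
  let ?c = "\<lambda>k. if k \<in> S then c k else 0"
  have support: "{k. ?c k \<noteq> 0} \<subseteq> S" by auto
  then show "finite {k. ?c k \<noteq> 0}" using assms(1) by (rule finite_subset)
  show "f t = trig_poly ?c t" for t
    unfolding trig_poly_superset[OF assms(1) support] by (simp add: assms(2))
qed

lemma is_trig_poly_const: "is_trig_poly (\<lambda>t. a)"
  by (rule is_trig_polyI[of "{0}" _ "\<lambda>_. a"]) auto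

lemma is_trig_poly_add:
  assumes "is_trig_poly f" "is_trig_poly g"
  shows "is_trig_poly (\<lambda>t. f t + g t)"
proof -
  obtain c d where c: "finite {k. c k \<noteq> 0}" "f = trig_poly c"
    and d: "finite {k. d k \<noteq> 0}" "g = trig_poly d"
    using assms by (elim is_trig_polyE)
  let ?S = "{k. c k \<noteq> 0} \<union> {k. d k \<noteq> 0}"
  have "f t + g t = (\<Sum>k\<in>?S. (c k + d k) * unit_exp (of_int k * t))" for t
    using c(1) d(1) by (simp add: c(2) d(2) trig_poly_superset[of ?S] sum.distrib distrib_right)
  with c(1) d(1) show ?thesis by (intro is_trig_polyI) auto
qed

lemma is_trig_poly_sum:
  "(\<And>i. i \<in> A \<Longrightarrow> is_trig_poly (f i)) \<Longrightarrow> is_trig_poly (\<lambda>t. \<Sum>i\<in>A. f i t)"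
  by (induction A rule: infinite_finite_induct) (auto intro: is_trig_poly_add is_trig_poly_const)

lemma is_trig_poly_mult_unit_exp:
  assumes "is_trig_poly f"
  shows "is_trig_poly (\<lambda>t. a * unit_exp (of_int j * t) * f t)"
proof -
  obtain c where c: "finite {k. c k \<noteq> 0}" "f = trig_poly c"
    using assms by (rule is_trig_polyE)
  let ?S = "{k. c k \<noteq> 0}"
  have "a * unit_exp (of_int j * t) * f t = (\<Sum>k\<in>?S. a * c k * unit_exp (of_int (k + j) * t))" for t
    unfolding c(2) trig_poly_def sum_distrib_left of_int_add distrib_right unit_exp_add
    by (simp add: mult_ac)
  also have "(\<Sum>k\<in>?S. a * c k * unit_exp (of_int (k + j) * t)) =
      (\<Sum>k\<in>(\<lambda>k. k + j) ` ?S. a * c (k - j) * unit_exp (of_int k * t))" for t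
    by (subst sum.reindex) auto
  finally show ?thesis using c(1) by (intro is_trig_polyI) auto
qed

lemma is_trig_poly_mult:
  assumes "is_trig_poly f" "is_trig_poly g"
  shows "is_trig_poly (\<lambda>t. f t * g t)"
proof -
  obtain c where "f = trig_poly c" using assms(1) by (rule is_trig_polyE)
  then show ?thesis
    using assms(2)
    by (auto simp: trig_poly_def sum_distrib_right intro!: is_trig_poly_sum
        is_trig_poly_mult_unit_exp)
qed

lemma is_trig_poly_cos: "is_trig_poly (\<lambda>t. of_real (cos (2 * pi * t)))"
proof -
  have "of_real (cos (2 * pi * t)) =
      1 / 2 * unit_exp (of_int 1 * t) * 1 + 1 / 2 * unit_exp (of_int (- 1) * t) * 1" for t
    by (simp add: unit_exp_minus complex_eq_iff Re_unit_exp)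
  then show ?thesis
    by (simp only:) (intro is_trig_poly_add is_trig_poly_mult_unit_exp is_trig_poly_const)
qed

lemma is_trig_poly_polynomial_cos:
  assumes "real_polynomial_function g"
  shows "is_trig_poly (\<lambda>t. of_real (g (cos (2 * pi * t))))"
  using assms
proof (induction g rule: real_polynomial_function.induct)
  case (linear g)
  then obtain a where "g = (\<lambda>x. x * a)" using real_bounded_linear by blast
  then show ?case by (simp add: is_trig_poly_mult is_trig_poly_cos is_trig_poly_const)
qed (auto intro: is_trig_poly_const is_trig_poly_add is_trig_poly_mult)

lemma trig_poly_approximates_continuous_cos:
  fixes f :: "real \<Rightarrow> real"
  assumes "continuous_on {-1..1} f" "\<eta> > 0"
  obtains c where "finite {k. c k \<noteq> 0}"
    and "\<And>t. norm (of_real (f (cos (2 * pi * t))) - trig_poly c t) \<le> \<eta>"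
proof -
  obtain g where g: "real_polynomial_function g" "\<And>x. x \<in> {-1..1} \<Longrightarrow> \<bar>f x - g x\<bar> < \<eta>"
    using Stone_Weierstrass_real_polynomial_function[OF compact_Icc assms] by blast
  obtain c where c: "finite {k. c k \<noteq> 0}" "(\<lambda>t. of_real (g (cos (2 * pi * t)))) = trig_poly c"
    using is_trig_poly_polynomial_cos[OF g(1)] by (rule is_trig_polyE)
  have "norm (of_real (f (cos (2 * pi * t))) - trig_poly c t) \<le> \<eta>" for t
    using g(2)[of "cos (2 * pi * t)"] unfolding c(2)[symmetric]
    by (simp flip: of_real_diff)
  with c(1) show ?thesis by (rule that)
qed

lemma unit_exp_has_integral:
  assumes "j \<noteq> 0" "a \<le> b"
  shows "((\<lambda>t. unit_exp (j * t))
      has_integral (unit_exp (j * b) - unit_exp (j * a)) / (2 * pi * \<i> * j)) {a..b}"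
proof -
  have exp_eq: "unit_exp (j * t) = exp (t *\<^sub>R (2 * pi * \<i> * j))" for t
    by (simp add: unit_exp_def cis_conv_exp scaleR_conv_of_real mult_ac)
  have "((\<lambda>t. unit_exp (j * t) * (2 * pi * \<i> * j))
      has_integral unit_exp (j * b) - unit_exp (j * a)) {a..b}"
    unfolding exp_eq
    by (intro fundamental_theorem_of_calculus assms exp_scaleR_has_vector_derivative_right)
  from has_integral_divide[OF this, of "2 * pi * \<i> * j"] show ?thesis using assms(1) by simp
qed

lemma trig_poly_coeff_integral:
  assumes "finite {k. c k \<noteq> 0}"
  shows "((\<lambda>t. trig_poly c t * unit_exp (- (of_int k * t))) has_integral c k) {0..1}"
proof -
  define S where "S = insert k {k. c k \<noteq> 0}"
  have S: "finite S" using assms by (simp add: S_def)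
  have monomial: "((\<lambda>t. c j * unit_exp (of_int (j - k) * t))
      has_integral (if j = k then c k else 0)) {0..1}" for j
  proof (cases "j = k")
    case True
    then show ?thesis using has_integral_const_real[of "c k" 0 1] by simp
  next
    case False
    then have "((\<lambda>t. unit_exp (of_int (j - k) * t)) has_integral 0) {0..1}"
      using unit_exp_has_integral[of "of_int (j - k)" 0 1]
      unfolding mult_1_right unit_exp_of_int by simp
    from has_integral_mult_right[OF this, of "c j"] False show ?thesis by simp
  qed
  have "trig_poly c t * unit_exp (- (of_int k * t)) = (\<Sum>j\<in>S. c j * unit_exp (of_int (j - k) * t))"
    for t
    using S by (subst trig_poly_superset[of S])
      (auto simp: S_def sum_distrib_right mult.assoc left_diff_distrib simp flip: unit_exp_add
          intro!: sum.cong)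
  moreover have "(\<Sum>j\<in>S. if j = k then c k else 0) = c k" using S by (simp add: S_def)
  ultimately show ?thesis
    using has_integral_sum[OF S, of "\<lambda>j t. c j * unit_exp (of_int (j - k) * t)", OF monomial]
    by simp
qed

lemma norm_trig_poly_coeff_le:
  assumes "finite {k. c k \<noteq> 0}" "(g has_integral I) {0..1}" "\<And>t. norm (trig_poly c t) \<le> g t"
  shows "norm (c k) \<le> I"
proof -
  have "norm (integral {0..1} (\<lambda>t. trig_poly c t * unit_exp (- (of_int k * t)))) \<le>
      integral {0..1} g"
    using trig_poly_coeff_integral[OF assms(1), of k] assms(2,3)
    by (intro integral_norm_bound_integral) (auto simp: norm_mult has_integral_integrable)
  then show ?thesis
    using trig_poly_coeff_integral[OF assms(1), of k] assms(2) by (simp add: integral_unique)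
qed

definition trig_approximable :: "(int \<Rightarrow> real) \<Rightarrow> (real \<Rightarrow> real) \<Rightarrow> bool" where
  "trig_approximable w \<psi> \<longleftrightarrow> (\<forall>\<eta>>0. \<exists>c. finite {k. c k \<noteq> 0} \<and> c 0 = 1 \<and> (\<forall>k. norm (c k) \<le> w k) \<and>
     (\<forall>t. norm (of_real (\<psi> t) - trig_poly c t) \<le> \<eta>))"

lemma trig_approximableE:
  assumes "trig_approximable w \<psi>" "\<eta> > 0"
  obtains c where "finite {k. c k \<noteq> 0}" "c 0 = 1" "\<And>k. norm (c k) \<le> w k"
    "\<And>t. norm (of_real (\<psi> t) - trig_poly c t) \<le> \<eta>"
  using assms unfolding trig_approximable_def by metis

lemma trig_approximable_sequence:
  assumes "trig_approximable w \<psi>"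
  obtains c where "\<And>N. finite {k. c N k \<noteq> 0}" "\<And>N. c N 0 = 1" "\<And>N k. norm (c N k) \<le> w k"
    "\<And>N t. norm (of_real (\<psi> t) - trig_poly (c N) t) \<le> 1 / real (Suc N)"
    "uniform_limit UNIV (\<lambda>N. trig_poly (c N)) (\<lambda>t. of_real (\<psi> t)) sequentially"
proof -
  have "\<exists>c. finite {k. c k \<noteq> 0} \<and> c 0 = 1 \<and> (\<forall>k. norm (c k) \<le> w k) \<and>
      (\<forall>t. norm (of_real (\<psi> t) - trig_poly c t) \<le> 1 / real (Suc N))" for N
    using assms by (simp add: trig_approximable_def)
  then obtain c where c: "\<And>N. finite {k. c N k \<noteq> 0}" "\<And>N. c N 0 = 1" "\<And>N k. norm (c N k) \<le> w k"
    "\<And>N t. norm (of_real (\<psi> t) - trig_poly (c N) t) \<le> 1 / real (Suc N)" by metis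
  have "uniform_limit UNIV (\<lambda>N. trig_poly (c N)) (\<lambda>t. complex_of_real (\<psi> t)) sequentially"
  proof (rule uniform_limitI)
    fix e :: real assume "e > 0"
    then have "\<forall>\<^sub>F N in sequentially. 1 / real (Suc N) < e"
      using order_tendstoD(2)[OF LIMSEQ_inverse_real_of_nat] by (simp add: inverse_eq_divide)
    then show "\<forall>\<^sub>F N in sequentially. \<forall>t\<in>UNIV. dist (trig_poly (c N) t) (complex_of_real (\<psi> t)) < e"
      by eventually_elim
        (use c(4) in \<open>auto simp: dist_norm norm_minus_commute intro: le_less_trans\<close>)
  qed
  with c show ?thesis by (rule that)
qed

lemma norm_trig_poly_approximant_le:
  assumes "\<And>N t. norm (of_real (\<psi> t) - trig_poly (c N) t) \<le> 1 / real (Suc N)"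
  shows "norm (trig_poly (c N) t) \<le> (\<Sum>k | c 0 k \<noteq> 0. norm (c 0 k)) + 2"
proof -
  have "norm (trig_poly (c N) t) \<le> \<bar>\<psi> t\<bar> + 1 / real (Suc N)"
    using norm_triangle_sub[of "trig_poly (c N) t" "complex_of_real (\<psi> t)"] assms[of t N]
    by (simp add: norm_minus_commute)
  moreover have "1 / real (Suc N) \<le> 1" by simp
  moreover have "\<bar>\<psi> t\<bar> \<le> norm (trig_poly (c 0) t) + 1"
    using norm_triangle_sub[of "complex_of_real (\<psi> t)" "trig_poly (c 0) t"] assms[of t 0] by simp
  ultimately show ?thesis using norm_trig_poly_le[of "c 0" t] by linarith
qed

lemma continuous_on_trig_approximable:
  assumes "trig_approximable w \<psi>"
  shows "continuous_on A \<psi>"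
proof -
  obtain c where "uniform_limit UNIV (\<lambda>N. trig_poly (c N)) (\<lambda>t. complex_of_real (\<psi> t)) sequentially"
    using assms by (rule trig_approximable_sequence)
  then have "continuous_on UNIV (\<lambda>t. complex_of_real (\<psi> t))"
    by (rule uniform_limit_theorem[rotated]) (auto intro!: always_eventually continuous_intros)
  from continuous_on_Re[OF this] have "continuous_on UNIV \<psi>" by simp
  then show ?thesis by (rule continuous_on_subset) simp
qed

lemma trig_approximableI_density:
  assumes nonneg: "\<And>t. 0 \<le> \<psi> t" and int: "(\<psi> has_integral 1) {0..1}"
    and approx: "\<And>\<eta>. \<eta> > 0 \<Longrightarrow>
      \<exists>c. finite {k. c k \<noteq> 0} \<and> (\<forall>t. norm (of_real (\<psi> t) - trig_poly c t) \<le> \<eta>)"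
  shows "trig_approximable (\<lambda>_. 2) \<psi>"
  unfolding trig_approximable_def
proof (intro allI impI)
  fix \<eta> :: real assume "\<eta> > 0"
  define \<theta> where "\<theta> = min (\<eta> / 2) 1"
  have \<theta>: "\<theta> > 0" "\<theta> \<le> 1" "\<theta> + \<theta> \<le> \<eta>" using \<open>\<eta> > 0\<close> by (auto simp: \<theta>_def)
  obtain c where c: "finite {k. c k \<noteq> 0}" "\<And>t. norm (of_real (\<psi> t) - trig_poly c t) \<le> \<theta>"
    using approx[OF \<theta>(1)] by blast
  have mean: "norm (1 - c 0) \<le> \<theta>"
  proof -
    have "((\<lambda>t. complex_of_real (\<psi> t)) has_integral 1) {0..1}"
      using has_integral_linear[OF int bounded_linear_of_real[where ?'a = complex]]
      by (simp add: o_def)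
    from has_integral_diff[OF this trig_poly_coeff_integral[OF c(1), of 0]]
    have "((\<lambda>t. of_real (\<psi> t) - trig_poly c t) has_integral 1 - c 0) {0..1}" by simp
    from has_integral_bound_real[OF _ _ this, of \<theta> "{}"] show ?thesis using c(2) \<theta> by auto
  qed
  have "norm (trig_poly c t) \<le> \<psi> t + \<theta>" for t
    using norm_triangle_sub[of "trig_poly c t" "complex_of_real (\<psi> t)"] c(2)[of t] nonneg[of t]
    by (simp add: norm_minus_commute)
  moreover have "((\<lambda>t. \<psi> t + \<theta>) has_integral 1 + \<theta>) {0..1}"
    using has_integral_add[OF int has_integral_const_real[of \<theta> 0 1]] by simp
  ultimately have coeff: "norm (c k) \<le> 1 + \<theta>" for k by (intro norm_trig_poly_coeff_le[OF c(1)])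
  show "\<exists>c. finite {k. c k \<noteq> 0} \<and> c 0 = 1 \<and> (\<forall>k. norm (c k) \<le> 2) \<and>
      (\<forall>t. norm (of_real (\<psi> t) - trig_poly c t) \<le> \<eta>)"
  proof (intro exI conjI allI)
    show "finite {k. (c(0 := 1)) k \<noteq> 0}"
      by (rule finite_subset[of _ "insert 0 {k. c k \<noteq> 0}"]) (use c(1) in auto)
    show "norm ((c(0 := 1)) k) \<le> 2" for k using order_trans[OF coeff, of 2 k] \<theta>(2) by simp
    show "norm (of_real (\<psi> t) - trig_poly (c(0 := 1)) t) \<le> \<eta>" for t
      using norm_triangle_ineq4[of "of_real (\<psi> t) - trig_poly c t" "1 - c 0"] c(2)[of t] mean \<theta>(3)
      by (simp add: trig_poly_update_0[OF c(1)] diff_diff_add)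
  qed simp
qed

lemma cos_infdist_Ints: "cos (2 * pi * infdist t \<int>) = cos (2 * pi * t)"
proof -
  have "2 * pi * infdist t \<int> = \<bar>2 * pi * (t - of_int (round t))\<bar>"
    by (simp add: infdist_Ints_eq abs_mult)
  then have "cos (2 * pi * infdist t \<int>) = Re (unit_exp (t + of_int (- round t)))"
    by (simp only: cos_abs_real Re_unit_exp of_int_minus diff_conv_add_uminus)
  also have "\<dots> = cos (2 * pi * t)"
    by (simp only: unit_exp_add unit_exp_of_int mult_1_right Re_unit_exp)
  finally show ?thesis .
qed

lemma infdist_Ints_less_if_cos_less:
  assumes "cos (2 * pi * \<delta>) < cos (2 * pi * t)" "0 \<le> \<delta>" "\<delta> \<le> 1 / 2"
  shows "infdist t \<int> < \<delta>"
proof (rule ccontr)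
  assume "\<not> infdist t \<int> < \<delta>"
  moreover have "infdist t \<int> \<le> 1 / 2"
    using of_int_round_abs_le[of t] by (simp add: infdist_Ints_eq abs_minus_commute)
  ultimately have "cos (2 * pi * infdist t \<int>) \<le> cos (2 * pi * \<delta>)"
    using assms by (intro cos_monotone_0_pi_le) auto
  then show False using assms(1) by (simp add: cos_infdist_Ints)
qed

lemma cosine_bump:
  assumes "0 < \<delta>" "\<delta> \<le> 1 / 2"
  obtains \<psi> :: "real \<Rightarrow> real" where "\<And>t. 0 \<le> \<psi> t" "\<And>t. \<psi> t \<noteq> 0 \<Longrightarrow> infdist t \<int> \<le> \<delta>"
    "trig_approximable (\<lambda>_. 2) \<psi>"
proof -
  define g where "g t = max 0 (cos (2 * pi * t) - cos (2 * pi * \<delta>))" for t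
  define I where "I = integral {0..1} g"
  have cont: "continuous_on A g" for A unfolding g_def by (intro continuous_intros)
  have nonneg: "0 \<le> g t" for t by (simp add: g_def)
  have "cos (2 * pi * \<delta>) < cos 0" using assms by (intro cos_monotone_0_pi) auto
  then have "g 0 > 0" by (simp add: g_def)
  then have "I \<noteq> 0"
    unfolding I_def by (subst integral_eq_0_iff) (auto intro!: cont nonneg bexI[of _ 0])
  moreover have "I \<ge> 0"
    unfolding I_def by (intro integral_nonneg integrable_continuous_real cont nonneg)
  ultimately have "I > 0" by simp
  show ?thesis
  proof (rule that[of "\<lambda>t. g t / I"])
    show "0 \<le> g t / I" for t using \<open>I > 0\<close> nonneg by simp
    show "infdist t \<int> \<le> \<delta>" if "g t / I \<noteq> 0" for t
      using that infdist_Ints_less_if_cos_less[of \<delta> t] assms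
      by (simp add: g_def max_def split: if_splits)
    show "trig_approximable (\<lambda>_. 2) (\<lambda>t. g t / I)"
    proof (rule trig_approximableI_density)
      have "(g has_integral I) {0..1}"
        unfolding I_def by (intro integrable_integral integrable_continuous_real cont)
      from has_integral_divide[OF this, of I] show "((\<lambda>t. g t / I) has_integral 1) {0..1}"
        using \<open>I > 0\<close> by simp
      fix \<eta> :: real assume "\<eta> > 0"
      have "continuous_on {-1..1} (\<lambda>u. max 0 (u - cos (2 * pi * \<delta>)) / I)"
        using \<open>I > 0\<close> by (intro continuous_intros) auto
      then show "\<exists>c. finite {k. c k \<noteq> 0} \<and> (\<forall>t. norm (of_real (g t / I) - trig_poly c t) \<le> \<eta>)"
        unfolding g_def using \<open>\<eta> > 0\<close> by (rule trig_poly_approximates_continuous_cos) blast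
    qed (use \<open>I > 0\<close> nonneg in simp)
  qed
qed

definition local_average :: "real \<Rightarrow> (real \<Rightarrow> 'a::banach) \<Rightarrow> real \<Rightarrow> 'a" where
  "local_average h f t = (1 / (2 * h)) *\<^sub>R integral {- h..h} (\<lambda>s. f (t + s))"

lemma integrable_on_translate:
  fixes f :: "real \<Rightarrow> 'a::banach"
  assumes "continuous_on UNIV f"
  shows "(\<lambda>s. f (t + s)) integrable_on {a..b}"
  by (intro integrable_continuous_real continuous_on_compose2[OF assms])
    (auto intro!: continuous_intros)

lemma norm_local_average_le:
  fixes f :: "real \<Rightarrow> 'a::banach"
  assumes "continuous_on UNIV f" "\<And>s. norm (f s) \<le> B" "h > 0"
  shows "norm (local_average h f t) \<le> B"
proof -
  have "norm (integral {- h..h} (\<lambda>s. f (t + s))) \<le> B * (h - (- h))"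
    using assms
    by (intro integral_bound continuous_on_compose2[OF assms(1)]) (auto intro!: continuous_intros)
  then show ?thesis using assms(3) by (simp add: local_average_def field_simps)
qed

lemma local_average_diff:
  fixes f g :: "real \<Rightarrow> 'a::banach"
  assumes "continuous_on UNIV f" "continuous_on UNIV g"
  shows "local_average h (\<lambda>s. f s - g s) t = local_average h f t - local_average h g t"
  unfolding local_average_def
  by (subst Henstock_Kurzweil_Integration.integral_diff)
    (auto intro!: integrable_on_translate assms simp: scaleR_diff_right)

lemma local_average_of_real:
  assumes "continuous_on UNIV f"
  shows "local_average h (\<lambda>s. complex_of_real (f s)) t = of_real (local_average h f t)"
  using integral_unique[OF has_integral_linear[OF
      integrable_integral[OF integrable_on_translate[OF assms]]
        bounded_linear_of_real[where ?'a = complex]]]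
  by (simp add: local_average_def o_def scaleR_conv_of_real)

lemma local_average_nonneg:
  fixes f :: "real \<Rightarrow> real"
  assumes "continuous_on UNIV f" "\<And>s. 0 \<le> f s" "h > 0"
  shows "0 \<le> local_average h f t"
  unfolding local_average_def using assms
  by (intro scaleR_nonneg_nonneg integral_nonneg integrable_on_translate) auto

lemma local_average_nonzeroE:
  assumes "local_average h f t \<noteq> 0"
  obtains s where "\<bar>s\<bar> \<le> h" "f (t + s) \<noteq> 0"
proof -
  have "\<exists>s\<in>{- h..h}. f (t + s) \<noteq> 0"
  proof (rule ccontr)
    assume "\<not> ?thesis"
    then have "integral {- h..h} (\<lambda>s. f (t + s)) = integral {- h..h} (\<lambda>s. 0)"
      by (intro Henstock_Kurzweil_Integration.integral_cong) auto
    then show False using assms by (simp add: local_average_def)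
  qed
  then obtain s where "s \<in> {- h..h}" "f (t + s) \<noteq> 0" by blast
  then show ?thesis by (intro that[of s]) auto
qed

lemma local_average_trig_poly:
  assumes "finite {k. c k \<noteq> 0}"
  shows "local_average h (trig_poly c) t =
    trig_poly (\<lambda>k. c k * local_average h (\<lambda>s. unit_exp (of_int k * s)) 0) t"
proof -
  let ?I = "\<lambda>k. integral {- h..h} (\<lambda>s. unit_exp (of_int k * s))"
  have "((\<lambda>s. c k * unit_exp (of_int k * t) * unit_exp (of_int k * s)) has_integral
      c k * unit_exp (of_int k * t) * ?I k) {- h..h}" for k
    by (intro has_integral_mult_right integrable_integral integrable_continuous_real
        continuous_intros)
  from has_integral_sum[OF assms this]
  have "integral {- h..h} (\<lambda>s. trig_poly c (t + s)) =
      (\<Sum>k | c k \<noteq> 0. c k * unit_exp (of_int k * t) * ?I k)"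
    by (simp add: trig_poly_def distrib_left unit_exp_add mult.assoc integral_unique)
  moreover have "{k. c k * local_average h (\<lambda>s. unit_exp (of_int k * s)) 0 \<noteq> 0} \<subseteq> {k. c k \<noteq> 0}"
    by auto
  ultimately show ?thesis
    unfolding trig_poly_superset[OF assms] local_average_def
    by (subst trig_poly_superset[OF assms]) (auto simp: scaleR_sum_right mult_ac)
qed

lemma norm_local_average_unit_exp_le:
  assumes "h > 0"
  shows "norm (local_average h (\<lambda>s. unit_exp (of_int k * s)) 0) \<le> 2 / (1 + h * \<bar>of_int k\<bar>)"
proof (cases "k = 0")
  case True
  then show ?thesis using assms by (simp add: local_average_def)
next
  case False
  define \<sigma> where "\<sigma> = local_average h (\<lambda>s. unit_exp (of_int k * s)) 0"
  define x where "x = h * \<bar>real_of_int k\<bar>"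
  have "x > 0" using assms False by (simp add: x_def)
  have "norm \<sigma> \<le> 1"
    unfolding \<sigma>_def by (rule norm_local_average_le) (use assms in \<open>auto intro!: continuous_intros\<close>)
  moreover have "norm \<sigma> * x \<le> 1"
  proof -
    have "\<sigma> = (1 / (2 * h)) *\<^sub>R ((unit_exp (of_int k * h) - unit_exp (of_int k * (- h))) /
        (2 * pi * \<i> * of_int k))"
      using unit_exp_has_integral[of "of_int k" "- h" h] False assms
      by (simp add: \<sigma>_def local_average_def integral_unique)
    then have "norm \<sigma> * x = norm (unit_exp (of_int k * h) - unit_exp (of_int k * (- h))) / (4 * pi)"
      using assms False by (simp add: x_def norm_mult norm_divide)
    also have "\<dots> \<le> 2 / (4 * pi)"
      using norm_triangle_ineq4[of "unit_exp (of_int k * h)" "unit_exp (of_int k * (- h))"]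
      by (intro divide_right_mono) auto
    also have "\<dots> \<le> 1" using pi_gt3 by simp
    finally show ?thesis .
  qed
  ultimately have "norm \<sigma> * (1 + x) \<le> 2" by (simp add: distrib_left)
  then show ?thesis using \<open>x > 0\<close> by (simp add: \<sigma>_def[symmetric] x_def[symmetric] pos_le_divide_eq)
qed

lemma trig_approximable_local_average:
  assumes "trig_approximable w \<psi>" "h > 0"
  shows "trig_approximable (\<lambda>k. w k * (2 / (1 + h * \<bar>of_int k\<bar>))) (local_average h \<psi>)"
  unfolding trig_approximable_def
proof (intro allI impI)
  fix \<eta> :: real assume "\<eta> > 0"
  with assms(1) obtain c where c: "finite {k. c k \<noteq> 0}" "c 0 = 1" "\<And>k. norm (c k) \<le> w k"
    "\<And>t. norm (of_real (\<psi> t) - trig_poly c t) \<le> \<eta>" by (rule trig_approximableE) (rule that)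
  define \<sigma> where "\<sigma> k = local_average h (\<lambda>s. unit_exp (of_int k * s)) 0" for k
  have cont: "continuous_on UNIV \<psi>" using assms(1) by (rule continuous_on_trig_approximable)
  have cont_trig: "continuous_on UNIV (trig_poly c)" by (intro continuous_intros)
  show "\<exists>c. finite {k. c k \<noteq> 0} \<and> c 0 = 1 \<and> (\<forall>k. norm (c k) \<le> w k * (2 / (1 + h * \<bar>of_int k\<bar>))) \<and>
      (\<forall>t. norm (of_real (local_average h \<psi> t) - trig_poly c t) \<le> \<eta>)"
  proof (intro exI conjI allI)
    show "finite {k. c k * \<sigma> k \<noteq> 0}" by (rule finite_subset[OF _ c(1)]) auto
    show "c 0 * \<sigma> 0 = 1" using assms(2) c(2) by (simp add: \<sigma>_def local_average_def)
    show "norm (c k * \<sigma> k) \<le> w k * (2 / (1 + h * \<bar>of_int k\<bar>))" for k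
      unfolding norm_mult \<sigma>_def using order_trans[OF norm_ge_zero c(3)]
      by (intro mult_mono c(3) norm_local_average_unit_exp_le assms(2)) auto
    have "of_real (local_average h \<psi> t) - trig_poly (\<lambda>k. c k * \<sigma> k) t =
        local_average h (\<lambda>s. of_real (\<psi> s) - trig_poly c s) t" for t
      unfolding \<sigma>_def local_average_trig_poly[OF c(1), symmetric]
        local_average_of_real[OF cont, symmetric]
      by (intro local_average_diff[symmetric] continuous_on_of_real cont cont_trig)
    then show "norm (of_real (local_average h \<psi> t) - trig_poly (\<lambda>k. c k * \<sigma> k) t) \<le> \<eta>" for t
      by (simp only:) (intro norm_local_average_le c(4) assms(2) continuous_intros cont)
  qed
qed

lemma smoothed_cosine_bump:
  assumes "0 < \<delta>" "\<delta> \<le> 1 / 2" "h > 0"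
  shows "\<exists>\<psi>. (\<forall>t. 0 \<le> \<psi> t) \<and> (\<forall>t. \<psi> t \<noteq> 0 \<longrightarrow> infdist t \<int> \<le> \<delta> + real j * h) \<and>
    trig_approximable (\<lambda>k. 2 * (2 / (1 + h * \<bar>of_int k\<bar>)) ^ j) \<psi>"
proof (induction j)
  case 0
  show ?case by (rule cosine_bump[OF assms(1,2)]) auto
next
  case (Suc j)
  then obtain \<psi> where \<psi>: "\<And>t. 0 \<le> \<psi> t" "\<And>t. \<psi> t \<noteq> 0 \<Longrightarrow> infdist t \<int> \<le> \<delta> + real j * h"
    "trig_approximable (\<lambda>k. 2 * (2 / (1 + h * \<bar>of_int k\<bar>)) ^ j) \<psi>" by blast
  show ?case
  proof (intro exI conjI allI impI)
    show "0 \<le> local_average h \<psi> t" for t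
      by (intro local_average_nonneg continuous_on_trig_approximable[OF \<psi>(3)] \<psi>(1) assms(3))
    fix t assume "local_average h \<psi> t \<noteq> 0"
    then obtain s where s: "\<bar>s\<bar> \<le> h" "\<psi> (t + s) \<noteq> 0" by (rule local_average_nonzeroE)
    have "infdist t \<int> \<le> infdist (t + s) \<int> + dist t (t + s)" by (rule infdist_triangle)
    then show "infdist t \<int> \<le> \<delta> + real (Suc j) * h"
      using \<psi>(2)[OF s(2)] s(1) by (simp add: dist_real_def distrib_right)
  next
    show "trig_approximable (\<lambda>k. 2 * (2 / (1 + h * \<bar>of_int k\<bar>)) ^ Suc j) (local_average h \<psi>)"
      using trig_approximable_local_average[OF \<psi>(3) assms(3)] by (simp add: mult_ac)
  qed
qed

definition bump_coeffs :: "nat \<Rightarrow> real \<Rightarrow> (int \<Rightarrow> complex) \<Rightarrow> bool" where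
  "bump_coeffs K \<delta> c \<longleftrightarrow> finite {k. c k \<noteq> 0} \<and> c 0 = 1 \<and>
     (\<forall>k. norm (c k) \<le> 2 * (4 * real K / (1 + \<delta> * \<bar>of_int k\<bar>)) ^ K)"

lemma periodic_bump:
  assumes "0 < \<delta>" "\<delta> \<le> 1" "K > 0"
  obtains \<psi> :: "real \<Rightarrow> real" and c and B
  where "continuous_on UNIV \<psi>" "\<And>t. 0 \<le> \<psi> t" "\<And>t. \<psi> t \<noteq> 0 \<Longrightarrow> infdist t \<int> \<le> \<delta>"
    and "\<And>N. bump_coeffs K \<delta> (c N)" "\<And>t. (\<lambda>N. trig_poly (c N) t) \<longlonglongrightarrow> of_real (\<psi> t)"
      "\<And>N t. norm (trig_poly (c N) t) \<le> B"
proof -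
  define h where "h = \<delta> / (2 * K)"
  have h: "h > 0" "\<delta> / 2 + K * h = \<delta>" using assms by (simp_all add: h_def field_simps)
  obtain \<psi> where nonneg: "\<And>t. 0 \<le> \<psi> t" and support: "\<And>t. \<psi> t \<noteq> 0 \<Longrightarrow> infdist t \<int> \<le> \<delta>"
    and approx: "trig_approximable (\<lambda>k. 2 * (2 / (1 + h * \<bar>of_int k\<bar>)) ^ K) \<psi>"
    using smoothed_cosine_bump[of "\<delta> / 2" h K] assms h by auto
  obtain c where c: "\<And>N. finite {k. c N k \<noteq> 0}" "\<And>N. c N 0 = 1"
      "\<And>N k. norm (c N k) \<le> 2 * (2 / (1 + h * \<bar>of_int k\<bar>)) ^ K"
      "\<And>N t. norm (of_real (\<psi> t) - trig_poly (c N) t) \<le> 1 / real (Suc N)"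
    and lim: "uniform_limit UNIV (\<lambda>N. trig_poly (c N)) (\<lambda>t. of_real (\<psi> t)) sequentially"
    using approx by (rule trig_approximable_sequence) (rule that)
  have coeff: "norm (c N k) \<le> 2 * (4 * real K / (1 + \<delta> * \<bar>of_int k\<bar>)) ^ K" for N k
  proof -
    have "1 + \<delta> * \<bar>of_int k\<bar> \<le> 2 * real K * (1 + h * \<bar>of_int k\<bar>)"
      using assms by (simp add: h_def distrib_left)
    then have "2 / (1 + h * \<bar>of_int k\<bar>) \<le> 4 * real K / (1 + \<delta> * \<bar>of_int k\<bar>)"
      using assms h by (simp add: divide_simps add_pos_nonneg split: if_splits)
    then have "(2 / (1 + h * \<bar>of_int k\<bar>)) ^ K \<le> (4 * real K / (1 + \<delta> * \<bar>of_int k\<bar>)) ^ K"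
      using h by (intro power_mono) auto
    then show ?thesis using c(3)[of N k] by linarith
  qed
  note bound = norm_trig_poly_approximant_le[OF c(4)]
  show ?thesis
    by (rule that[of \<psi> c])
      (use continuous_on_trig_approximable[OF approx] nonneg support c coeff bound
          tendsto_uniform_limitI[OF lim]
        in \<open>auto simp: bump_coeffs_def\<close>)
qed

section \<open>Weak compactness\<close>

text \<open>Schoenberg's space-filling curve \<open>\<psi>\<close> is continuous and has a Borel right inverse \<open>g\<close> given by
  interleaving binary digits. Pushing measures forward along \<open>g\<close> and back along \<open>\<psi>\<close> reduces the
  selection theorem for measures on a cube to Helly's theorem on the line.\<close>

definition schoenberg_wave :: "real \<Rightarrow> real" where
  "schoenberg_wave t = max 0 (min 1 (1 / 2 - cos (pi * t)))"

lemma schoenberg_wave_bounds: "0 \<le> schoenberg_wave t" "schoenberg_wave t \<le> 1"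
  by (auto simp: schoenberg_wave_def)

lemma continuous_on_schoenberg_wave [continuous_intros]:
  fixes f :: "'a::t2_space \<Rightarrow> real"
  shows "continuous_on A f \<Longrightarrow> continuous_on A (\<lambda>x. schoenberg_wave (f x))"
  unfolding schoenberg_wave_def by (intro continuous_intros)

lemma schoenberg_wave_digit:
  fixes a n :: int
  assumes "a \<in> {0, 1}" "0 \<le> s" "s \<le> 1 / 3"
  shows "schoenberg_wave (2 * of_int n + 2 * of_int a / 3 + s) = of_int a"
proof -
  define y where "y = 2 * of_int a / 3 + s"
  have "pi * (2 * of_int n + y) = pi * y + of_int n * (2 * pi)" by (simp add: algebra_simps)
  then have periodic: "cos (pi * (2 * of_int n + y)) = cos (pi * y)"
    using cos_int_2pin sin_int_2pin[of n] by (simp add: cos_add mult.commute mult.left_commute)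
  show ?thesis
  proof (cases "a = 0")
    case True
    have "cos (pi * y) \<ge> cos (pi / 3)"
      using assms True by (intro cos_monotone_0_pi_le) (auto simp: y_def field_simps)
    then show ?thesis using True periodic by (simp add: schoenberg_wave_def y_def cos_60 add.assoc)
  next
    case False
    then have "a = 1" using assms by auto
    have "cos (pi * y) \<le> cos (pi * (2 / 3))"
      using assms \<open>a = 1\<close> pi_gt_zero
      by (intro cos_monotone_0_pi_le mult_left_mono) (auto simp: y_def)
    also have "pi * (2 / 3) = pi - pi / 3" by (simp add: field_simps)
    also have "cos (pi - pi / 3) = - (1 / 2)" by (simp only: cos_pi_minus cos_60)
    finally show ?thesis using \<open>a = 1\<close> periodic by (simp add: schoenberg_wave_def y_def add.assoc)
  qed
qed

definition ternary_point :: "(nat \<Rightarrow> int) \<Rightarrow> real" where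
  "ternary_point a = (\<Sum>i. 2 * of_int (a i) / 3 ^ Suc i)"

lemma
  assumes "\<And>i. a i \<in> {0, 1 :: int}"
  shows summable_ternary_point: "summable (\<lambda>i. 2 * real_of_int (a i) / 3 ^ Suc i)"
    and ternary_point_nonneg: "0 \<le> ternary_point a"
    and ternary_point_le_1: "ternary_point a \<le> 1"
proof -
  have geometric: "(\<lambda>i. 2 * (1 / 3) ^ Suc i :: real) sums 1"
    using sums_mult[OF geometric_sums[of "1 / 3 :: real"], of "2 / 3"] by (simp add: mult.assoc)
  have a: "0 \<le> real_of_int (a i)" "real_of_int (a i) \<le> 1" for i using assms[of i] by auto
  then have dominated: "2 * real_of_int (a i) / 3 ^ Suc i \<le> 2 * (1 / 3) ^ Suc i" for i
    by (simp add: power_one_over divide_simps)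
  show summable: "summable (\<lambda>i. 2 * real_of_int (a i) / 3 ^ Suc i)"
    by (rule summable_comparison_test'[OF sums_summable[OF geometric], of 0])
      (use a dominated in auto)
  show "0 \<le> ternary_point a"
    unfolding ternary_point_def by (intro suminf_nonneg summable) (use a in auto)
  show "ternary_point a \<le> 1"
    using suminf_le[OF dominated summable sums_summable[OF geometric]] sums_unique[OF geometric]
    by (simp add: ternary_point_def)
qed

lemma ternary_point_shift:
  assumes "\<And>i. a i \<in> {0, 1}"
  shows "ternary_point a = 2 * of_int (a 0) / 3 + ternary_point (\<lambda>i. a (Suc i)) / 3"
proof -
  have "(\<Sum>i. 2 * real_of_int (a (Suc i)) / 3 ^ Suc (Suc i)) = ternary_point (\<lambda>i. a (Suc i)) / 3"
    unfolding ternary_point_def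
    using suminf_divide[OF summable_ternary_point, of "\<lambda>i. a (Suc i)" 3] assms by simp
  then show ?thesis
    using suminf_split_head[OF summable_ternary_point, of a] assms by (simp add: ternary_point_def)
qed

lemma schoenberg_wave_ternary_point:
  assumes a: "\<And>i. a i \<in> {0, 1}"
  shows "schoenberg_wave (3 ^ k * ternary_point a) = of_int (a k)"
proof -
  have "\<exists>n. 3 ^ k * ternary_point a = 2 * of_int n + ternary_point (\<lambda>i. a (k + i))"
  proof (induction k)
    case (Suc k)
    then obtain n where "3 ^ k * ternary_point a = 2 * of_int n + ternary_point (\<lambda>i. a (k + i))" ..
    then have "3 ^ Suc k * ternary_point a =
        2 * of_int (3 * n + a k) + ternary_point (\<lambda>i. a (Suc k + i))"
      using ternary_point_shift[of "\<lambda>i. a (k + i)"] a by simp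
    then show ?case ..
  qed (auto intro: exI[of _ 0])
  then obtain n where "3 ^ k * ternary_point a =
      2 * of_int n + 2 * of_int (a k) / 3 + ternary_point (\<lambda>i. a (k + Suc i)) / 3"
    using ternary_point_shift[of "\<lambda>i. a (k + i)"] a by auto
  then show ?thesis
    using a ternary_point_nonneg[of "\<lambda>i. a (k + Suc i)"] ternary_point_le_1[of "\<lambda>i. a (k + Suc i)"]
    by (simp only:) (intro schoenberg_wave_digit, auto)
qed

definition binary_digit :: "real \<Rightarrow> nat \<Rightarrow> int" where
  "binary_digit x j = \<lfloor>2 ^ Suc j * x\<rfloor> mod 2"

lemma binary_digit_cases: "binary_digit x j \<in> {0, 1}"
  by (auto simp: binary_digit_def)

lemma sum_binary_digits:
  assumes "0 \<le> x" "x < 1"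
  shows "(\<Sum>j<J. real_of_int (binary_digit x j) * (1 / 2) ^ Suc j) = of_int \<lfloor>2 ^ J * x\<rfloor> / 2 ^ J"
proof (induction J)
  case 0
  have "\<lfloor>x\<rfloor> = 0" using assms by (simp add: floor_eq_iff)
  then show ?case by simp
next
  case (Suc J)
  have "\<lfloor>2 ^ J * x\<rfloor> = \<lfloor>2 ^ Suc J * x\<rfloor> div 2"
    using floor_divide_real_eq_div[of 2 "2 ^ Suc J * x"] by simp
  then have "\<lfloor>2 ^ Suc J * x\<rfloor> = 2 * \<lfloor>2 ^ J * x\<rfloor> + binary_digit x J"
    unfolding binary_digit_def by (simp only: mult_div_mod_eq)
  from arg_cong[OF this, of real_of_int]
  have "of_int \<lfloor>2 ^ Suc J * x\<rfloor> / 2 ^ Suc J =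
      of_int \<lfloor>2 ^ J * x\<rfloor> / 2 ^ J + real_of_int (binary_digit x J) * (1 / 2) ^ Suc J"
    by (simp only: of_int_add of_int_mult add_divide_distrib) (simp add: power_one_over field_simps)
  then show ?case using Suc by (simp only: sum.lessThan_Suc)
qed

lemma binary_digits_sums:
  assumes "0 \<le> x" "x < 1"
  shows "(\<lambda>j. of_int (binary_digit x j) * (1 / 2) ^ Suc j) sums x"
  unfolding sums_def sum_binary_digits[OF assms]
proof (rule LIM_zero_cancel, rule Lim_null_comparison)
  have "\<bar>of_int \<lfloor>2 ^ J * x\<rfloor> - 2 ^ J * x\<bar> \<le> 1" for J by linarith
  then have "\<bar>of_int \<lfloor>2 ^ J * x\<rfloor> - 2 ^ J * x\<bar> / 2 ^ J \<le> 1 / 2 ^ J" for J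
    by (intro divide_right_mono) auto
  moreover have "of_int \<lfloor>2 ^ J * x\<rfloor> / 2 ^ J - x = (of_int \<lfloor>2 ^ J * x\<rfloor> - 2 ^ J * x) / 2 ^ J" for J
    by (simp add: diff_divide_distrib)
  ultimately show "\<forall>\<^sub>F J in sequentially. norm (of_int \<lfloor>2 ^ J * x\<rfloor> / 2 ^ J - x) \<le> (1 / 2) ^ J"
    by (simp add: power_one_over)
  show "(\<lambda>J. (1 / 2 :: real) ^ J) \<longlonglongrightarrow> 0" by (rule LIMSEQ_power_zero) simp
qed

definition schoenberg_coord :: "nat \<Rightarrow> nat \<Rightarrow> real \<Rightarrow> real" where
  "schoenberg_coord m i t = (\<Sum>j. schoenberg_wave (3 ^ (j * m + i) * t) * (1 / 2) ^ Suc j)"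

lemma continuous_on_schoenberg_coord: "continuous_on UNIV (schoenberg_coord m i)"
  unfolding schoenberg_coord_def[abs_def]
proof (rule uniform_limit_theorem)
  let ?w = "\<lambda>j t. schoenberg_wave (3 ^ (j * m + i) * t) * (1 / 2) ^ Suc j"
  have "summable (\<lambda>j. (1 / 2 :: real) ^ Suc j)" using power_half_series by (rule sums_summable)
  then show "uniform_limit UNIV (\<lambda>n t. \<Sum>j<n. ?w j t) (\<lambda>t. \<Sum>j. ?w j t) sequentially"
    by (rule Weierstrass_m_test[rotated]) (use schoenberg_wave_bounds in \<open>auto simp: abs_mult\<close>)
  show "\<forall>\<^sub>F n in sequentially. continuous_on UNIV (\<lambda>t. \<Sum>j<n. ?w j t)"
    by (intro always_eventually allI continuous_intros)
qed simp

lemma schoenberg_coord_ternary_point: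
  assumes "\<And>k. a k \<in> {0, 1}" "\<And>j. a (j * m + i) = binary_digit x j" "0 \<le> x" "x < 1"
  shows "schoenberg_coord m i (ternary_point a) = x"
  using binary_digits_sums[OF assms(3,4)]
  by (simp add: schoenberg_coord_def schoenberg_wave_ternary_point[OF assms(1)] assms(2) sums_iff)

lemma schoenberg_curve:
  obtains \<psi> :: "real \<Rightarrow> 'a::euclidean_space" and g :: "'a \<Rightarrow> real"
  where "continuous_on UNIV \<psi>" "g \<in> borel_measurable borel" "\<And>x. g x \<in> {0..1}"
    "\<And>x. (\<And>b. b \<in> Basis \<Longrightarrow> 0 \<le> x \<bullet> b \<and> x \<bullet> b < 1) \<Longrightarrow> \<psi> (g x) = x"
proof -
  define m where "m = DIM('a)"
  have "m > 0" by (simp add: m_def)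
  obtain B :: "nat \<Rightarrow> 'a" where B: "bij_betw B {0..<m} Basis"
    unfolding m_def using ex_bij_betw_nat_finite[OF finite_Basis] by blast
  define index where "index = the_inv_into {0..<m} B"
  have index: "index b < m" "B (index b) = b" if "b \<in> Basis" for b
    using that B the_inv_into_into[of B "{0..<m}" b "{0..<m}"] f_the_inv_into_f_bij_betw[OF B, of b]
    by (auto simp: index_def bij_betw_def)
  define digits where "digits x k = binary_digit (x \<bullet> B (k mod m)) (k div m)" for x k
  have digits: "digits x k \<in> {0, 1}" for x k unfolding digits_def by (rule binary_digit_cases)
  define g where "g x = ternary_point (digits x)" for x
  define \<psi> where "\<psi> t = (\<Sum>b\<in>Basis. schoenberg_coord m (index b) t *\<^sub>R b)" for t
  show ?thesis
  proof (rule that[of \<psi> g])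
    show "continuous_on UNIV \<psi>"
      unfolding \<psi>_def by (intro continuous_intros continuous_on_schoenberg_coord)
    show "g \<in> borel_measurable borel"
      unfolding g_def ternary_point_def digits_def binary_digit_def by measurable
    show "g x \<in> {0..1}" for x
      using ternary_point_nonneg[OF digits] ternary_point_le_1[OF digits] by (simp add: g_def)
    fix x :: 'a assume x: "\<And>b. b \<in> Basis \<Longrightarrow> 0 \<le> x \<bullet> b \<and> x \<bullet> b < 1"
    have "schoenberg_coord m (index b) (g x) = x \<bullet> b" if b: "b \<in> Basis" for b
      unfolding g_def
      by (rule schoenberg_coord_ternary_point[OF digits])
        (use x[OF b] index[OF b] \<open>m > 0\<close> in \<open>simp_all add: digits_def\<close>)
    then show "\<psi> (g x) = x" unfolding \<psi>_def by (simp add: euclidean_representation)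
  qed
qed

lemma cball_continuous_parametrization:
  fixes R :: real
  obtains \<phi> :: "real \<Rightarrow> 'a::euclidean_space" and \<gamma> :: "'a \<Rightarrow> real"
  where "continuous_on UNIV \<phi>" "\<gamma> \<in> borel_measurable borel" "\<And>x. \<gamma> x \<in> {0..1}"
    "\<And>x. norm x \<le> R \<Longrightarrow> \<phi> (\<gamma> x) = x"
proof -
  obtain \<psi> :: "real \<Rightarrow> 'a" and g where curve: "continuous_on UNIV \<psi>" "g \<in> borel_measurable borel"
    "\<And>x. g x \<in> {0..1}" "\<And>x. (\<And>b. b \<in> Basis \<Longrightarrow> 0 \<le> x \<bullet> b \<and> x \<bullet> b < 1) \<Longrightarrow> \<psi> (g x) = x"
    using schoenberg_curve by blast
  define S where "S = 2 * \<bar>R\<bar> + 2"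
  have "S > 0" by (simp add: S_def)
  define rescale where "rescale x = (1 / S) *\<^sub>R x + (1 / 2) *\<^sub>R One" for x :: 'a
  have [measurable]: "rescale \<in> borel_measurable borel" unfolding rescale_def by measurable
  note [measurable] = curve(2)
  show ?thesis
  proof (rule that[of "\<lambda>t. S *\<^sub>R (\<psi> t - (1 / 2) *\<^sub>R One)" "\<lambda>x. g (rescale x)"])
    show "continuous_on UNIV (\<lambda>t. S *\<^sub>R (\<psi> t - (1 / 2) *\<^sub>R One))" by (intro continuous_intros curve)
    fix x :: 'a assume "norm x \<le> R"
    have "0 \<le> rescale x \<bullet> b \<and> rescale x \<bullet> b < 1" if b: "b \<in> Basis" for b
    proof -
      have "\<bar>x \<bullet> b\<bar> \<le> \<bar>R\<bar>" using Basis_le_norm[OF b, of x] \<open>norm x \<le> R\<close> by linarith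
      then have "\<bar>x \<bullet> b\<bar> / S < 1 / 2" using \<open>S > 0\<close> by (simp add: S_def divide_simps)
      then have "\<bar>(x \<bullet> b) / S\<bar> < 1 / 2" using \<open>S > 0\<close> unfolding abs_divide by simp
      then have "- (1 / 2) < (x \<bullet> b) / S" "(x \<bullet> b) / S < 1 / 2" by linarith+
      moreover have "rescale x \<bullet> b = (x \<bullet> b) / S + 1 / 2"
        using b by (simp add: rescale_def inner_add_left)
      ultimately show ?thesis by linarith
    qed
    then have "\<psi> (g (rescale x)) = rescale x" by (rule curve(4))
    then show "S *\<^sub>R (\<psi> (g (rescale x)) - (1 / 2) *\<^sub>R One) = x"
      using \<open>S > 0\<close> by (simp add: rescale_def)
  qed (use curve(3) in auto)
qed

definition converges_weakly :: "(nat \<Rightarrow> 'a::euclidean_space measure) \<Rightarrow> 'a measure \<Rightarrow> bool" where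
  "converges_weakly \<mu> \<nu> \<longleftrightarrow> (\<forall>h :: 'a \<Rightarrow> complex. continuous_on UNIV h \<longrightarrow> bounded (range h) \<longrightarrow>
     (\<lambda>k. LINT x|\<mu> k. h x) \<longlonglongrightarrow> (LINT x|\<nu>. h x))"

lemma converges_weaklyD:
  fixes h :: "'a::euclidean_space \<Rightarrow> complex"
  assumes "converges_weakly \<mu> \<nu>" "continuous_on UNIV h" "\<And>x. norm (h x) \<le> B"
  shows "(\<lambda>k. LINT x|\<mu> k. h x) \<longlonglongrightarrow> (LINT x|\<nu>. h x)"
  using assms unfolding converges_weakly_def by (auto simp: bounded_iff)

lemma converges_weakly_fourier_transform:
  assumes "converges_weakly \<mu> \<nu>"
  shows "(\<lambda>k. fourier_transform (\<mu> k) \<xi>) \<longlonglongrightarrow> fourier_transform \<nu> \<xi>"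
  unfolding fourier_transform_unit_exp
  by (rule converges_weaklyD[OF assms, where B = 1]) (auto intro!: continuous_intros)

lemma converges_weakly_distr:
  assumes "weak_conv_m \<mu> M" "\<And>k. real_distribution (\<mu> k)" "real_distribution M"
    and \<phi>: "continuous_on UNIV (\<phi> :: real \<Rightarrow> 'a::euclidean_space)"
  shows "converges_weakly (\<lambda>k. distr (\<mu> k) borel \<phi>) (distr M borel \<phi>)"
  unfolding converges_weakly_def
proof (intro allI impI)
  fix h :: "'a \<Rightarrow> complex" assume h: "continuous_on UNIV h" "bounded (range h)"
  obtain B where B: "\<And>x. norm (h x) \<le> B" using h(2) by (auto simp: bounded_iff)
  have transfer: "(LINT x|distr N borel \<phi>. h x) = (LINT t|N. h (\<phi> t))" if "real_distribution N"
    for N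
  proof (rule integral_distr)
    show "\<phi> \<in> measurable N borel"
      using borel_measurable_continuous_onI[OF \<phi>] real_distribution.events_eq_borel[OF that]
      by (simp cong: measurable_cong_sets)
    show "h \<in> borel_measurable borel" using h(1) by (rule borel_measurable_continuous_onI)
  qed
  have "(\<lambda>k. LINT t|\<mu> k. h (\<phi> t)) \<longlonglongrightarrow> (LINT t|M. h (\<phi> t))"
    by (rule weak_conv_imp_integral_bdd_continuous_conv[OF assms(2,3,1)])
      (use continuous_on_compose2[OF h(1) \<phi>] B in \<open>auto simp: continuous_on_eq_continuous_at\<close>)
  then show "(\<lambda>k. LINT x|distr (\<mu> k) borel \<phi>. h x) \<longlonglongrightarrow> (LINT x|distr M borel \<phi>. h x)"
    by (simp add: transfer assms)
qed

lemma tight_if_AE_Icc: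
  assumes "\<And>k. real_distribution (\<mu> k)" "\<And>k. AE t in \<mu> k. t \<in> {a..b}"
  shows "tight \<mu>"
  unfolding tight_def
proof (intro conjI allI impI assms(1))
  fix \<epsilon> :: real assume "\<epsilon> > 0"
  have "measure (\<mu> k) {a - 1<..max a b} = 1" for k
  proof -
    interpret real_distribution "\<mu> k" by (rule assms)
    have "AE t in \<mu> k. t \<in> {a - 1<..max a b}"
      using assms(2)[of k] by eventually_elim (auto simp: le_max_iff_disj)
    then show ?thesis by (intro prob_eq_1[THEN iffD2]) auto
  qed
  then show "\<exists>a b. a < b \<and> (\<forall>k. 1 - \<epsilon> < measure (\<mu> k) {a<..b})"
    using \<open>\<epsilon> > 0\<close> by (intro exI[of _ "a - 1"] exI[of _ "max a b"]) auto
qed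

lemma weak_compactness:
  fixes \<mu> :: "nat \<Rightarrow> 'a::euclidean_space measure"
  assumes "\<And>k. prob_space (\<mu> k)" and sets: "\<And>k. sets (\<mu> k) = sets borel"
    and bounded: "\<And>k. AE x in \<mu> k. norm x \<le> R"
  obtains \<nu> r where "prob_space \<nu>" "sets \<nu> = sets borel" "strict_mono (r :: nat \<Rightarrow> nat)"
    "converges_weakly (\<lambda>k. \<mu> (r k)) \<nu>"
proof -
  obtain \<phi> :: "real \<Rightarrow> 'a" and \<gamma> where \<phi>: "continuous_on UNIV \<phi>"
    and [measurable]: "\<gamma> \<in> borel_measurable borel"
    and \<gamma>: "\<And>x. \<gamma> x \<in> {0..1}" "\<And>x. norm x \<le> R \<Longrightarrow> \<phi> (\<gamma> x) = x"
    by (rule cball_continuous_parametrization[of R]) (rule that)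
  have [measurable]: "\<phi> \<in> borel_measurable borel" using \<phi> by (rule borel_measurable_continuous_onI)
  note borel_measurable_iff = measurable_cong_sets[OF sets refl]
  define \<nu> where "\<nu> k = distr (\<mu> k) borel \<gamma>" for k
  have \<gamma>_measurable: "\<gamma> \<in> measurable (\<mu> k) borel" for k by (simp add: borel_measurable_iff)
  have real_distribution: "real_distribution (\<nu> k)" for k
    unfolding \<nu>_def by (rule prob_space.real_distribution_distr[OF assms(1) \<gamma>_measurable])
  have "AE t in \<nu> k. t \<in> {0..1}" for k
    unfolding \<nu>_def using \<gamma>(1) by (subst AE_distr_iff[OF \<gamma>_measurable]) auto
  then have "tight \<nu>" by (rule tight_if_AE_Icc[OF real_distribution])
  then obtain r M where r: "strict_mono r" and M: "real_distribution M" "weak_conv_m (\<nu> \<circ> id \<circ> r) M"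
    using tight_imp_convergent_subsubsequence[of \<nu> id] by (auto simp: strict_mono_id)
  have recovered: "distr (\<nu> k) borel \<phi> = \<mu> k" for k
  proof -
    have "distr (\<nu> k) borel \<phi> = distr (\<mu> k) borel (\<phi> \<circ> \<gamma>)"
      unfolding \<nu>_def by (rule distr_distr) (use \<gamma>_measurable in auto)
    also have "\<dots> = distr (\<mu> k) (\<mu> k) (\<lambda>x. x)"
      using bounded[of k] \<gamma>(2)
      by (intro distr_cong_AE)
        (auto simp: sets borel_measurable_iff measurable_ident_sets elim!: eventually_mono)
    finally show ?thesis by simp
  qed
  show ?thesis
  proof (rule that[OF _ _ r])
    interpret real_distribution M by (rule M)
    show "prob_space (distr M borel \<phi>)"
      by (rule prob_space_distr) (simp cong: measurable_cong_sets)
    show "converges_weakly (\<lambda>k. \<mu> (r k)) (distr M borel \<phi>)"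
      using converges_weakly_distr[OF M(2) _ M(1) \<phi>] real_distribution by (simp add: recovered)
  qed simp
qed

lemma closed_measure_support: "closed (measure_support \<mu>)"
  unfolding measure_support_def by (intro closed_Inter) auto

lemma AE_measure_support:
  fixes \<mu> :: "'a::euclidean_space measure"
  assumes "sets \<mu> = sets borel"
  shows "AE x in \<mu>. x \<in> measure_support \<mu>"
proof -
  define F where "F = {C. closed C \<and> emeasure \<mu> (UNIV - C) = 0}"
  have "\<And>S. S \<in> uminus ` F \<Longrightarrow> open S" by (auto simp: F_def)
  then obtain F' where F': "F' \<subseteq> uminus ` F" "countable F'" "\<Union>F' = \<Union>(uminus ` F)"
    using Lindelof[of "uminus ` F"] by metis
  have "S \<in> null_sets \<mu>" if S: "S \<in> F'" for S
  proof -
    obtain C where "C \<in> F" "S = - C" using S F'(1) by blast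
    then show ?thesis using assms by (auto simp: F_def null_sets_def Compl_eq_Diff_UNIV)
  qed
  then have "(\<Union>S\<in>F'. S) \<in> null_sets \<mu>" using F'(2) by (intro null_sets_UN') auto
  moreover have "{x \<in> space \<mu>. x \<notin> measure_support \<mu>} \<subseteq> \<Union>F'"
    unfolding F'(3) by (auto simp: measure_support_def F_def)
  ultimately show ?thesis by (auto intro: AE_I')
qed

lemma measure_support_subset:
  assumes "sets \<mu> = sets borel" "closed S" "AE x in \<mu>. x \<in> S"
  shows "measure_support \<mu> \<subseteq> S"
proof -
  have "{x \<in> space \<mu>. x \<notin> S} = UNIV - S" using sets_eq_imp_space_eq[OF assms(1)] by auto
  moreover have "UNIV - S \<in> sets \<mu>" using assms(1,2) by auto
  ultimately have "emeasure \<mu> (UNIV - S) = 0"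
    using AE_iff_measurable[of "UNIV - S" \<mu> "\<lambda>x. x \<in> S"] assms(3) by simp
  then show ?thesis using assms(2) by (auto simp: measure_support_def)
qed

lemma converges_weakly_AE_closed:
  fixes S :: "'a::euclidean_space set"
  assumes \<nu>: "prob_space \<nu>" "sets \<nu> = sets borel" and "\<And>k. prob_space (\<mu> k)"
    and weak: "converges_weakly \<mu> \<nu>" and "closed S"
    and AE: "\<forall>\<^sub>F k in sequentially. AE x in \<mu> k. x \<in> S"
  shows "AE x in \<nu>. x \<in> S"
proof -
  interpret \<nu>: prob_space \<nu> by (rule \<nu>)
  obtain k where "AE x in \<mu> k. x \<in> S" using AE by (auto simp: eventually_sequentially)
  then have "S \<noteq> {}" using prob_space.AE_False[OF assms(3), of k] by auto
  define f where "f x = min 1 (infdist x S)" for x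
  have cont: "continuous_on UNIV f" unfolding f_def by (intro continuous_intros)
  have f: "0 \<le> f x" "f x \<le> 1" for x by (auto simp: f_def infdist_nonneg)
  have f_measurable: "f \<in> borel_measurable \<nu>"
    using borel_measurable_continuous_onI[OF cont] \<nu>(2) by (simp cong: measurable_cong_sets)
  have "(\<lambda>k. LINT x|\<mu> k. complex_of_real (f x)) \<longlonglongrightarrow> (LINT x|\<nu>. complex_of_real (f x))"
    by (rule converges_weaklyD[OF weak, of _ 1]) (use f in \<open>auto intro!: continuous_intros cont\<close>)
  moreover have "\<forall>\<^sub>F k in sequentially. (LINT x|\<mu> k. complex_of_real (f x)) = 0"
    using AE by eventually_elim
      (auto simp: f_def elim!: eventually_mono intro!: integral_eq_zero_AE)
  ultimately have "(LINT x|\<nu>. complex_of_real (f x)) = 0"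
    using tendsto_unique[OF sequentially_bot _ tendsto_eventually] by blast
  then have "(LINT x|\<nu>. f x) = 0" unfolding integral_complex_of_real by simp
  moreover have "integrable \<nu> f"
    by (rule \<nu>.integrable_bounded_borel[OF f_measurable, of 1]) (use f in auto)
  ultimately have "AE x in \<nu>. f x = 0" using f by (subst (asm) integral_nonneg_eq_0_iff_AE) auto
  then show ?thesis
  proof eventually_elim
    case (elim x)
    then have "infdist x S = 0" using infdist_nonneg[of x S]
      by (auto simp: f_def min_def split: if_splits)
    then show ?case using in_closed_iff_infdist_zero[OF \<open>closed S\<close> \<open>S \<noteq> {}\<close>] by blast
  qed
qed

section \<open>Compactly supported measures with rapidly decaying Fourier transform\<close>

text \<open>The library's convolution of measures is restricted to ordered Euclidean spaces.\<close>

definition sum_law :: "'a::euclidean_space measure \<Rightarrow> 'a measure \<Rightarrow> 'a measure" where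
  "sum_law \<mu> \<nu> = distr (\<mu> \<Otimes>\<^sub>M \<nu>) borel (\<lambda>(x, y). x + y)"

lemma sets_sum_law [simp]: "sets (sum_law \<mu> \<nu>) = sets borel"
  by (simp add: sum_law_def)

context
  fixes \<mu> \<nu> :: "'a::euclidean_space measure"
  assumes prob: "prob_space \<mu>" "prob_space \<nu>"
    and borel [measurable_cong]: "sets \<mu> = sets borel" "sets \<nu> = sets borel"
begin

interpretation \<mu>: prob_space \<mu> by (rule prob)
interpretation \<nu>: prob_space \<nu> by (rule prob)
interpretation product: pair_prob_space \<mu> \<nu> ..

lemma measurable_plus_pair: "(\<lambda>(x, y). x + y) \<in> measurable (\<mu> \<Otimes>\<^sub>M \<nu>) borel"
  by measurable

lemma prob_space_sum_law: "prob_space (sum_law \<mu> \<nu>)"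
  unfolding sum_law_def by (rule product.prob_space_distr[OF measurable_plus_pair])

lemma fourier_transform_sum_law:
  "fourier_transform (sum_law \<mu> \<nu>) \<xi> = fourier_transform \<mu> \<xi> * fourier_transform \<nu> \<xi>"
proof -
  have "fourier_transform (sum_law \<mu> \<nu>) \<xi> =
      (LINT z|(\<mu> \<Otimes>\<^sub>M \<nu>). unit_exp (- ((\<lambda>(x, y). x + y) z \<bullet> \<xi>)))"
    unfolding fourier_transform_unit_exp sum_law_def
    by (rule integral_distr[OF measurable_plus_pair]) measurable
  also have "\<dots> = (LINT (x, y)|(\<mu> \<Otimes>\<^sub>M \<nu>). unit_exp (- (x \<bullet> \<xi>)) * unit_exp (- (y \<bullet> \<xi>)))"
    by (intro Bochner_Integration.integral_cong) (auto simp: inner_add_left simp flip: unit_exp_add)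
  also have "\<dots> = (LINT x|\<mu>. LINT y|\<nu>. unit_exp (- (x \<bullet> \<xi>)) * unit_exp (- (y \<bullet> \<xi>)))"
    using product.integral_fst'[OF product.integrable_bounded_borel[of
      "\<lambda>(x, y). unit_exp (- (x \<bullet> \<xi>)) * unit_exp (- (y \<bullet> \<xi>))" 1]]
    by (simp add: norm_mult case_prod_unfold)
  also have "\<dots> = fourier_transform \<mu> \<xi> * fourier_transform \<nu> \<xi>"
    unfolding fourier_transform_unit_exp by simp
  finally show ?thesis .
qed

lemma AE_sum_law_norm_le:
  assumes "AE x in \<mu>. norm x \<le> R" "AE x in \<nu>. norm x \<le> S"
  shows "AE x in sum_law \<mu> \<nu>. norm x \<le> R + S"
proof -
  have "AE z in \<mu> \<Otimes>\<^sub>M \<nu>. norm (fst z) \<le> R \<and> norm (snd z) \<le> S"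
  proof (rule product.AE_pair_measure)
    show "{z \<in> space (\<mu> \<Otimes>\<^sub>M \<nu>). norm (fst z) \<le> R \<and> norm (snd z) \<le> S} \<in> sets (\<mu> \<Otimes>\<^sub>M \<nu>)"
      by measurable
  qed (use assms in auto)
  then have "AE z in \<mu> \<Otimes>\<^sub>M \<nu>. norm ((\<lambda>(x, y). x + y) z) \<le> R + S"
    by eventually_elim (auto simp: case_prod_unfold intro!: norm_triangle_le add_mono)
  then show ?thesis unfolding sum_law_def by (subst AE_distr_iff[OF measurable_plus_pair]) auto
qed

lemma emeasure_sum_law:
  assumes "S \<in> sets borel"
  shows "emeasure (sum_law \<mu> \<nu>) S = (\<integral>\<^sup>+x. emeasure \<nu> {y. x + y \<in> S} \<partial>\<mu>)"
proof -
  have "emeasure (sum_law \<mu> \<nu>) S = emeasure (\<mu> \<Otimes>\<^sub>M \<nu>) ((\<lambda>(x, y). x + y) -` S \<inter> space (\<mu> \<Otimes>\<^sub>M \<nu>))"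
    unfolding sum_law_def by (rule emeasure_distr[OF measurable_plus_pair assms])
  also have "\<dots> = (\<integral>\<^sup>+x. emeasure \<nu> (Pair x -` ((\<lambda>(x, y). x + y) -` S \<inter> space (\<mu> \<Otimes>\<^sub>M \<nu>))) \<partial>\<mu>)"
    by (intro \<nu>.emeasure_pair_measure_alt measurable_sets[OF measurable_plus_pair assms])
  also have "\<dots> = (\<integral>\<^sup>+x. emeasure \<nu> {y. x + y \<in> S} \<partial>\<mu>)"
    by (intro nn_integral_cong arg_cong2[where f = emeasure] refl)
      (auto simp: space_pair_measure borel[THEN sets_eq_imp_space_eq])
  finally show ?thesis .
qed

end

text \<open>Translating by \<open>h\<close> with \<open>h \<bullet> \<xi> = 1 / 2\<close> changes the sign of the character.\<close>

lemma integral_unit_exp_half_translate: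
  fixes f :: "'a::euclidean_space \<Rightarrow> real"
  assumes f: "integrable lborel f" and "h \<bullet> \<xi> = 1 / 2"
  shows "2 * (LINT x|lborel. f x *\<^sub>R unit_exp (- (x \<bullet> \<xi>))) =
    (LINT x|lborel. (f x - f (x - h)) *\<^sub>R unit_exp (- (x \<bullet> \<xi>)))"
proof -
  have [measurable]: "f \<in> borel_measurable borel" using borel_measurable_integrable[OF f] by simp
  have integrable: "integrable lborel (\<lambda>x. g x *\<^sub>R unit_exp (- (x \<bullet> \<xi>)))" if "integrable lborel g"
    for g :: "'a \<Rightarrow> real"
    by (rule Bochner_Integration.integrable_bound[OF that])
      (use borel_measurable_integrable[OF that] in auto)
  have f_translate: "integrable lborel (\<lambda>x. f (x - h))"
    using f integrable_distr_eq[of "(+) (- h)" lborel borel f] by (simp add: lborel_distr_plus)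
  have "(LINT x|lborel. f x *\<^sub>R unit_exp (- (x \<bullet> \<xi>))) =
      (LINT x|distr lborel borel ((+) (- h)). f x *\<^sub>R unit_exp (- (x \<bullet> \<xi>)))"
    by (simp add: lborel_distr_plus)
  also have "\<dots> = (LINT x|lborel. f (- h + x) *\<^sub>R unit_exp (- ((- h + x) \<bullet> \<xi>)))"
    by (rule integral_distr) measurable
  also have "\<dots> = (LINT x|lborel. - (f (x - h) *\<^sub>R unit_exp (- (x \<bullet> \<xi>))))"
  proof (intro Bochner_Integration.integral_cong refl)
    fix x
    have "- ((- h + x) \<bullet> \<xi>) = - (x \<bullet> \<xi>) + 1 / 2"
      using assms(2) by (simp only: inner_add_left inner_minus_left)
    then show "f (- h + x) *\<^sub>R unit_exp (- ((- h + x) \<bullet> \<xi>)) =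
        - (f (x - h) *\<^sub>R unit_exp (- (x \<bullet> \<xi>)))"
      by (simp only: unit_exp_add unit_exp_half) simp
  qed
  finally have "2 * (LINT x|lborel. f x *\<^sub>R unit_exp (- (x \<bullet> \<xi>))) =
      (LINT x|lborel. f x *\<^sub>R unit_exp (- (x \<bullet> \<xi>))) -
          (LINT x|lborel. f (x - h) *\<^sub>R unit_exp (- (x \<bullet> \<xi>)))"
    by simp
  also have "\<dots> = (LINT x|lborel. (f x - f (x - h)) *\<^sub>R unit_exp (- (x \<bullet> \<xi>)))"
    unfolding scaleR_left_diff_distrib
    by (intro Bochner_Integration.integral_diff[symmetric] integrable f f_translate)
  finally show ?thesis .
qed

lemma integrable_lborel_compact_support:
  fixes f :: "'a::euclidean_space \<Rightarrow> real"
  assumes "continuous_on UNIV f" "\<And>x. r < norm x \<Longrightarrow> f x = 0"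
  shows "integrable lborel f"
proof -
  have "integrable lborel (\<lambda>x. indicator (cball 0 r) x *\<^sub>R f x)"
    by (intro borel_integrable_compact continuous_on_subset[OF assms(1)]) auto
  also have "(\<lambda>x. indicator (cball 0 r) x *\<^sub>R f x) = f"
    using assms(2) by (auto simp: indicator_def fun_eq_iff)
  finally show ?thesis .
qed

lemma norm_fourier_integral_lipschitz_le:
  fixes f :: "'a::euclidean_space \<Rightarrow> real"
  assumes lip: "C-lipschitz_on UNIV f" and support: "\<And>x. r < norm x \<Longrightarrow> f x = 0" and "1 \<le> norm \<xi>"
  shows "norm (LINT x|lborel. f x *\<^sub>R unit_exp (- (x \<bullet> \<xi>))) \<le>
    C * measure lborel (cball (0::'a) (r + 1)) / (4 * norm \<xi>)"
proof -
  define h where "h = (1 / (2 * (norm \<xi>)\<^sup>2)) *\<^sub>R \<xi>"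
  have "\<xi> \<noteq> 0" using assms(3) by auto
  then have h: "h \<bullet> \<xi> = 1 / 2" "norm h = 1 / (2 * norm \<xi>)"
    by (simp add: h_def power2_norm_eq_inner) (use \<open>\<xi> \<noteq> 0\<close> in \<open>simp add: h_def power2_eq_square\<close>)
  have "norm h \<le> 1" unfolding h(2) using assms(3) by (simp add: divide_simps)
  have f: "integrable lborel f"
    using lipschitz_on_continuous_on[OF lip] support by (rule integrable_lborel_compact_support)
  have pointwise: "\<bar>f x - f (x - h)\<bar> \<le> C * norm h * indicat_real (cball 0 (r + 1)) x" for x
  proof (cases "x \<in> cball 0 (r + 1)")
    case True
    then show ?thesis using lipschitz_onD[OF lip, of x "x - h"]
      by (simp add: dist_real_def dist_norm)
  next
    case False
    then have "r < norm x" "r < norm (x - h)"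
      using norm_triangle_sub[of x h] \<open>norm h \<le> 1\<close> by auto
    then show ?thesis using False support by simp
  qed
  have bound_integrable:
      "integrable lborel (\<lambda>x. C * norm h * indicat_real (cball (0::'a) (r + 1)) x)"
    by (intro integrable_mult_right integrable_real_indicator emeasure_bounded_finite bounded_cball)
      auto
  have [measurable]: "f \<in> borel_measurable borel" using borel_measurable_integrable[OF f] by simp
  have "2 * norm (LINT x|lborel. f x *\<^sub>R unit_exp (- (x \<bullet> \<xi>))) =
      norm (LINT x|lborel. (f x - f (x - h)) *\<^sub>R unit_exp (- (x \<bullet> \<xi>)))"
    unfolding integral_unit_exp_half_translate[OF f h(1), symmetric] by (simp add: norm_mult)
  also have "\<dots> \<le> (LINT x|lborel. C * norm h * indicat_real (cball (0::'a) (r + 1)) x)"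
  proof (rule Bochner_Integration.integral_norm_bound_integral[OF _ bound_integrable])
    show "integrable lborel (\<lambda>x. (f x - f (x - h)) *\<^sub>R unit_exp (- (x \<bullet> \<xi>)))"
      by (rule Bochner_Integration.integrable_bound[OF bound_integrable])
        (auto intro: order_trans[OF pointwise abs_ge_self])
  qed (simp add: pointwise)
  also have "\<dots> = C * norm h * measure lborel (cball (0::'a) (r + 1))" by simp
  finally show ?thesis by (simp add: h(2))
qed

definition decaying_measure :: "real \<Rightarrow> real \<Rightarrow> 'a::euclidean_space measure \<Rightarrow> bool" where
  "decaying_measure R A \<mu> \<longleftrightarrow> finite_measure \<mu> \<and> sets \<mu> = sets borel \<and> (AE x in \<mu>. norm x \<le> R) \<and>
     (\<exists>C. decay_bound C A (fourier_transform \<mu>))"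

lemma decaying_measure_density_lipschitz:
  fixes f :: "'a::euclidean_space \<Rightarrow> real"
  assumes nonneg: "\<And>x. 0 \<le> f x" and lip: "C-lipschitz_on UNIV f"
    and support: "\<And>x. r < norm x \<Longrightarrow> f x = 0" and mass: "(LINT x|lborel. f x) = 1"
  defines "\<mu> \<equiv> density lborel (\<lambda>x. ennreal (f x))"
  shows "prob_space \<mu>" and "decaying_measure r 1 \<mu>"
proof -
  have f: "integrable lborel f"
    using lipschitz_on_continuous_on[OF lip] support by (rule integrable_lborel_compact_support)
  note [measurable] = borel_measurable_integrable[OF f]
  show prob: "prob_space \<mu>"
  proof
    show "emeasure \<mu> (space \<mu>) = 1"
      using nonneg f mass by (simp add: \<mu>_def emeasure_density nn_integral_eq_integral)
  qed
  define V where "V = C * measure lborel (cball (0::'a) (r + 1))"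
  have "0 \<le> V" using lipschitz_on_nonneg[OF lip] by (simp add: V_def)
  have decay: "decay_bound (2 + V) 1 (fourier_transform \<mu>)"
  proof (rule decay_boundI)
    fix \<xi> :: 'a
    have "norm (fourier_transform \<mu> \<xi>) * \<langle>\<xi>\<rangle> \<le> 2 + V"
    proof (cases "1 \<le> norm \<xi>")
      case True
      have "fourier_transform \<mu> \<xi> = (LINT x|lborel. f x *\<^sub>R unit_exp (- (x \<bullet> \<xi>)))"
        unfolding fourier_transform_unit_exp \<mu>_def using nonneg by (subst integral_density) auto
      then have "norm (fourier_transform \<mu> \<xi>) \<le> V / (4 * norm \<xi>)"
        using norm_fourier_integral_lipschitz_le[OF lip support True] by (simp add: V_def)
      then have "norm (fourier_transform \<mu> \<xi>) * \<langle>\<xi>\<rangle> \<le> V / (4 * norm \<xi>) * (2 * norm \<xi>)"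
        using True \<open>0 \<le> V\<close> by (intro mult_mono) (auto simp: bracket_def)
      also have "\<dots> = V / 2" using True by auto
      finally show ?thesis using \<open>0 \<le> V\<close> by linarith
    next
      case False
      then have "norm (fourier_transform \<mu> \<xi>) * \<langle>\<xi>\<rangle> \<le> 1 * 2"
        by (intro mult_mono norm_fourier_transform_le_1 prob) (auto simp: bracket_def)
      then show ?thesis using \<open>0 \<le> V\<close> by simp
    qed
    then show "norm (fourier_transform \<mu> \<xi>) \<le> (2 + V) * \<langle>\<xi>\<rangle> powr (- 1)"
      by (simp add: powr_minus_divide pos_le_divide_eq)
  qed
  have "norm x \<le> r" if "0 < f x" for x using support[of x] that by (cases "r < norm x") auto
  then have "AE x in \<mu>. norm x \<le> r" unfolding \<mu>_def by (subst AE_density) auto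
  moreover have "sets \<mu> = sets borel" by (simp add: \<mu>_def)
  ultimately show "decaying_measure r 1 \<mu>"
    using prob decay by (auto simp: decaying_measure_def prob_space.finite_measure)
qed

lemma ex_decaying_measure_1:
  "\<exists>\<mu> :: 'a::euclidean_space measure. prob_space \<mu> \<and> decaying_measure 1 1 \<mu>"
proof -
  define tent where "tent x = max 0 (1 - norm x)" for x :: 'a
  have lip: "1-lipschitz_on UNIV tent"
  proof (rule lipschitz_onI)
    show "dist (tent x) (tent y) \<le> 1 * dist x y" for x y
      using norm_triangle_ineq3[of x y] by (auto simp: tent_def max_def dist_real_def dist_norm)
  qed simp
  have tent: "integrable lborel tent"
    using lipschitz_on_continuous_on[OF lip]
    by (rule integrable_lborel_compact_support[of _ 1]) (simp add: tent_def)
  define I where "I = (LINT x|lborel. tent x)"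
  have "0 < 1 / 2 * measure lborel (cball (0::'a) (1 / 2))"
    using content_cball_pos[of "1 / 2" "0 :: 'a"] by simp
  also have "\<dots> = (LINT x|lborel. (1 / 2) * indicat_real (cball (0::'a) (1 / 2)) x)" by simp
  also have "\<dots> \<le> I"
    unfolding I_def
    by (intro integral_mono tent integrable_mult_right integrable_real_indicator
        emeasure_bounded_finite)
      (auto simp: tent_def indicator_def)
  finally have "I > 0" .
  have "(1 / I * 1)-lipschitz_on UNIV (\<lambda>x. 1 / I * tent x)"
    using lipschitz_on_cmult_real[OF lip, of "1 / I"] \<open>I > 0\<close> by simp
  moreover have "(LINT x|lborel. 1 / I * tent x) = 1" using \<open>I > 0\<close> by (simp add: I_def)
  ultimately show ?thesis
    using decaying_measure_density_lipschitz[of "\<lambda>x. 1 / I * tent x" "1 / I * 1" 1] \<open>I > 0\<close>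
    by (auto simp: tent_def)
qed

lemma ex_decaying_measure:
  "\<exists>(\<mu> :: 'a::euclidean_space measure) R. prob_space \<mu> \<and> decaying_measure R (real A) \<mu>"
proof (induction A)
  case 0
  obtain \<mu> :: "'a measure" where "prob_space \<mu>" "decaying_measure 1 1 \<mu>"
    using ex_decaying_measure_1 by blast
  moreover from this obtain C where "decay_bound C 1 (fourier_transform \<mu>)"
    unfolding decaying_measure_def by blast
  then have "decay_bound C 0 (fourier_transform \<mu>)" by (rule decay_bound_weaken) auto
  ultimately show ?case by (auto simp: decaying_measure_def)
next
  case (Suc A)
  then obtain \<mu> :: "'a measure" and R C where \<mu>: "prob_space \<mu>" "sets \<mu> = sets borel"
    "AE x in \<mu>. norm x \<le> R" "decay_bound C (real A) (fourier_transform \<mu>)"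
    unfolding decaying_measure_def by blast
  obtain \<nu> :: "'a measure" and D where \<nu>: "prob_space \<nu>" "sets \<nu> = sets borel"
    "AE x in \<nu>. norm x \<le> 1" "decay_bound D 1 (fourier_transform \<nu>)"
    using ex_decaying_measure_1 unfolding decaying_measure_def by blast
  have prob: "prob_space (sum_law \<mu> \<nu>)" by (rule prob_space_sum_law[OF \<mu>(1) \<nu>(1) \<mu>(2) \<nu>(2)])
  have "decay_bound (C * D) (real (Suc A)) (fourier_transform (sum_law \<mu> \<nu>))"
    using decay_bound_mult[OF \<mu>(4) \<nu>(4)] fourier_transform_sum_law[OF \<mu>(1) \<nu>(1) \<mu>(2) \<nu>(2)]
    by (simp add: decay_bound_def add.commute)
  then have "decaying_measure (R + 1) (real (Suc A)) (sum_law \<mu> \<nu>)"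
    using AE_sum_law_norm_le[OF \<mu>(1) \<nu>(1) \<mu>(2) \<nu>(2) \<mu>(3) \<nu>(3)] prob
    by (auto simp: decaying_measure_def prob_space.finite_measure)
  with prob show ?case by blast
qed

section \<open>Fejer kernel estimates\<close>

definition exp_sum :: "nat \<Rightarrow> real \<Rightarrow> complex" where
  "exp_sum N t = (\<Sum>a<N. unit_exp (real a * t))"

lemma norm_exp_sum_le: "norm (exp_sum N t) \<le> real N"
  using norm_sum[of "\<lambda>a. unit_exp (real a * t)" "{..<N}"] by (simp add: exp_sum_def)

lemma norm_exp_sum_ge:
  assumes "N > 0" "infdist t \<int> \<le> 1 / (8 * real N)"
  shows "real N / 2 \<le> norm (exp_sum N t)"
proof -
  obtain r :: int where r: "\<bar>t - of_int r\<bar> \<le> 1 / (8 * real N)"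
    using assms(2) by (auto simp: infdist_Ints_le_iff)
  define s where "s = t - of_int r"
  have reduce: "unit_exp (real a * t) = unit_exp (real a * s)" for a
  proof -
    have "real a * t = real a * s + of_int (int a * r)" by (simp add: s_def algebra_simps)
    then show ?thesis by (simp only: unit_exp_add unit_exp_of_int mult_1_right)
  qed
  have cos_ge: "cos (2 * pi * (real a * s)) \<ge> 1 / 2" if "a < N" for a
  proof -
    have "real a * \<bar>s\<bar> \<le> real N * (1 / (8 * real N))"
      using r that by (intro mult_mono) (auto simp: s_def)
    then have "2 * pi * (real a * \<bar>s\<bar>) \<le> 2 * pi * (1 / 8)"
      using assms by (intro mult_left_mono) auto
    then have "\<bar>2 * pi * (real a * s)\<bar> \<le> pi / 3" by (simp add: abs_mult)
    then have "cos (pi / 3) \<le> cos \<bar>2 * pi * (real a * s)\<bar>" by (intro cos_monotone_0_pi_le) auto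
    then show ?thesis by (simp only: cos_abs_real cos_60)
  qed
  have "real N / 2 = (\<Sum>a<N. 1 / 2)" by simp
  also have "\<dots> \<le> (\<Sum>a<N. cos (2 * pi * (real a * s)))" using cos_ge by (intro sum_mono) auto
  also have "\<dots> = Re (exp_sum N t)" by (simp add: exp_sum_def reduce Re_unit_exp)
  also have "\<dots> \<le> norm (exp_sum N t)" by (rule complex_Re_le_cmod)
  finally show ?thesis .
qed

definition fejer_product :: "nat \<Rightarrow> 'i set \<Rightarrow> ('i \<Rightarrow> real) \<Rightarrow> real" where
  "fejer_product N I t = (\<Prod>i\<in>I. (norm (exp_sum N (t i)))\<^sup>2)"

lemma fejer_product_nonneg: "0 \<le> fejer_product N I t"
  unfolding fejer_product_def by (intro prod_nonneg) auto

lemma fejer_product_le: "fejer_product N I t \<le> (real N)\<^sup>2 ^ card I"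
  using prod_mono[of I "\<lambda>i. (norm (exp_sum N (t i)))\<^sup>2" "\<lambda>_. (real N)\<^sup>2"]
  by (simp add: fejer_product_def norm_exp_sum_le power_mono)

lemma fejer_product_ge:
  assumes "N > 0" "\<And>i. i \<in> I \<Longrightarrow> infdist (t i) \<int> \<le> 1 / (8 * real N)"
  shows "((real N)\<^sup>2 / 4) ^ card I \<le> fejer_product N I t"
proof -
  have "((real N)\<^sup>2 / 4) ^ card I = (\<Prod>i\<in>I. (real N / 2)\<^sup>2)" by (simp add: power_divide)
  also have "\<dots> \<le> fejer_product N I t"
    unfolding fejer_product_def by (intro prod_mono conjI power_mono norm_exp_sum_ge assms) auto
  finally show ?thesis .
qed

lemma fejer_product_expand:
  assumes "finite I"
  shows "complex_of_real (fejer_product N I t) =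
    (\<Sum>j\<in>PiE I (\<lambda>_. {..<N}). \<Sum>j'\<in>PiE I (\<lambda>_. {..<N}).
        unit_exp (- (\<Sum>i\<in>I. (real (j i) - real (j' i)) * t i)))"
proof -
  have expand: "(\<Prod>i\<in>I. exp_sum N (t i)) =
      (\<Sum>j\<in>PiE I (\<lambda>_. {..<N}). unit_exp (\<Sum>i\<in>I. real (j i) * t i))"
    unfolding exp_sum_def using assms by (subst prod_sum_PiE) (auto simp: unit_exp_sum)
  have "complex_of_real (fejer_product N I t) = (\<Prod>i\<in>I. cnj (exp_sum N (t i)) * exp_sum N (t i))"
    by (simp add: fejer_product_def complex_norm_square[unfolded of_real_power] mult.commute)
  also have "\<dots> = cnj (\<Prod>i\<in>I. exp_sum N (t i)) * (\<Prod>i\<in>I. exp_sum N (t i))" by (simp add: prod.distrib)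
  also have "\<dots> = (\<Sum>j\<in>PiE I (\<lambda>_. {..<N}). \<Sum>j'\<in>PiE I (\<lambda>_. {..<N}).
      unit_exp (- (\<Sum>i\<in>I. real (j i) * t i)) * unit_exp (\<Sum>i\<in>I. real (j' i) * t i))"
    unfolding expand by (simp add: sum_product unit_exp_minus)
  also have "\<dots> = (\<Sum>j\<in>PiE I (\<lambda>_. {..<N}). \<Sum>j'\<in>PiE I (\<lambda>_. {..<N}).
      unit_exp (- (\<Sum>i\<in>I. (real (j i) - real (j' i)) * t i)))"
    by (intro sum.cong refl) (simp add: unit_exp_add[symmetric] left_diff_distrib sum_subtractf)
  finally show ?thesis .
qed

definition bohr_set :: "'i set \<Rightarrow> ('i \<Rightarrow> 'a::euclidean_space) \<Rightarrow> real \<Rightarrow> 'a set" where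
  "bohr_set I v \<delta> = {x. \<forall>i\<in>I. infdist (x \<bullet> v i) \<int> \<le> \<delta>}"

lemma closed_bohr_set: "closed (bohr_set I v \<delta>)"
proof -
  have "bohr_set I v \<delta> = (\<Inter>i\<in>I. {x. infdist (x \<bullet> v i) \<int> \<le> \<delta>})" by (auto simp: bohr_set_def)
  also have "closed \<dots>" by (intro closed_INT ballI closed_Collect_le continuous_intros)
  finally show ?thesis .
qed

lemma measure_bohr_set_le_sum_fourier:
  fixes \<mu> :: "'a::euclidean_space measure"
  assumes "finite_measure \<mu>" "sets \<mu> = sets borel" "finite I" "N > 0"
  shows "measure \<mu> (bohr_set I v (1 / (8 * real N))) * ((real N)\<^sup>2 / 4) ^ card I \<le>
    (\<Sum>j\<in>PiE I (\<lambda>_. {..<N}). \<Sum>j'\<in>PiE I (\<lambda>_. {..<N}).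
      norm (fourier_transform \<mu> (\<Sum>i\<in>I. (real (j i) - real (j' i)) *\<^sub>R v i)))"
proof -
  interpret finite_measure \<mu> by fact
  define A where "A = bohr_set I v (1 / (8 * real N))"
  define f where "f x = fejer_product N I (\<lambda>i. x \<bullet> v i)" for x
  have A: "A \<in> sets \<mu>" unfolding A_def assms(2) by (intro borel_closed closed_bohr_set)
  have "continuous_on UNIV f" unfolding f_def fejer_product_def exp_sum_def
    by (intro continuous_intros)
  then have "f \<in> borel_measurable \<mu>"
    using assms(2) by (auto dest: borel_measurable_continuous_onI cong: measurable_cong_sets)
  then have "integrable \<mu> f"
    by (rule integrable_bounded_borel[where B = "(real N)\<^sup>2 ^ card I"])
      (simp add: f_def fejer_product_le fejer_product_nonneg)
  have minorant: "((real N)\<^sup>2 / 4) ^ card I * indicat_real A x \<le> f x" for x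
    using fejer_product_ge[OF assms(4), of I "\<lambda>i. x \<bullet> v i"] fejer_product_nonneg
    by (auto simp: A_def f_def bohr_set_def indicator_def)
  have "measure \<mu> A * ((real N)\<^sup>2 / 4) ^ card I =
      (LINT x|\<mu>. ((real N)\<^sup>2 / 4) ^ card I * indicat_real A x)"
    using A by (simp add: mult.commute)
  also have "\<dots> \<le> (LINT x|\<mu>. f x)"
    using A \<open>integrable \<mu> f\<close> minorant
    by (intro integral_mono integrable_mult_right integrable_real_indicator)
      (auto simp: emeasure_eq_measure)
  also have "\<dots> \<le> norm (LINT x|\<mu>. complex_of_real (f x))"
    unfolding integral_complex_of_real by simp
  also have "(LINT x|\<mu>. complex_of_real (f x)) = (\<Sum>j\<in>PiE I (\<lambda>_. {..<N}). \<Sum>j'\<in>PiE I (\<lambda>_. {..<N}).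
      fourier_transform \<mu> (\<Sum>i\<in>I. (real (j i) - real (j' i)) *\<^sub>R v i))"
  proof -
    have "complex_of_real (f x) = (\<Sum>j\<in>PiE I (\<lambda>_. {..<N}). \<Sum>j'\<in>PiE I (\<lambda>_. {..<N}).
        unit_exp (- (x \<bullet> (\<Sum>i\<in>I. (real (j i) - real (j' i)) *\<^sub>R v i))))" for x
      unfolding f_def fejer_product_expand[OF assms(3)] by (simp add: inner_sum_right)
    moreover have "integrable \<mu> (\<lambda>x. unit_exp (- (x \<bullet> w)))" for w
      by (rule integrable_unit_exp)
        (simp cong: measurable_cong_sets add: measurable_cong_sets[OF assms(2) refl])
    ultimately show ?thesis by (simp add: fourier_transform_unit_exp)
  qed
  also have "norm \<dots> \<le> (\<Sum>j\<in>PiE I (\<lambda>_. {..<N}). \<Sum>j'\<in>PiE I (\<lambda>_. {..<N}).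
      norm (fourier_transform \<mu> (\<Sum>i\<in>I. (real (j i) - real (j' i)) *\<^sub>R v i)))"
    by (intro order_trans[OF norm_sum] sum_mono order_refl)
  finally show ?thesis unfolding A_def .
qed

lemma measure_bohr_set_le:
  fixes \<mu> :: "'a::euclidean_space measure"
  assumes "finite_measure \<mu>" "sets \<mu> = sets borel" "finite I" "N > 0"
    and rows: "\<And>j. j \<in> PiE I (\<lambda>_. {..<N}) \<Longrightarrow> (\<Sum>j'\<in>PiE I (\<lambda>_. {..<N}).
      norm (fourier_transform \<mu> (\<Sum>i\<in>I. (real (j i) - real (j' i)) *\<^sub>R v i))) \<le> B"
  shows "measure \<mu> (bohr_set I v (1 / (8 * real N))) \<le> (4 / real N) ^ card I * B"
proof -
  let ?m = "measure \<mu> (bohr_set I v (1 / (8 * real N)))"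
  have "?m * ((real N)\<^sup>2 / 4) ^ card I \<le> (\<Sum>j\<in>PiE I (\<lambda>_. {..<N}). B)"
    using measure_bohr_set_le_sum_fourier[OF assms(1-4), of v] rows by (meson order_trans sum_mono)
  also have "\<dots> = real N ^ card I * B" using assms(3) by (simp add: card_PiE)
  finally have "(4 / (real N)\<^sup>2) ^ card I * (?m * ((real N)\<^sup>2 / 4) ^ card I) \<le>
      (4 / (real N)\<^sup>2) ^ card I * (real N ^ card I * B)"
    by (intro mult_left_mono) auto
  then show ?thesis
    using assms(4) by (simp add: power_divide power2_eq_square power_mult_distrib field_simps)
qed

lemma measure_bohr_set_Basis_le:
  fixes \<mu> :: "'a::euclidean_space measure" and f :: "'b::euclidean_space \<Rightarrow> 'a"
  assumes "finite_measure \<mu>" "sets \<mu> = sets borel" "N > 0" "linear f"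
    and bound: "\<And>S. finite S \<Longrightarrow> S \<subseteq> int_lattice \<Longrightarrow>
      (\<And>v. v \<in> S \<Longrightarrow> \<langle>v\<rangle> \<le> (real DIM('b) + 1) * real N) \<Longrightarrow>
      (\<Sum>v\<in>S. norm (fourier_transform \<mu> (f v))) \<le> B"
  shows "measure \<mu> (bohr_set Basis f (1 / (8 * real N))) \<le> (4 / real N) ^ DIM('b) * B"
proof (rule measure_bohr_set_le[OF assms(1,2) finite_Basis \<open>N > 0\<close>])
  fix j :: "'b \<Rightarrow> nat" assume j: "j \<in> PiE Basis (\<lambda>_. {..<N})"
  define P where "P = PiE (Basis :: 'b set) (\<lambda>_. {..<N})"
  define diff where "diff j' = (\<Sum>b\<in>Basis. (real (j b) - real (j' b)) *\<^sub>R b :: 'b)"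
    for j' :: "'b \<Rightarrow> nat"
  have diff_inner: "diff j' \<bullet> b = real (j b) - real (j' b)" if "b \<in> Basis" for j' b
    unfolding diff_def
    using that by (simp add: inner_sum_left inner_Basis if_distrib sum.delta cong: if_cong)
  have inj: "inj_on diff P"
  proof (rule inj_onI)
    fix k l assume kl: "k \<in> P" "l \<in> P" "diff k = diff l"
    then have "k b = l b" if "b \<in> Basis" for b
      using diff_inner[OF that, of k] diff_inner[OF that, of l] by simp
    then show "k = l" using kl unfolding P_def by (intro PiE_ext) auto
  qed
  have "(\<Sum>j'\<in>P. norm (fourier_transform \<mu> (f (diff j')))) =
      (\<Sum>v\<in>diff ` P. norm (fourier_transform \<mu> (f v)))"
    by (subst sum.reindex[OF inj]) simp
  also have "\<dots> \<le> B"
  proof (rule bound)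
    show "finite (diff ` P)" unfolding P_def by (intro finite_imageI finite_PiE) auto
    show "diff ` P \<subseteq> int_lattice" by (auto simp: int_lattice_def diff_inner)
    fix v assume "v \<in> diff ` P"
    then obtain j' where j': "j' \<in> P" "v = diff j'" by blast
    have "norm v \<le> (\<Sum>b\<in>Basis. \<bar>v \<bullet> b\<bar>)" by (rule norm_le_l1)
    also have "\<dots> \<le> (\<Sum>b\<in>(Basis::'b set). real N)"
    proof (rule sum_mono)
      fix b :: 'b assume b: "b \<in> Basis"
      then have "j b < N" "j' b < N" using j j'(1) by (auto simp: P_def)
      then show "\<bar>v \<bullet> b\<bar> \<le> real N" unfolding j'(2) diff_inner[OF b] by linarith
    qed
    finally show "\<langle>v\<rangle> \<le> (real DIM('b) + 1) * real N"
      using \<open>N > 0\<close> by (simp add: bracket_def distrib_right)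
  qed
  finally show "(\<Sum>j'\<in>PiE Basis (\<lambda>_. {..<N}).
      norm (fourier_transform \<mu> (\<Sum>b\<in>Basis. (real (j b) - real (j' b)) *\<^sub>R f b))) \<le> B"
    using \<open>linear f\<close> by (simp add: P_def diff_def linear_sum linear_scale)
qed

section \<open>Well approximable matrices are null for rapidly decaying measures\<close>

definition outer :: "real ^ 'n \<Rightarrow> real ^ 'd \<Rightarrow> real ^ 'd ^ 'n" where
  "outer v w = (\<chi> i. v $ i *\<^sub>R w)"

lemma linear_outer_left: "linear (\<lambda>v. outer v w)"
  by (rule linearI) (simp_all add: outer_def vec_eq_iff algebra_simps)

lemma outer_component: "outer v w $ i $ j = v $ i * w $ j"
  by (simp add: outer_def)

lemma outer_0_left [simp]: "outer 0 w = 0"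
  by (simp add: outer_def vec_eq_iff)

lemma norm_outer: "norm (outer v w) = norm v * norm w"
proof -
  have "(norm (outer v w))\<^sup>2 = (\<Sum>i\<in>UNIV. (v $ i)\<^sup>2 * (norm w)\<^sup>2)"
    unfolding power2_norm_eq_inner
    by (subst inner_vec_def)
      (simp add: outer_def power2_eq_square mult_ac flip: power2_norm_eq_inner)
  also have "\<dots> = (norm v * norm w)\<^sup>2"
    unfolding power_mult_distrib power2_norm_eq_inner[of v]
    by (subst inner_vec_def) (simp add: power2_eq_square sum_distrib_right)
  finally show ?thesis by (simp add: power2_eq_iff_nonneg)
qed

lemma outer_eq_0_iff: "outer v w = 0 \<longleftrightarrow> v = 0 \<or> w = 0"
  using norm_outer[of v w] by (metis mult_eq_0_iff norm_eq_zero)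

lemma inner_outer: "x \<bullet> outer v w = v \<bullet> (x *v w)"
  unfolding outer_def
  by (subst (1 2) inner_vec_def)
    (simp add: matrix_vector_mult_def inner_vec_def sum_distrib_left mult_ac)

lemma continuous_on_matrix_vector_component: "continuous_on A (\<lambda>x :: real ^ 'd ^ 'n. (x *v w) $ i)"
  unfolding matrix_vector_mult_def by (simp, intro continuous_intros)

lemma vec_int_lattice: "((\<chi> i. real_of_int (f i)) :: real ^ 'n) \<in> int_lattice"
  by (auto simp: int_lattice_def Basis_vec_def inner_axis)

lemma real_vec_int_lattice: "real_vec q \<in> int_lattice"
  unfolding real_vec_def by (rule vec_int_lattice)

lemma real_vec_eq_0_iff [simp]: "real_vec q = 0 \<longleftrightarrow> q = 0"
  by (simp add: real_vec_def vec_eq_iff)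

lemma real_vec_0 [simp]: "real_vec 0 = 0"
  by simp

lemma inj_real_vec: "inj real_vec"
  by (auto simp: inj_def real_vec_def vec_eq_iff)

lemma sum_real_vec_bracket_powr_bounded:
  assumes "p > real CARD('k)"
  obtains L where "L > 0" "\<And>T :: (int ^ 'k) set. finite T \<Longrightarrow> (\<Sum>q\<in>T. \<langle>real_vec q\<rangle> powr (- p)) \<le> L"
proof -
  have "p > real DIM(real ^ 'k)" using assms by simp
  then obtain L where L: "L > 0" "\<And>(\<xi>::real ^ 'k) T. finite T \<Longrightarrow> T \<subseteq> int_lattice \<Longrightarrow>
      (\<Sum>l\<in>T. \<langle>\<xi> - l\<rangle> powr (- p)) \<le> L"
    by (rule sum_int_lattice_bracket_powr_bounded) (rule that)
  have "(\<Sum>q\<in>T. \<langle>real_vec q\<rangle> powr (- p)) \<le> L" if "finite T" for T :: "(int ^ 'k) set"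
  proof -
    have "(\<Sum>q\<in>T. \<langle>real_vec q\<rangle> powr (- p)) = (\<Sum>l\<in>real_vec ` T. \<langle>0 - l\<rangle> powr (- p))"
      by (subst sum.reindex) (auto intro: inj_on_subset[OF inj_real_vec])
    also have "\<dots> \<le> L" using that by (intro L(2)) (auto simp: real_vec_int_lattice)
    finally show ?thesis .
  qed
  with L(1) show ?thesis by (rule that)
qed

definition resonant_nbhd :: "real ^ 'd \<Rightarrow> real \<Rightarrow> (real ^ 'd ^ 'n) set" where
  "resonant_nbhd w \<delta> = {x. \<forall>i. infdist ((x *v w) $ i) \<int> \<le> \<delta>}"

lemma closed_resonant_nbhd: "closed (resonant_nbhd w \<delta>)"
proof -
  have "resonant_nbhd w \<delta> = (\<Inter>i. {x. infdist ((x *v w) $ i) \<int> \<le> \<delta>})"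
    by (auto simp: resonant_nbhd_def)
  also have "closed \<dots>"
    by (intro closed_INT ballI closed_Collect_le continuous_intros
        continuous_on_matrix_vector_component)
  finally show ?thesis .
qed

lemma resonant_nbhd_mono: "\<delta> \<le> \<delta>' \<Longrightarrow> resonant_nbhd w \<delta> \<subseteq> resonant_nbhd w \<delta>'"
  by (auto simp: resonant_nbhd_def intro: order_trans)

lemma bohr_set_outer: "bohr_set Basis (\<lambda>v. outer v w) \<delta> = resonant_nbhd w \<delta>"
  by (auto simp: bohr_set_def resonant_nbhd_def Basis_vec_def inner_outer inner_axis')

lemma ex_nat_inverse_scale:
  assumes "0 < \<delta>" "\<delta> \<le> 1 / 8"
  obtains N :: nat where "N > 0" "\<delta> \<le> 1 / (8 * real N)" "1 / real N \<le> 16 * \<delta>"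
proof -
  define N where "N = nat \<lfloor>1 / (8 * \<delta>)\<rfloor>"
  have "1 \<le> 1 / (8 * \<delta>)" using assms by simp
  then have "1 \<le> \<lfloor>1 / (8 * \<delta>)\<rfloor>" by (simp add: le_floor_iff)
  then have N: "N \<ge> 1" "real N \<le> 1 / (8 * \<delta>)" "1 / (8 * \<delta>) < real N + 1"
    unfolding N_def by linarith+
  then have "1 / (8 * \<delta>) < 2 * real N" by simp
  then show ?thesis using N assms by (intro that[of N]) (simp_all add: field_simps)
qed

lemma inverse_scale_powr_le:
  assumes "N > 0" "1 / real N \<le> 16 * \<delta>" "0 \<le> e" "e \<le> n"
  shows "real N powr (- e) \<le> 16 powr n * \<delta> powr e"
proof -
  have "0 < 16 * \<delta>" using assms(1,2) less_le_trans[of 0 "1 / real N" "16 * \<delta>"] by simp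
  have "real N powr (- e) = (1 / real N) powr e"
    using assms(1) by (simp add: powr_divide powr_minus_divide)
  also have "\<dots> \<le> (16 * \<delta>) powr e" using assms by (intro powr_mono2) auto
  also have "\<dots> \<le> 16 powr n * \<delta> powr e"
    using \<open>0 < 16 * \<delta>\<close> assms(4) by (simp add: powr_mult mult_right_mono powr_mono)
  finally show ?thesis .
qed

context
  fixes \<mu> :: "(real ^ 'd ^ 'n) measure" and C \<sigma> \<epsilon> :: real
  assumes prob: "prob_space \<mu>" and borel: "sets \<mu> = sets borel"
    and decay: "decay_bound C \<sigma> (fourier_transform \<mu>)"
    and \<sigma>: "0 \<le> \<sigma>" "\<sigma> \<le> real CARD('n)" and \<epsilon>: "0 < \<epsilon>" "\<epsilon> \<le> \<sigma>"
begin

lemma fourier_transform_outer_le: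
  assumes "v \<in> int_lattice" "v \<noteq> 0" "w \<noteq> 0" "\<langle>v\<rangle> \<le> X"
  shows "norm (fourier_transform \<mu> (outer v w)) \<le> C * 2 powr \<sigma> * X powr (real CARD('n) + \<epsilon> - \<sigma>) *
    norm w powr (- \<sigma>) * \<langle>v\<rangle> powr (- (real CARD('n) + \<epsilon>))"
proof -
  define p where "p = real CARD('n) + \<epsilon>"
  have "0 \<le> C" using decay by (rule decay_bound_const_nonneg)
  have "\<langle>v\<rangle> powr (- \<sigma>) = \<langle>v\<rangle> powr (p - \<sigma>) * \<langle>v\<rangle> powr (- p)" by (simp flip: powr_add)
  also have "\<dots> \<le> X powr (p - \<sigma>) * \<langle>v\<rangle> powr (- p)"
    using assms(4) \<sigma> \<epsilon> by (intro mult_right_mono powr_mono2) (auto simp: p_def)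
  finally have bracket_le: "\<langle>v\<rangle> powr (- \<sigma>) \<le> X powr (p - \<sigma>) * \<langle>v\<rangle> powr (- p)" .
  have "norm (fourier_transform \<mu> (outer v w)) \<le> C * \<langle>outer v w\<rangle> powr (- \<sigma>)"
    using decay by (rule decay_boundD)
  also have "\<dots> \<le> C * norm (outer v w) powr (- \<sigma>)"
    using assms \<sigma> \<open>0 \<le> C\<close>
    by (intro mult_left_mono powr_mono2') (auto simp: outer_eq_0_iff bracket_def)
  also have "\<dots> = C * norm w powr (- \<sigma>) * norm v powr (- \<sigma>)" by (simp add: norm_outer powr_mult)
  also have "\<dots> \<le> C * norm w powr (- \<sigma>) * (2 powr \<sigma> * \<langle>v\<rangle> powr (- \<sigma>))"
    using assms \<open>0 \<le> C\<close> \<sigma> by (intro mult_left_mono norm_powr_le_bracket norm_ge_1_int_lattice) auto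
  also have "\<dots> \<le> C * norm w powr (- \<sigma>) * (2 powr \<sigma> * (X powr (p - \<sigma>) * \<langle>v\<rangle> powr (- p)))"
    using \<open>0 \<le> C\<close> by (intro mult_left_mono bracket_le) auto
  finally show ?thesis by (simp add: p_def mult_ac)
qed

lemma sum_fourier_transform_outer_le:
  assumes S: "finite S" "S \<subseteq> int_lattice" "\<And>v. v \<in> S \<Longrightarrow> \<langle>v\<rangle> \<le> X" and "w \<noteq> 0"
    and L: "\<And>T :: (real ^ 'n) set. finite T \<Longrightarrow> T \<subseteq> int_lattice \<Longrightarrow>
      (\<Sum>v\<in>T. \<langle>v\<rangle> powr (- (real CARD('n) + \<epsilon>))) \<le> L"
  shows "(\<Sum>v\<in>S. norm (fourier_transform \<mu> (outer v w))) \<le>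
    1 + C * 2 powr \<sigma> * X powr (real CARD('n) + \<epsilon> - \<sigma>) * norm w powr (- \<sigma>) * L"
proof -
  define K where "K = C * 2 powr \<sigma> * X powr (real CARD('n) + \<epsilon> - \<sigma>) * norm w powr (- \<sigma>)"
  have "0 \<le> K" using decay_bound_const_nonneg[OF decay] by (simp add: K_def)
  have "norm (fourier_transform \<mu> (outer v w)) \<le>
      (if v = 0 then 1 else 0) + K * \<langle>v\<rangle> powr (- (real CARD('n) + \<epsilon>))" if "v \<in> S" for v
  proof (cases "v = 0")
    case True
    with \<open>0 \<le> K\<close> show ?thesis by (simp add: norm_fourier_transform_le_1[OF prob] add_increasing2)
  next
    case False
    then show ?thesis using fourier_transform_outer_le[of v w X] that S(2,3) \<open>w \<noteq> 0\<close>
      by (auto simp: K_def)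
  qed
  then have "(\<Sum>v\<in>S. norm (fourier_transform \<mu> (outer v w))) \<le>
      (\<Sum>v\<in>S. (if v = 0 then 1 else 0) + K * \<langle>v\<rangle> powr (- (real CARD('n) + \<epsilon>)))"
    by (rule sum_mono)
  also have "\<dots> \<le> 1 + K * L"
    unfolding sum.distrib sum_distrib_left[symmetric] using S \<open>0 \<le> K\<close>
    by (intro add_mono mult_left_mono L) auto
  finally show ?thesis by (simp add: K_def)
qed

lemma measure_resonant_nbhd_inverse_nat_le:
  obtains D where "D > 0" and "\<And>w N. w \<noteq> 0 \<Longrightarrow> N > 0 \<Longrightarrow>
    measure \<mu> (resonant_nbhd w (1 / (8 * real N))) \<le>
      D * (real N powr (- real CARD('n)) + norm w powr (- \<sigma>) * real N powr (\<epsilon> - \<sigma>))"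
proof -
  define n where "n = real CARD('n)"
  have "n + \<epsilon> > real DIM(real ^ 'n)" using \<epsilon> by (simp add: n_def)
  then obtain L where L: "L > 0" "\<And>(\<xi>::real ^ 'n) T. finite T \<Longrightarrow> T \<subseteq> int_lattice \<Longrightarrow>
      (\<Sum>l\<in>T. \<langle>\<xi> - l\<rangle> powr (- (n + \<epsilon>))) \<le> L"
    by (rule sum_int_lattice_bracket_powr_bounded) (rule that)
  have sum_at_0: "(\<Sum>v\<in>T. \<langle>v\<rangle> powr (- (n + \<epsilon>))) \<le> L" if "finite T" "T \<subseteq> int_lattice"
    for T :: "(real ^ 'n) set"
    using L(2)[OF that, of 0] by simp
  define U where "U = C * 2 powr \<sigma> * (n + 1) powr (n + \<epsilon> - \<sigma>) * L"
  have "0 \<le> U" using decay_bound_const_nonneg[OF decay] L(1) by (simp add: U_def)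
  show ?thesis
  proof (rule that[of "4 ^ CARD('n) * (1 + U)"])
    show "4 ^ CARD('n) * (1 + U) > 0" using \<open>0 \<le> U\<close> by simp
    fix w :: "real ^ 'd" and N :: nat assume w: "w \<noteq> 0" and N: "N > 0"
    define K where "K = C * 2 powr \<sigma> * ((n + 1) * N) powr (n + \<epsilon> - \<sigma>) * norm w powr (- \<sigma>)"
    have "measure \<mu> (bohr_set Basis (\<lambda>v. outer v w) (1 / (8 * real N))) \<le>
        (4 / real N) ^ DIM(real ^ 'n) * (1 + K * L)"
      unfolding K_def n_def
      by (rule measure_bohr_set_Basis_le[OF prob_space.finite_measure[OF prob] borel N
          linear_outer_left],
          rule sum_fourier_transform_outer_le)
        (use w sum_at_0 in \<open>auto simp: n_def\<close>)
    also have "\<dots> =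
        4 ^ CARD('n) *
            (real N powr (- n) + U *
                (norm w powr (- \<sigma>) * (real N powr (- n) * real N powr (n + \<epsilon> - \<sigma>))))"
      using N unfolding K_def powr_mult
      by (simp add: U_def power_divide powr_minus_divide powr_realpow n_def field_simps)
    also have "real N powr (- n) * real N powr (n + \<epsilon> - \<sigma>) = real N powr (\<epsilon> - \<sigma>)"
      by (simp flip: powr_add)
    also have "4 ^ CARD('n) * (real N powr (- n) + U * (norm w powr (- \<sigma>) * real N powr (\<epsilon> - \<sigma>))) \<le>
        4 ^ CARD('n) * ((1 + U) * (real N powr (- n) + norm w powr (- \<sigma>) * real N powr (\<epsilon> - \<sigma>)))"
      using \<open>0 \<le> U\<close> by (intro mult_left_mono) (auto simp: distrib_left distrib_right)
    finally show "measure \<mu> (resonant_nbhd w (1 / (8 * real N))) \<le> 4 ^ CARD('n) * (1 + U) *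
        (real N powr (- real CARD('n)) + norm w powr (- \<sigma>) * real N powr (\<epsilon> - \<sigma>))"
      by (simp add: bohr_set_outer n_def mult.assoc)
  qed
qed

lemma measure_resonant_nbhd_le:
  obtains D where "D > 0" and "\<And>w \<delta>. w \<noteq> 0 \<Longrightarrow> \<delta> > 0 \<Longrightarrow>
    measure \<mu> (resonant_nbhd w \<delta>) \<le> D * (\<delta> powr real CARD('n) + norm w powr (- \<sigma>) * \<delta> powr (\<sigma> - \<epsilon>))"
proof -
  define n where "n = real CARD('n)"
  obtain D where D: "D > 0" "\<And>w N. w \<noteq> 0 \<Longrightarrow> N > 0 \<Longrightarrow>
      measure \<mu> (resonant_nbhd w (1 / (8 * real N))) \<le>
        D * (real N powr (- n) + norm w powr (- \<sigma>) * real N powr (\<epsilon> - \<sigma>))"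
    by (rule measure_resonant_nbhd_inverse_nat_le[folded n_def]) (rule that)
  interpret prob_space \<mu> by (rule prob)
  show ?thesis
  proof (rule that[of "(D + 1) * 16 powr n"])
    show "(D + 1) * 16 powr n > 0" using D(1) by simp
    fix w :: "real ^ 'd" and \<delta> :: real assume w: "w \<noteq> 0" and \<delta>: "\<delta> > 0"
    define S where "S = \<delta> powr n + norm w powr (- \<sigma>) * \<delta> powr (\<sigma> - \<epsilon>)"
    have "measure \<mu> (resonant_nbhd w \<delta>) \<le> (D + 1) * 16 powr n * S"
    proof (cases "\<delta> \<le> 1 / 8")
      case True
      obtain N :: nat where N: "N > 0" "\<delta> \<le> 1 / (8 * real N)" "1 / real N \<le> 16 * \<delta>"
        using \<delta> True by (rule ex_nat_inverse_scale)
      have "measure \<mu> (resonant_nbhd w \<delta>) \<le> measure \<mu> (resonant_nbhd w (1 / (8 * real N)))"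
        using N(2) borel
        by (intro finite_measure_mono resonant_nbhd_mono)
          (auto intro: borel_closed closed_resonant_nbhd)
      also have "\<dots> \<le> D * (real N powr (- n) + norm w powr (- \<sigma>) * real N powr (- (\<sigma> - \<epsilon>)))"
        using D(2)[OF w N(1)] by simp
      also have "\<dots> \<le> D * (16 powr n * \<delta> powr n + norm w powr (- \<sigma>) * (16 powr n * \<delta> powr (\<sigma> - \<epsilon>)))"
        using D(1) \<sigma> \<epsilon>
        by (intro mult_left_mono add_mono inverse_scale_powr_le N(1,3)) (auto simp: n_def)
      also have "\<dots> = D * 16 powr n * S" by (simp add: S_def distrib_left mult_ac)
      also have "\<dots> \<le> (D + 1) * 16 powr n * S" by (intro mult_right_mono) (auto simp: S_def)
      finally show ?thesis .
    next
      case False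
      have "1 \<le> (16 * \<delta>) powr n" using False by (intro ge_one_powr_ge_zero) (auto simp: n_def)
      also have "\<dots> \<le> 16 powr n * S" using \<delta> by (simp add: powr_mult S_def mult_left_mono)
      also have "\<dots> \<le> (D + 1) * (16 powr n * S)"
        using mult_right_mono[of 1 "D + 1" "16 powr n * S"] D(1) by (simp add: S_def)
      finally show ?thesis by (intro order_trans[OF prob_le_1]) (simp add: mult.assoc)
    qed
    then show "measure \<mu> (resonant_nbhd w \<delta>) \<le> (D + 1) * 16 powr n *
        (\<delta> powr real CARD('n) + norm w powr (- \<sigma>) * \<delta> powr (\<sigma> - \<epsilon>))" by (simp add: S_def n_def)
  qed
qed

end

lemma AE_finite_if_summable:
  fixes A :: "'i::countable \<Rightarrow> 'a set"
  assumes "finite_measure M" and A: "\<And>i. A i \<in> sets M"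
    and bound: "\<And>T. finite T \<Longrightarrow> (\<Sum>i\<in>T. measure M (A i)) \<le> B"
  shows "AE x in M. finite {i. x \<in> A i}"
proof -
  interpret finite_measure M by fact
  define A' where "A' k = (if k \<in> range (to_nat :: 'i \<Rightarrow> nat) then A (from_nat k) else {})" for k
  have "summable (\<lambda>k. measure M (A' k))"
  proof (rule summableI_nonneg_bounded)
    fix K
    have "(\<Sum>k<K. measure M (A' k)) =
        (\<Sum>k\<in>{..<K} \<inter> range (to_nat :: 'i \<Rightarrow> nat). measure M (A (from_nat k)))"
      by (simp add: A'_def if_distrib[of "measure M"] sum.If_cases cong: if_cong)
    also have "\<dots> = (\<Sum>i\<in>from_nat ` ({..<K} \<inter> range (to_nat :: 'i \<Rightarrow> nat)). measure M (A i))"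
      by (subst sum.reindex) (auto simp: inj_on_def)
    also have "\<dots> \<le> B" by (intro bound) auto
    finally show "(\<Sum>k<K. measure M (A' k)) \<le> B" .
  qed simp
  then have "AE x in M. eventually (\<lambda>k. x \<in> space M - A' k) sequentially"
    using A by (intro borel_cantelli_AE1)
      (auto simp: A'_def emeasure_eq_measure less_top[symmetric])
  then show ?thesis
  proof eventually_elim
    case (elim x)
    then obtain K where "\<And>k. k \<ge> K \<Longrightarrow> x \<notin> A' k" by (auto simp: eventually_sequentially)
    moreover have "x \<in> A' (to_nat i)" if "x \<in> A i" for i using that by (simp add: A'_def)
    ultimately have "to_nat ` {i. x \<in> A i} \<subseteq> {..<K}" by (force simp: not_le[symmetric])
    then have "finite (to_nat ` {i. x \<in> A i})" by (rule finite_subset) simp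
    then show ?case by (rule finite_imageD) (simp add: inj_on_def)
  qed
qed

lemma infnorm_real_vec_ge_1:
  assumes "q \<noteq> 0"
  shows "1 \<le> infnorm (real_vec q)"
proof -
  obtain i where "q $ i \<noteq> 0" using assms by (auto simp: vec_eq_iff)
  then have "1 \<le> \<bar>real_vec q $ i\<bar>" by (simp add: real_vec_def flip: of_int_abs)
  also have "\<dots> \<le> infnorm (real_vec q)" by (rule component_le_infnorm_cart)
  finally show ?thesis .
qed

lemma infnorm_powr_le_bracket:
  fixes v :: "'a::euclidean_space"
  assumes "1 \<le> infnorm v" "0 \<le> a"
  shows "infnorm v powr (- a) \<le> (2 * sqrt (real DIM('a))) powr a * \<langle>v\<rangle> powr (- a)"
proof -
  have "1 + norm v \<le> 2 * norm v" using infnorm_le_norm[of v] assms by linarith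
  then have "\<langle>v\<rangle> \<le> 2 * sqrt (real DIM('a)) * infnorm v"
    using norm_le_infnorm[of v] by (simp add: bracket_def)
  then have "(2 * sqrt (real DIM('a)) * infnorm v) powr (- a) \<le> \<langle>v\<rangle> powr (- a)"
    using assms by (intro powr_mono2') auto
  then have "(2 * sqrt (real DIM('a))) powr a *
      ((2 * sqrt (real DIM('a))) powr (- a) * infnorm v powr (- a)) \<le>
      (2 * sqrt (real DIM('a))) powr a * \<langle>v\<rangle> powr (- a)"
    using assms by (intro mult_left_mono) (auto simp: powr_mult)
  then show ?thesis by (simp flip: mult.assoc powr_add)
qed

lemma infnorm_le_cart: "(\<And>i. \<bar>x $ i\<bar> \<le> c) \<Longrightarrow> infnorm x \<le> c" for x :: "real ^ 'n"
  unfolding infnorm_cart by (rule cSup_least) auto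

lemma finite_int_vec_near: "finite {r :: int ^ 'n. infnorm (y - real_vec r) < c}"
proof (rule finite_subset)
  let ?B = "PiE (UNIV :: 'n set) (\<lambda>i. {\<lfloor>y $ i - c\<rfloor>..\<lceil>y $ i + c\<rceil>})"
  show "{r :: int ^ 'n. infnorm (y - real_vec r) < c} \<subseteq> vec_lambda ` ?B"
  proof
    fix r :: "int ^ 'n" assume r: "r \<in> {r. infnorm (y - real_vec r) < c}"
    have "r $ i \<in> {\<lfloor>y $ i - c\<rfloor>..\<lceil>y $ i + c\<rceil>}" for i
    proof -
      have "\<bar>y $ i - real_of_int (r $ i)\<bar> < c"
        using component_le_infnorm_cart[of "y - real_vec r" i] r by (simp add: real_vec_def)
      then show ?thesis unfolding atLeastAtMost_iff abs_less_iff by linarith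
    qed
    then show "r \<in> vec_lambda ` ?B" by (intro image_eqI[of _ _ "\<lambda>i. r $ i"]) (auto simp: vec_eq_iff)
  qed
  show "finite (vec_lambda ` ?B)" by (intro finite_imageI finite_PiE) auto
qed

lemma well_approximable_imp_infinite_resonant:
  fixes x :: "real ^ 'd ^ 'n"
  assumes "x \<in> well_approximable \<tau>"
  shows "infinite {q. q \<noteq> 0 \<and> x \<in> resonant_nbhd (real_vec q) (infnorm (real_vec q) powr (- \<tau>))}"
    (is "infinite ?Q")
proof
  assume "finite ?Q"
  let ?R = "\<lambda>q :: int ^ 'd. {r :: int ^ 'n. infnorm (x *v real_vec q - real_vec r) <
      infnorm (real_vec q) powr (- \<tau>)}"
  have resonant: "q \<in> ?Q" if "q \<noteq> 0" "r \<in> ?R q" for q r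
  proof -
    have "infdist ((x *v real_vec q) $ i) \<int> \<le> infnorm (real_vec q) powr (- \<tau>)" for i
      using component_le_infnorm_cart[of "x *v real_vec q - real_vec r" i] that(2)
      by (auto simp: infdist_Ints_le_iff real_vec_def intro!: exI[of _ "r $ i"])
    with that(1) show ?thesis by (simp add: resonant_nbhd_def)
  qed
  have "finite (SIGMA q:?Q. ?R q)" using \<open>finite ?Q\<close> by (intro finite_SigmaI finite_int_vec_near)
  moreover have "{(q, r). q \<noteq> 0 \<and> r \<in> ?R q} \<subseteq> (SIGMA q:?Q. ?R q)" using resonant by blast
  ultimately have "finite {(q, r). q \<noteq> 0 \<and> r \<in> ?R q}" by (rule rev_finite_subset)
  then show False using assms by (simp add: well_approximable_def)
qed

lemma measure_resonant_nbhd_infnorm_le: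
  fixes \<mu> :: "(real ^ 'd ^ 'n) measure"
  assumes "prob_space \<mu>" "sets \<mu> = sets borel"
    and "decay_bound C \<sigma> (fourier_transform \<mu>)"
    and "0 \<le> \<sigma>" "\<sigma> \<le> real CARD('n)" "0 < \<epsilon>" "\<epsilon> \<le> \<sigma>" "0 \<le> \<tau>"
  defines "\<alpha> \<equiv> min (\<tau> * real CARD('n)) (\<sigma> + \<tau> * (\<sigma> - \<epsilon>))"
  obtains D where "D \<ge> 0" and "\<And>q. q \<noteq> 0 \<Longrightarrow>
    measure \<mu> (resonant_nbhd (real_vec q) (infnorm (real_vec q) powr (- \<tau>))) \<le>
        D * \<langle>real_vec q\<rangle> powr (- \<alpha>)"
proof -
  obtain D where D: "D > 0" "\<And>w \<delta>. w \<noteq> 0 \<Longrightarrow> \<delta> > 0 \<Longrightarrow>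
      measure \<mu> (resonant_nbhd w \<delta>) \<le>
          D * (\<delta> powr real CARD('n) + norm w powr (- \<sigma>) * \<delta> powr (\<sigma> - \<epsilon>))"
    by (rule measure_resonant_nbhd_le[OF assms(1-7)]) (rule that)
  have "0 \<le> \<alpha>" using assms by (simp add: \<alpha>_def)
  define s where "s = (2 * sqrt (real DIM(real ^ 'd))) powr \<alpha>"
  show ?thesis
  proof (rule that[of "D * (2 * s)"])
    show "0 \<le> D * (2 * s)" using D(1) by (simp add: s_def)
    fix q :: "int ^ 'd" assume "q \<noteq> 0"
    define u where "u = infnorm (real_vec q)"
    have u: "1 \<le> u" "u \<le> norm (real_vec q)"
      unfolding u_def using infnorm_real_vec_ge_1[OF \<open>q \<noteq> 0\<close>] infnorm_le_norm by auto
    have "measure \<mu> (resonant_nbhd (real_vec q) (u powr (- \<tau>))) \<le>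
        D * (u powr (- (\<tau> * real CARD('n))) + norm (real_vec q) powr (- \<sigma>) *
            u powr (- (\<tau> * (\<sigma> - \<epsilon>))))"
      using D(2)[of "real_vec q" "u powr (- \<tau>)"] \<open>q \<noteq> 0\<close> u by (simp add: powr_powr)
    also have "\<dots> \<le> D * (u powr (- \<alpha>) + u powr (- \<sigma>) * u powr (- (\<tau> * (\<sigma> - \<epsilon>))))"
      using D(1) u assms
      by (intro mult_left_mono add_mono mult_right_mono powr_mono powr_mono2') (auto simp: \<alpha>_def)
    also have "\<dots> \<le> D * (u powr (- \<alpha>) + u powr (- \<alpha>))"
      unfolding powr_add[symmetric] using D(1) u
      by (intro mult_left_mono add_mono powr_mono) (auto simp: \<alpha>_def)
    also have "\<dots> = D * 2 * u powr (- \<alpha>)" by simp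
    also have "\<dots> \<le> D * 2 * (s * \<langle>real_vec q\<rangle> powr (- \<alpha>))"
      unfolding u_def s_def using D(1) \<open>0 \<le> \<alpha>\<close>
      by (intro mult_left_mono infnorm_powr_le_bracket infnorm_real_vec_ge_1 \<open>q \<noteq> 0\<close>) auto
    finally show "measure \<mu> (resonant_nbhd (real_vec q) (infnorm (real_vec q) powr (- \<tau>))) \<le>
        D * (2 * s) * \<langle>real_vec q\<rangle> powr (- \<alpha>)" by (simp add: u_def mult.assoc)
  qed
qed

lemma ex_exponent_above:
  fixes \<tau> d n \<sigma> :: real
  assumes "0 < \<tau>" "d < \<tau> * n" "0 < \<sigma>" "d < (1 + \<tau>) * \<sigma>"
  obtains \<epsilon> where "0 < \<epsilon>" "\<epsilon> < \<sigma>" "d < min (\<tau> * n) (\<sigma> + \<tau> * (\<sigma> - \<epsilon>))"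
proof -
  have "0 < min \<sigma> (((1 + \<tau>) * \<sigma> - d) / \<tau>)" using assms by simp
  from dense[OF this] obtain \<epsilon> where \<epsilon>: "0 < \<epsilon>" "\<epsilon> < \<sigma>" "\<epsilon> < ((1 + \<tau>) * \<sigma> - d) / \<tau>"
    by auto
  then have "\<epsilon> * \<tau> < (1 + \<tau>) * \<sigma> - d" using assms(1) by (simp add: pos_less_divide_eq)
  then have "d < min (\<tau> * n) (\<sigma> + \<tau> * (\<sigma> - \<epsilon>))" using assms(2) by (simp add: algebra_simps)
  with \<epsilon>(1,2) show ?thesis by (rule that)
qed

lemma AE_not_well_approximable:
  fixes \<mu> :: "(real ^ 'd ^ 'n) measure"
  assumes \<tau>: "\<tau> > real CARD('d) / real CARD('n)" and prob: "prob_space \<mu>"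
    and borel: "sets \<mu> = sets borel"
    and decay: "decay_bound C \<sigma> (fourier_transform \<mu>)"
    and \<sigma>: "real CARD('d) / (1 + \<tau>) < \<sigma>" "\<sigma> \<le> real CARD('n)"
  shows "AE x in \<mu>. x \<notin> well_approximable \<tau>"
proof -
  define d n where "d = real CARD('d)" and "n = real CARD('n)"
  have "d > 0" "n > 0" by (auto simp: d_def n_def)
  then have "\<tau> > 0" using \<tau> unfolding d_def[symmetric] n_def[symmetric]
    by (meson divide_pos_pos less_trans)
  then have "0 < d / (1 + \<tau>)" using \<open>d > 0\<close> by simp
  then have "\<sigma> > 0" using \<sigma>(1) unfolding d_def by (rule less_trans)
  have "d < (1 + \<tau>) * \<sigma>" using \<sigma>(1) \<open>\<tau> > 0\<close> by (simp add: d_def field_simps)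
  moreover have "d < \<tau> * n" using \<tau> by (simp add: d_def n_def pos_divide_less_eq)
  ultimately obtain \<epsilon> where \<epsilon>: "0 < \<epsilon>" "\<epsilon> < \<sigma>" and exponent: "d < min (\<tau> * n) (\<sigma> + \<tau> * (\<sigma> - \<epsilon>))"
    using \<open>\<tau> > 0\<close> \<open>\<sigma> > 0\<close> by (rule_tac ex_exponent_above) auto
  define \<alpha> where "\<alpha> = min (\<tau> * n) (\<sigma> + \<tau> * (\<sigma> - \<epsilon>))"
  define A :: "int ^ 'd \<Rightarrow> (real ^ 'd ^ 'n) set" where
    "A q = (if q = 0 then {} else resonant_nbhd (real_vec q) (infnorm (real_vec q) powr (- \<tau>)))"
      for q
  obtain D where D: "D \<ge> 0" "\<And>q. q \<noteq> 0 \<Longrightarrow>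
      measure \<mu> (resonant_nbhd (real_vec q) (infnorm (real_vec q) powr (- \<tau>))) \<le>
          D * \<langle>real_vec q\<rangle> powr (- \<alpha>)"
    by (rule measure_resonant_nbhd_infnorm_le[OF prob borel decay less_imp_le[OF \<open>\<sigma> > 0\<close>] \<sigma>(2)
          \<epsilon>(1) less_imp_le[OF \<epsilon>(2)] less_imp_le[OF \<open>\<tau> > 0\<close>],
          folded n_def, folded \<alpha>_def]) (rule that)
  have "\<alpha> > real CARD('d)" using exponent by (simp add: \<alpha>_def d_def)
  then obtain L where L: "\<And>T :: (int ^ 'd) set. finite T \<Longrightarrow> (\<Sum>q\<in>T. \<langle>real_vec q\<rangle> powr (- \<alpha>)) \<le> L"
    by (rule sum_real_vec_bracket_powr_bounded) (rule that)
  have "AE x in \<mu>. finite {q. x \<in> A q}"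
  proof (rule AE_finite_if_summable[OF prob_space.finite_measure[OF prob]])
    show "A q \<in> sets \<mu>" for q
      unfolding A_def borel by (auto intro: borel_closed closed_resonant_nbhd)
    fix T :: "(int ^ 'd) set" assume "finite T"
    have "(\<Sum>q\<in>T. measure \<mu> (A q)) \<le> D * (\<Sum>q\<in>T. \<langle>real_vec q\<rangle> powr (- \<alpha>))"
      unfolding sum_distrib_left using D by (intro sum_mono) (simp add: A_def)
    also have "\<dots> \<le> D * L" using \<open>finite T\<close> D(1) by (intro mult_left_mono L)
    finally show "(\<Sum>q\<in>T. measure \<mu> (A q)) \<le> D * L" .
  qed
  then show ?thesis
  proof eventually_elim
    case (elim x)
    then have "finite {q. q \<noteq> 0 \<and> x \<in> resonant_nbhd (real_vec q) (infnorm (real_vec q) powr (- \<tau>))}"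
      by (rule rev_finite_subset) (auto simp: A_def)
    then show ?case using well_approximable_imp_infinite_resonant by blast
  qed
qed

section \<open>Lower bounds for the Hausdorff dimension\<close>

lemma hausdorff_premeasure_le_suminf:
  assumes "E \<subseteq> (\<Union>i. U i)" "\<And>i. bounded (U i)" "\<And>i. diameter (U i) \<le> \<delta>"
  shows "hausdorff_premeasure s \<delta> E \<le> (\<Sum>i. diam_power s (U i))"
  unfolding hausdorff_premeasure_def using assms by (intro Inf_lower) blast

lemma hausdorff_premeasure_lessE:
  assumes "hausdorff_premeasure s \<delta> E < c"
  obtains U where "E \<subseteq> (\<Union>i. U i)" "\<And>i. bounded (U i)" "\<And>i. diameter (U i) \<le> \<delta>"
    "(\<Sum>i. diam_power s (U i)) < c"
  using assms unfolding hausdorff_premeasure_def Inf_less_iff by blast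

lemma hausdorff_premeasure_mono:
  assumes "E \<subseteq> F"
  shows "hausdorff_premeasure s \<delta> E \<le> hausdorff_premeasure s \<delta> F"
  unfolding hausdorff_premeasure_def using assms by (intro Inf_superset_mono) blast

lemma hausdorff_premeasure_UN_eq_0:
  fixes E :: "nat \<Rightarrow> 'a::metric_space set"
  assumes "\<And>k. hausdorff_premeasure s \<delta> (E k) = 0"
  shows "hausdorff_premeasure s \<delta> (\<Union>k. E k) = 0"
proof -
  have "hausdorff_premeasure s \<delta> (\<Union>k. E k) \<le> ennreal \<epsilon>" if "\<epsilon> > 0" for \<epsilon> :: real
  proof -
    have "\<exists>U. E k \<subseteq> (\<Union>i. U i) \<and> (\<forall>i. bounded (U i) \<and> diameter (U i) \<le> \<delta>) \<and>
        (\<Sum>i. diam_power s (U i)) < ennreal (\<epsilon> * (1 / 2) ^ Suc k)" for k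
      by (rule hausdorff_premeasure_lessE[of s \<delta> "E k" "ennreal (\<epsilon> * (1 / 2) ^ Suc k)"])
        (use assms \<open>\<epsilon> > 0\<close> in auto)
    then obtain U where U: "\<And>k. E k \<subseteq> (\<Union>i. U k i)"
      "\<And>k i. bounded (U k i)" "\<And>k i. diameter (U k i) \<le> \<delta>"
      "\<And>k. (\<Sum>i. diam_power s (U k i)) < ennreal (\<epsilon> * (1 / 2) ^ Suc k)" by metis
    define V where "V i = case_prod U (prod_decode i)" for i
    have "(\<Union>k. E k) \<subseteq> (\<Union>i. V i)"
    proof
      fix x assume "x \<in> (\<Union>k. E k)"
      then obtain k i where "x \<in> U k i" using U(1) by blast
      then have "x \<in> V (prod_encode (k, i))" by (simp add: V_def)
      then show "x \<in> (\<Union>i. V i)" by blast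
    qed
    then have "hausdorff_premeasure s \<delta> (\<Union>k. E k) \<le> (\<Sum>i. diam_power s (V i))"
      by (intro hausdorff_premeasure_le_suminf) (auto simp: V_def U split: prod.split)
    also have "\<dots> = (\<Sum>i. (\<lambda>(k, j). diam_power s (U k j)) (prod_decode i))"
      by (simp add: V_def case_prod_unfold)
    also have "\<dots> = (\<Sum>k. \<Sum>j. diam_power s (U k j))" by (rule suminf_ennreal_2dimen) simp
    also have "\<dots> \<le> (\<Sum>k. ennreal (\<epsilon> * (1 / 2) ^ Suc k))"
      using U(4) by (intro suminf_le summableI less_imp_le)
    also have "\<dots> = ennreal \<epsilon>"
      using sums_mult[OF power_half_series, of \<epsilon>] \<open>\<epsilon> > 0\<close> by (intro suminf_ennreal_eq) auto
    finally show ?thesis .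
  qed
  then have "hausdorff_premeasure s \<delta> (\<Union>k. E k) \<le> 0 + ennreal \<epsilon>" if "\<epsilon> > 0" for \<epsilon>
    using that unfolding add_0 .
  then have "hausdorff_premeasure s \<delta> (\<Union>k. E k) \<le> 0" by (rule ennreal_le_epsilon)
  then show ?thesis by simp
qed

lemma hausdorff_premeasure_le_card:
  assumes "finite I" "E \<subseteq> (\<Union>i\<in>I. U i)" "0 \<le> \<delta>" "0 < s"
    and U: "\<And>i. i \<in> I \<Longrightarrow> bounded (U i)" "\<And>i. i \<in> I \<Longrightarrow> diameter (U i) \<le> \<delta>"
  shows "hausdorff_premeasure s \<delta> E \<le> ennreal (real (card I) * \<delta> powr s)"
proof -
  obtain h where h: "bij_betw h {0..<card I} I" using ex_bij_betw_nat_finite[OF assms(1)] by blast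
  define V where "V j = (if j < card I then U (h j) else {})" for j
  have h_in: "h j \<in> I" if "j < card I" for j using h that by (auto simp: bij_betw_def)
  have "E \<subseteq> (\<Union>j. V j)"
  proof
    fix x assume "x \<in> E"
    then obtain i where "i \<in> h ` {0..<card I}" "x \<in> U i"
      using assms(2) h by (auto simp: bij_betw_def)
    then show "x \<in> (\<Union>j. V j)" by (auto simp: V_def)
  qed
  then have "hausdorff_premeasure s \<delta> E \<le> (\<Sum>j. diam_power s (V j))"
    using U h_in \<open>0 \<le> \<delta>\<close> by (intro hausdorff_premeasure_le_suminf) (auto simp: V_def)
  also have "\<dots> = (\<Sum>j<card I. diam_power s (V j))"
    by (rule suminf_finite) (auto simp: V_def diam_power_def)
  also have "\<dots> \<le> (\<Sum>j<card I. ennreal (\<delta> powr s))"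
    using U h_in \<open>0 < s\<close>
    by (intro sum_mono)
      (auto simp: V_def diam_power_def intro!: ennreal_leI powr_mono2 diameter_ge_0)
  finally show ?thesis by (simp add: ennreal_mult ennreal_of_nat_eq_real_of_nat)
qed

lemma diameter_coordinate_cube:
  fixes S :: "'a::euclidean_space set"
  assumes "0 \<le> c" "\<And>x b. x \<in> S \<Longrightarrow> b \<in> Basis \<Longrightarrow> u b \<le> x \<bullet> b \<and> x \<bullet> b \<le> u b + c"
  shows "bounded S" "diameter S \<le> real DIM('a) * c"
proof -
  have dist_le: "dist x y \<le> real DIM('a) * c" if "x \<in> S" "y \<in> S" for x y
  proof -
    have "dist x y \<le> (\<Sum>b\<in>Basis. \<bar>(x - y) \<bullet> b\<bar>)" unfolding dist_norm by (rule norm_le_l1)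
    also have "\<dots> \<le> (\<Sum>b\<in>(Basis::'a set). c)"
    proof (rule sum_mono)
      fix b :: 'a assume "b \<in> Basis"
      then have "u b \<le> x \<bullet> b" "x \<bullet> b \<le> u b + c" "u b \<le> y \<bullet> b" "y \<bullet> b \<le> u b + c"
        using assms(2) that by auto
      then show "\<bar>(x - y) \<bullet> b\<bar> \<le> c" unfolding inner_diff_left abs_le_iff by linarith
    qed
    finally show ?thesis by simp
  qed
  then show "bounded S" unfolding bounded_two_points by blast
  show "diameter S \<le> real DIM('a) * c"
    by (rule diameter_le) (use dist_le assms(1) in \<open>auto simp: dist_norm\<close>)
qed

lemma hausdorff_premeasure_cube_le:
  fixes R :: real and n :: nat
  assumes "R > 0" "n > 0" "0 < s"
  defines "\<delta> \<equiv> real DIM('a::euclidean_space) * (2 * R / real n)"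
  shows "hausdorff_premeasure s \<delta> {x::'a. \<forall>b\<in>Basis. \<bar>x \<bullet> b\<bar> < R} \<le>
      ennreal (real (n ^ DIM('a)) * \<delta> powr s)"
proof -
  define c where "c = 2 * R / real n"
  have "c > 0" using assms by (simp add: c_def)
  define I where "I = PiE (Basis :: 'a set) (\<lambda>_. {..<n})"
  define Q where "Q f =
      {x :: 'a. \<forall>b\<in>Basis. - R + c * real (f b) \<le> x \<bullet> b \<and> x \<bullet> b \<le> - R + c * real (f b) + c}"
    for f :: "'a \<Rightarrow> nat"
  have "{x::'a. \<forall>b\<in>Basis. \<bar>x \<bullet> b\<bar> < R} \<subseteq> (\<Union>f\<in>I. Q f)"
  proof
    fix x :: 'a assume x: "x \<in> {x. \<forall>b\<in>Basis. \<bar>x \<bullet> b\<bar> < R}"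
    define f where "f = restrict (\<lambda>b. nat \<lfloor>(x \<bullet> b + R) / c\<rfloor>) Basis"
    have f: "real (f b) \<le> (x \<bullet> b + R) / c" "(x \<bullet> b + R) / c < real (f b) + 1" "f b < n"
      if b: "b \<in> Basis" for b
    proof -
      have "\<bar>x \<bullet> b\<bar> < R" using x b by blast
      then have "0 \<le> (x \<bullet> b + R) / c" "(x \<bullet> b + R) / c < 2 * R / c"
        using \<open>c > 0\<close> by (auto intro!: divide_nonneg_pos divide_strict_right_mono)
      moreover have "2 * R / c = real n" using assms by (simp add: c_def)
      ultimately show "real (f b) \<le> (x \<bullet> b + R) / c" "(x \<bullet> b + R) / c < real (f b) + 1" "f b < n"
        using b by (simp_all add: f_def) linarith+
    qed
    have "x \<in> Q f"
      using f(1,2) \<open>c > 0\<close> by (force simp: Q_def pos_le_divide_eq pos_divide_less_eq algebra_simps)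
    moreover have "f \<in> I" using f(3) by (auto simp: I_def f_def)
    ultimately show "x \<in> (\<Union>f\<in>I. Q f)" by blast
  qed
  moreover have "bounded (Q f)" "diameter (Q f) \<le> \<delta>" for f
    unfolding \<delta>_def c_def[symmetric]
    by (rule diameter_coordinate_cube[OF less_imp_le[OF \<open>c > 0\<close>]], auto simp: Q_def)+
  moreover have "finite I" "card I = n ^ DIM('a)" by (auto simp: I_def card_PiE intro!: finite_PiE)
  moreover have "0 \<le> \<delta>" using assms(1) by (simp add: \<delta>_def)
  ultimately show ?thesis using hausdorff_premeasure_le_card[of I _ Q \<delta> s] assms(3) by simp
qed

lemma hausdorff_premeasure_antimono:
  assumes "\<delta> \<le> \<delta>'"
  shows "hausdorff_premeasure s \<delta>' E \<le> hausdorff_premeasure s \<delta> E"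
  unfolding hausdorff_premeasure_def using order_trans[OF _ assms]
  by (intro Inf_superset_mono) blast

lemma hausdorff_premeasure_cube_eq_0:
  assumes "R > 0" "\<delta> > 0"
  shows "hausdorff_premeasure (real DIM('a::euclidean_space) + 1) \<delta> {x::'a. \<forall>b\<in>Basis. \<bar>x \<bullet> b\<bar> < R} =
      0"
    (is "hausdorff_premeasure ?s \<delta> ?Q = 0")
proof -
  define a where "a = real DIM('a) * (2 * R)"
  have "a > 0" using assms by (simp add: a_def)
  have "hausdorff_premeasure ?s \<delta> ?Q \<le> ennreal \<epsilon>" if "\<epsilon> > 0" for \<epsilon> :: real
  proof -
    obtain n :: nat where n: "max (a / \<delta>) (a powr ?s / \<epsilon>) < real n"
      using reals_Archimedean2 by blast
    have "0 < a / \<delta>" using \<open>a > 0\<close> assms by simp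
    then have "real n > 0" using n by linarith
    have "a / real n \<le> \<delta>" using n \<open>real n > 0\<close> assms by (simp add: field_simps)
    then have "hausdorff_premeasure ?s \<delta> ?Q \<le> hausdorff_premeasure ?s (a / real n) ?Q"
      by (rule hausdorff_premeasure_antimono)
    also have "\<dots> \<le> ennreal (real (n ^ DIM('a)) * (a / real n) powr ?s)"
      using hausdorff_premeasure_cube_le[of R n ?s, where 'a = 'a] assms \<open>real n > 0\<close>
      by (simp add: a_def)
    also have "real (n ^ DIM('a)) * (a / real n) powr ?s = a powr ?s / real n"
    proof -
      have "real n powr ?s = real n ^ DIM('a) * real n"
        using \<open>real n > 0\<close> by (simp add: powr_add powr_realpow)
      then show ?thesis using \<open>real n > 0\<close> \<open>a > 0\<close> by (simp add: powr_divide)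
    qed
    also have "\<dots> \<le> \<epsilon>" using n \<open>real n > 0\<close> \<open>\<epsilon> > 0\<close> by (simp add: field_simps)
    finally show ?thesis by (simp add: ennreal_leI)
  qed
  then have "hausdorff_premeasure ?s \<delta> ?Q \<le> 0 + ennreal \<epsilon>" if "\<epsilon> > 0" for \<epsilon>
    using that unfolding add_0 .
  then have "hausdorff_premeasure ?s \<delta> ?Q \<le> 0" by (rule ennreal_le_epsilon)
  then show ?thesis by simp
qed

lemma hausdorff_measure_DIM_plus_1:
  fixes E :: "'a::euclidean_space set"
  shows "hausdorff_measure (real DIM('a) + 1) E = 0"
proof -
  have "hausdorff_premeasure (real DIM('a) + 1) \<delta> E = 0" if "\<delta> > 0" for \<delta> :: real
  proof -
    define Q where "Q k = {x::'a. \<forall>b\<in>Basis. \<bar>x \<bullet> b\<bar> < real (Suc k)}" for k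
    have "x \<in> (\<Union>k. Q k)" for x
    proof -
      obtain k where "norm x < real k" using reals_Archimedean2 by blast
      then have "\<bar>x \<bullet> b\<bar> < real (Suc k)" if "b \<in> Basis" for b
        using Basis_le_norm[OF that, of x] by simp
      then show ?thesis by (auto simp: Q_def)
    qed
    then have "hausdorff_premeasure (real DIM('a) + 1) \<delta> E \<le>
        hausdorff_premeasure (real DIM('a) + 1) \<delta> (\<Union>k. Q k)"
      by (intro hausdorff_premeasure_mono) blast
    also have "\<dots> = 0"
      unfolding Q_def
      by (intro hausdorff_premeasure_UN_eq_0 hausdorff_premeasure_cube_eq_0 that) simp
    finally show ?thesis by simp
  qed
  then show ?thesis unfolding hausdorff_measure_def by (simp add: SUP_eq_const)
qed

lemma emeasure_closure_Int_le_diam_power: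
  fixes \<mu> :: "'a::euclidean_space measure"
  assumes "finite_measure \<mu>" "sets \<mu> = sets borel" "G \<in> sets \<mu>" "0 \<le> s"
    and ball: "\<And>y r. y \<in> G \<Longrightarrow> 0 < r \<Longrightarrow> r \<le> r\<^sub>0 \<Longrightarrow> measure \<mu> (cball y r) \<le> C * r powr s"
    and U: "bounded U" "diameter U < r\<^sub>0"
  shows "emeasure \<mu> (closure U \<inter> G) \<le> ennreal C * diam_power s U"
proof (cases "closure U \<inter> G = {}")
  case False
  then obtain y where y: "y \<in> closure U" "y \<in> G" by blast
  interpret finite_measure \<mu> by fact
  define D where "D = diameter U"
  have "0 \<le> D" "D < r\<^sub>0" using diameter_ge_0[OF U(1)] U(2) by (auto simp: D_def)
  have "0 \<le> C * r\<^sub>0 powr s"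
    using ball[OF y(2), of r\<^sub>0] \<open>0 \<le> D\<close> \<open>D < r\<^sub>0\<close> by (simp add: order_trans[OF measure_nonneg])
  then have "0 \<le> C" using \<open>0 \<le> D\<close> \<open>D < r\<^sub>0\<close> by (simp add: zero_le_mult_iff)
  have closure_subset_cball: "closure U \<inter> G \<subseteq> cball y r" if "D \<le> r" for r
    using diameter_bounded_bound[of "closure U" y] y(1) U(1) that
    by (force simp: D_def diameter_closure bounded_closure)
  have bound: "measure \<mu> (closure U \<inter> G) \<le> C * r powr s" if "D < r" "r \<le> r\<^sub>0" for r
    using finite_measure_mono[OF closure_subset_cball, of r] ball[OF y(2), of r] that \<open>0 \<le> D\<close>
      assms(2) by simp
  have "U \<noteq> {}" using y(1) by auto
  show ?thesis
  proof (cases "s = 0")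
    case True
    then show ?thesis
      using bound[of r\<^sub>0] \<open>U \<noteq> {}\<close> \<open>0 \<le> D\<close> \<open>D < r\<^sub>0\<close>
      by (simp add: diam_power_def emeasure_eq_measure ennreal_leI)
  next
    case False
    have "((\<lambda>r. C * r powr s) \<longlongrightarrow> C * D powr s) (at_right D)"
      using False assms(4) \<open>0 \<le> D\<close>
      by (intro tendsto_intros tendsto_powr' disjI2)
        (auto simp: eventually_at_right_less intro!: eventually_at_rightI[of D "D + 1"])
    moreover have "\<forall>\<^sub>F r in at_right D. measure \<mu> (closure U \<inter> G) \<le> C * r powr s"
      using \<open>D < r\<^sub>0\<close> bound by (intro eventually_at_rightI[of D r\<^sub>0]) auto
    ultimately have "measure \<mu> (closure U \<inter> G) \<le> C * D powr s" by (rule tendsto_lowerbound) simp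
    then show ?thesis
      using False \<open>U \<noteq> {}\<close> \<open>0 \<le> C\<close>
      by (simp add: diam_power_def D_def emeasure_eq_measure ennreal_leI flip: ennreal_mult)
  qed
qed simp

lemma mass_distribution_principle:
  fixes \<mu> :: "'a::euclidean_space measure"
  assumes "finite_measure \<mu>" "sets \<mu> = sets borel" and E: "AE x in \<mu>. x \<in> E"
    and G: "G \<in> sets \<mu>" "measure \<mu> G > 0" and "0 \<le> s" "0 < r\<^sub>0"
    and ball: "\<And>y r. y \<in> G \<Longrightarrow> 0 < r \<Longrightarrow> r \<le> r\<^sub>0 \<Longrightarrow> measure \<mu> (cball y r) \<le> C * r powr s"
  shows "hausdorff_measure s E \<noteq> 0"
proof
  assume null: "hausdorff_measure s E = 0"
  interpret finite_measure \<mu> by fact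
  define \<epsilon> where "\<epsilon> = measure \<mu> G / (\<bar>C\<bar> + 1)"
  have "\<epsilon> > 0" using G(2) by (simp add: \<epsilon>_def)
  have "hausdorff_premeasure s (r\<^sub>0 / 2) E \<le> hausdorff_measure s E"
    unfolding hausdorff_measure_def using \<open>0 < r\<^sub>0\<close> by (intro SUP_upper) auto
  then have "hausdorff_premeasure s (r\<^sub>0 / 2) E < ennreal \<epsilon>" using null \<open>\<epsilon> > 0\<close> by simp
  then obtain U where U: "E \<subseteq> (\<Union>i. U i)" "\<And>i. bounded (U i)" "\<And>i. diameter (U i) \<le> r\<^sub>0 / 2"
    "(\<Sum>i. diam_power s (U i)) < ennreal \<epsilon>" by (rule hausdorff_premeasure_lessE) (rule that)
  have sets: "closure (U i) \<inter> G \<in> sets \<mu>" for i using assms(2) G(1) by auto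
  have "emeasure \<mu> G \<le> emeasure \<mu> (\<Union>i. closure (U i) \<inter> G)"
  proof (rule emeasure_mono_AE)
    show "AE x in \<mu>. x \<in> G \<longrightarrow> x \<in> (\<Union>i. closure (U i) \<inter> G)"
      using E by eventually_elim (use U(1) closure_subset in blast)
    show "(\<Union>i. closure (U i) \<inter> G) \<in> sets \<mu>" using sets by blast
  qed
  also have "\<dots> \<le> (\<Sum>i. emeasure \<mu> (closure (U i) \<inter> G))"
    by (rule emeasure_subadditive_countably) (use sets in auto)
  also have "\<dots> \<le> (\<Sum>i. ennreal C * diam_power s (U i))"
  proof (intro suminf_le summableI)
    show "emeasure \<mu> (closure (U i) \<inter> G) \<le> ennreal C * diam_power s (U i)" for i
      using U(3)[of i] \<open>0 < r\<^sub>0\<close>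
      by (intro emeasure_closure_Int_le_diam_power[OF assms(1,2) G(1) \<open>0 \<le> s\<close> ball U(2)]) auto
  qed
  also have "\<dots> = ennreal C * (\<Sum>i. diam_power s (U i))" by simp
  also have "\<dots> \<le> ennreal \<bar>C\<bar> * ennreal \<epsilon>" using U(4) by (intro mult_mono) (auto intro: ennreal_leI)
  also have "\<dots> = ennreal (\<bar>C\<bar> * \<epsilon>)" using \<open>\<epsilon> > 0\<close> by (simp add: ennreal_mult)
  finally have "measure \<mu> G \<le> \<bar>C\<bar> * \<epsilon>" using \<open>\<epsilon> > 0\<close> by (simp add: emeasure_eq_measure)
  also have "\<dots> < (\<bar>C\<bar> + 1) * \<epsilon>" using \<open>\<epsilon> > 0\<close> by simp
  also have "\<dots> = measure \<mu> G" by (simp add: \<epsilon>_def add_nonneg_eq_0_iff)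
  finally show False by simp
qed

lemma measurable_emeasure_cball:
  fixes \<mu> :: "'a::euclidean_space measure"
  assumes "finite_measure \<mu>" and [measurable_cong]: "sets \<mu> = sets borel"
  shows "(\<lambda>x. emeasure \<mu> (cball x r)) \<in> borel_measurable \<mu>"
proof -
  interpret finite_measure \<mu> by fact
  have "{z \<in> space (\<mu> \<Otimes>\<^sub>M \<mu>). dist (fst z) (snd z) \<le> r} \<in> sets (\<mu> \<Otimes>\<^sub>M \<mu>)" by measurable
  from measurable_emeasure_Pair[OF this] show ?thesis
    using sets_eq_imp_space_eq[OF assms(2)] by (simp add: space_pair_measure cball_def vimage_def)
qed

lemma ex_dyadic_scale:
  fixes r r\<^sub>0 :: real
  assumes "0 < r" "r \<le> r\<^sub>0"
  obtains k where "r \<le> r\<^sub>0 / 2 ^ k" "r\<^sub>0 / 2 ^ k < 2 * r"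
proof -
  define k where "k = nat \<lfloor>log 2 (r\<^sub>0 / r)\<rfloor>"
  have "0 \<le> log 2 (r\<^sub>0 / r)" using assms by (simp add: zero_le_log_cancel_iff)
  then have "\<lfloor>log 2 (r\<^sub>0 / r)\<rfloor> = int k" by (simp add: k_def)
  then have "2 powr real k \<le> r\<^sub>0 / r" "r\<^sub>0 / r < 2 powr (real k + 1)"
    using floor_log_eq_powr_iff[of "r\<^sub>0 / r" 2 "int k"] assms by auto
  then have "2 ^ k \<le> r\<^sub>0 / r" "r\<^sub>0 / r < 2 ^ k * 2" by (simp_all add: powr_add powr_realpow)
  then show ?thesis using assms by (intro that[of k]) (simp_all add: field_simps)
qed

definition dyadic_potential :: "real \<Rightarrow> real \<Rightarrow> 'a::euclidean_space measure \<Rightarrow> 'a \<Rightarrow> ennreal" where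
  "dyadic_potential r\<^sub>0 s \<mu> x =
     (\<Sum>k. ennreal ((r\<^sub>0 / 2 ^ k) powr (- s)) * emeasure \<mu> (cball x (r\<^sub>0 / 2 ^ k)))"

lemma measurable_dyadic_potential:
  assumes "finite_measure \<mu>" "sets \<mu> = sets borel"
  shows "dyadic_potential r\<^sub>0 s \<mu> \<in> borel_measurable \<mu>"
proof -
  note [measurable] = measurable_emeasure_cball[OF assms]
  show ?thesis unfolding dyadic_potential_def[abs_def] by measurable
qed

lemma measure_cball_le_dyadic_potential:
  assumes "finite_measure \<mu>" "0 < r\<^sub>0" "dyadic_potential r\<^sub>0 s \<mu> x \<le> ennreal K" "0 \<le> K"
  shows "measure \<mu> (cball x (r\<^sub>0 / 2 ^ k)) \<le> K * (r\<^sub>0 / 2 ^ k) powr s"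
proof -
  have "ennreal ((r\<^sub>0 / 2 ^ k) powr (- s)) * emeasure \<mu> (cball x (r\<^sub>0 / 2 ^ k)) \<le>
      dyadic_potential r\<^sub>0 s \<mu> x"
    unfolding dyadic_potential_def using sum_le_suminf[OF summableI, of "{k}"] by simp
  also note assms(3)
  finally have "(r\<^sub>0 / 2 ^ k) powr (- s) * measure \<mu> (cball x (r\<^sub>0 / 2 ^ k)) \<le> K"
    using assms(4) by (simp add: finite_measure.emeasure_eq_measure[OF assms(1)] flip: ennreal_mult)
  then show ?thesis using assms(2) by (simp add: powr_minus field_simps)
qed

lemma nn_integral_dyadic_potential_finite:
  fixes \<mu> :: "'a::euclidean_space measure"
  assumes "finite_measure \<mu>" "sets \<mu> = sets borel" "s < t" "0 < r\<^sub>0"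
    and near: "\<And>r. 0 < r \<Longrightarrow> r \<le> r\<^sub>0 \<Longrightarrow> (\<integral>\<^sup>+x. emeasure \<mu> (cball x r) \<partial>\<mu>) \<le> ennreal (C * r powr t)"
  shows "(\<integral>\<^sup>+x. dyadic_potential r\<^sub>0 s \<mu> x \<partial>\<mu>) < \<infinity>"
proof -
  define q where "q = 1 / 2 powr (t - s)"
  have q: "0 < q" "q < 1" using \<open>s < t\<close> by (auto simp: q_def)
  note [measurable] = measurable_emeasure_cball[OF assms(1,2)]
  have "(\<integral>\<^sup>+x. dyadic_potential r\<^sub>0 s \<mu> x \<partial>\<mu>) =
      (\<Sum>k. ennreal ((r\<^sub>0 / 2 ^ k) powr (- s)) * (\<integral>\<^sup>+x. emeasure \<mu> (cball x (r\<^sub>0 / 2 ^ k)) \<partial>\<mu>))"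
    unfolding dyadic_potential_def by (simp add: nn_integral_suminf nn_integral_cmult)
  also have "\<dots> \<le> (\<Sum>k. ennreal (\<bar>C\<bar> * r\<^sub>0 powr (t - s) * q ^ k))"
  proof (intro suminf_le summableI)
    fix k :: nat
    define \<rho> where "\<rho> = r\<^sub>0 / 2 ^ k"
    have \<rho>: "0 < \<rho>" "\<rho> \<le> r\<^sub>0" using \<open>0 < r\<^sub>0\<close> by (auto simp: \<rho>_def divide_simps)
    have "ennreal (\<rho> powr (- s)) * (\<integral>\<^sup>+x. emeasure \<mu> (cball x \<rho>) \<partial>\<mu>) \<le>
        ennreal (\<rho> powr (- s)) * ennreal (\<bar>C\<bar> * \<rho> powr t)"
      by (intro mult_left_mono order_trans[OF near[OF \<rho>]] ennreal_leI mult_right_mono) auto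
    also have "\<dots> = ennreal (\<bar>C\<bar> * (\<rho> powr (- s) * \<rho> powr t))"
      by (simp add: mult_ac flip: ennreal_mult)
    also have "\<rho> powr (- s) * \<rho> powr t = \<rho> powr (t - s)" by (simp flip: powr_add)
    also have "\<rho> powr (t - s) = r\<^sub>0 powr (t - s) * q ^ k"
    proof -
      have "(2 ^ k :: real) powr (t - s) = (2 powr (t - s)) ^ k"
        by (simp add: powr_power powr_realpow[symmetric] powr_powr mult.commute)
      then show ?thesis
        using \<open>0 < r\<^sub>0\<close> by (simp add: \<rho>_def q_def powr_divide power_one_over)
    qed
    finally show
        "ennreal ((r\<^sub>0 / 2 ^ k) powr (- s)) * (\<integral>\<^sup>+x. emeasure \<mu> (cball x (r\<^sub>0 / 2 ^ k)) \<partial>\<mu>) \<le>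
        ennreal (\<bar>C\<bar> * r\<^sub>0 powr (t - s) * q ^ k)" by (simp add: mult.assoc \<rho>_def)
  qed
  also have "\<dots> = ennreal (\<bar>C\<bar> * r\<^sub>0 powr (t - s) * (1 / (1 - q)))"
    using q by (intro suminf_ennreal_eq sums_mult geometric_sums) auto
  finally show ?thesis by (simp add: less_top order_le_less_trans)
qed

lemma (in prob_space) ex_bounded_nn_integral_finite:
  assumes [measurable]: "f \<in> borel_measurable M" and "(\<integral>\<^sup>+x. f x \<partial>M) < \<infinity>"
  obtains G K where "G \<in> events" "prob G > 0" "0 \<le> K" "\<And>x. x \<in> G \<Longrightarrow> f x \<le> ennreal K"
proof -
  obtain I where I: "0 \<le> I" "(\<integral>\<^sup>+x. f x \<partial>M) = ennreal I"
    using assms(2) by (cases "\<integral>\<^sup>+x. f x \<partial>M") auto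
  define G where "G = {x \<in> space M. f x \<le> ennreal (I + 1)}"
  have [measurable]: "G \<in> events" unfolding G_def by measurable
  have "prob G \<noteq> 0"
  proof
    assume "prob G = 0"
    then have "AE x in M. x \<notin> G" by (simp add: prob_eq_0)
    then have "AE x in M. ennreal (I + 1) \<le> f x"
      using AE_space by eventually_elim (auto simp: G_def not_le intro: less_imp_le)
    then have "(\<integral>\<^sup>+x. ennreal (I + 1) \<partial>M) \<le> (\<integral>\<^sup>+x. f x \<partial>M)" by (rule nn_integral_mono_AE)
    then show False using I by (simp add: emeasure_space_1)
  qed
  then have "prob G > 0" by (simp add: zero_less_measure_iff)
  then show ?thesis using I(1) by (intro that[of G "I + 1"]) (auto simp: G_def)
qed

lemma frostman_subset:
  fixes \<mu> :: "'a::euclidean_space measure"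
  assumes "prob_space \<mu>" "sets \<mu> = sets borel" "0 \<le> s" "s < t" "0 < r\<^sub>0"
    and near: "\<And>r. 0 < r \<Longrightarrow> r \<le> r\<^sub>0 \<Longrightarrow> (\<integral>\<^sup>+x. emeasure \<mu> (cball x r) \<partial>\<mu>) \<le> ennreal (C * r powr t)"
  obtains G K where "G \<in> sets \<mu>" "measure \<mu> G > 0"
    "\<And>y r. y \<in> G \<Longrightarrow> 0 < r \<Longrightarrow> r \<le> r\<^sub>0 \<Longrightarrow> measure \<mu> (cball y r) \<le> K * r powr s"
proof -
  interpret prob_space \<mu> by fact
  obtain G K where G: "G \<in> sets \<mu>" "measure \<mu> G > 0" "0 \<le> K"
    "\<And>x. x \<in> G \<Longrightarrow> dyadic_potential r\<^sub>0 s \<mu> x \<le> ennreal K"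
    using measurable_dyadic_potential[OF finite_measure_axioms assms(2)]
      nn_integral_dyadic_potential_finite[OF finite_measure_axioms assms(2,4,5) near]
    by (rule ex_bounded_nn_integral_finite) (assumption | rule that)+
  show ?thesis
  proof (rule that[of G "K * 2 powr s", OF G(1,2)])
    fix y r assume "y \<in> G" "0 < r" "r \<le> r\<^sub>0"
    obtain k where k: "r \<le> r\<^sub>0 / 2 ^ k" "r\<^sub>0 / 2 ^ k < 2 * r"
      using \<open>0 < r\<close> \<open>r \<le> r\<^sub>0\<close> by (rule ex_dyadic_scale)
    have "prob (cball y r) \<le> prob (cball y (r\<^sub>0 / 2 ^ k))"
      using k(1) assms(2) by (intro finite_measure_mono subset_cball) auto
    also have "\<dots> \<le> K * (r\<^sub>0 / 2 ^ k) powr s" 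
      by (rule measure_cball_le_dyadic_potential[OF finite_measure_axioms assms(5) G(4)[OF \<open>y \<in> G\<close>]
          G(3)])
    also have "\<dots> \<le> K * (2 * r) powr s"
      using k \<open>0 < r\<close> G(3) assms(3) by (intro mult_left_mono powr_mono2) auto
    finally show "prob (cball y r) \<le> K * 2 powr s * r powr s"
      using \<open>0 < r\<close> by (simp add: powr_mult mult.assoc)
  qed
qed

lemma cball_subset_bohr_set_Basis:
  fixes r :: real
  assumes "r \<le> \<delta>"
  shows "cball 0 r \<subseteq> bohr_set Basis (\<lambda>b :: 'a::euclidean_space. b) \<delta>"
proof
  fix x :: 'a assume "x \<in> cball 0 r"
  then have "\<bar>x \<bullet> b - of_int 0\<bar> \<le> \<delta>" if "b \<in> Basis" for b
    using Basis_le_norm[OF that, of x] assms by simp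
  then show "x \<in> bohr_set Basis (\<lambda>b. b) \<delta>"
    by (auto simp: bohr_set_def infdist_Ints_le_iff intro!: exI[of _ 0])
qed

definition difference_law :: "'a::euclidean_space measure \<Rightarrow> 'a measure" where
  "difference_law \<mu> = sum_law \<mu> (distr \<mu> borel uminus)"

lemma sets_difference_law [simp]: "sets (difference_law \<mu>) = sets borel"
  by (simp add: difference_law_def)

context
  fixes \<mu> :: "'a::euclidean_space measure"
  assumes prob: "prob_space \<mu>" and borel [measurable_cong]: "sets \<mu> = sets borel"
begin

lemma prob_space_reflected: "prob_space (distr \<mu> borel uminus)"
  by (rule prob_space.prob_space_distr[OF prob]) measurable

lemma prob_space_difference_law: "prob_space (difference_law \<mu>)"
  unfolding difference_law_def by (rule prob_space_sum_law[OF prob prob_space_reflected borel]) simp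

lemma norm_fourier_transform_difference_law:
  "norm (fourier_transform (difference_law \<mu>) \<xi>) = (norm (fourier_transform \<mu> \<xi>))\<^sup>2"
proof -
  have "fourier_transform (distr \<mu> borel uminus) \<xi> = (LINT x|\<mu>. unit_exp (- (- x \<bullet> \<xi>)))"
    unfolding fourier_transform_unit_exp by (rule integral_distr) measurable
  also have "\<dots> = (LINT x|\<mu>. cnj (unit_exp (- (x \<bullet> \<xi>))))" by (simp flip: unit_exp_minus)
  also have "\<dots> = cnj (fourier_transform \<mu> \<xi>)" by (simp add: fourier_transform_unit_exp)
  finally show ?thesis
    by (simp add: difference_law_def fourier_transform_sum_law[OF prob prob_space_reflected borel]
        norm_mult power2_eq_square)
qed

lemma emeasure_difference_law_cball:
  "emeasure (difference_law \<mu>) (cball 0 r) = (\<integral>\<^sup>+x. emeasure \<mu> (cball x r) \<partial>\<mu>)"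
proof -
  have "emeasure (distr \<mu> borel uminus) {y. x + y \<in> cball 0 r} = emeasure \<mu> (cball x r)" for x
  proof -
    have "{y. x + y \<in> cball 0 r} = cball (- x) r"
      by (auto simp: dist_norm norm_minus_commute add.commute)
    then have "emeasure (distr \<mu> borel uminus) {y. x + y \<in> cball 0 r} =
        emeasure \<mu> (uminus -` cball (- x) r \<inter> space \<mu>)"
      by (simp add: emeasure_distr)
    also have "uminus -` cball (- x) r \<inter> space \<mu> = cball x r"
      using sets_eq_imp_space_eq[OF borel] by (auto simp: dist_norm norm_minus_commute)
    finally show ?thesis .
  qed
  then show ?thesis
    by (simp add: difference_law_def emeasure_sum_law[OF prob prob_space_reflected borel])
qed

lemma measure_difference_law_bohr_set_le:
  assumes energy: "lattice_energy_le p (fourier_transform \<mu>) B" and "0 \<le> p" "N > 0"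
  shows "measure (difference_law \<mu>) (bohr_set Basis (\<lambda>b. b) (1 / (8 * real N))) \<le>
    (4 / real N) ^ DIM('a) * (((real DIM('a) + 1) * real N) powr p * B\<^sup>2)"
proof (rule measure_bohr_set_Basis_le)
  let ?X = "(real DIM('a) + 1) * real N"
  fix S :: "'a set" assume S: "finite S" "S \<subseteq> int_lattice" "\<And>v. v \<in> S \<Longrightarrow> \<langle>v\<rangle> \<le> ?X"
  have "(\<Sum>v\<in>S. norm (fourier_transform (difference_law \<mu>) v)) =
      (\<Sum>v\<in>S. \<langle>v\<rangle> powr p * ((norm (fourier_transform \<mu> v))\<^sup>2 * \<langle>v\<rangle> powr (- p)))"
    by (simp add: norm_fourier_transform_difference_law mult.left_commute[of "_ powr p"])
  also have "\<dots> \<le> (\<Sum>v\<in>S. ?X powr p * ((norm (fourier_transform \<mu> v))\<^sup>2 * \<langle>v\<rangle> powr (- p)))"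
    using S(3) assms(2) by (intro sum_mono mult_right_mono powr_mono2) auto
  also have "\<dots> \<le> ?X powr p * B\<^sup>2"
    unfolding sum_distrib_left[symmetric]
    by (intro mult_left_mono lattice_energy_leD[OF energy] S) auto
  finally show "(\<Sum>v\<in>S. norm (fourier_transform (difference_law \<mu>) v)) \<le> ?X powr p * B\<^sup>2" .
qed (use assms(3) prob_space.finite_measure[OF prob_space_difference_law] in
    \<open>auto simp: linear_ident\<close>)

lemma nn_integral_emeasure_cball_le:
  assumes p: "0 \<le> p" "p \<le> real DIM('a)" and energy: "lattice_energy_le p (fourier_transform \<mu>) B"
  obtains C where "\<And>r. 0 < r \<Longrightarrow> r \<le> 1 / 8 \<Longrightarrow>
    (\<integral>\<^sup>+x. emeasure \<mu> (cball x r) \<partial>\<mu>) \<le> ennreal (C * r powr (real DIM('a) - p))"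
proof -
  define m where "m = real DIM('a)"
  interpret difference: prob_space "difference_law \<mu>" by (rule prob_space_difference_law)
  show ?thesis
  proof (rule that[of "4 ^ DIM('a) * ((m + 1) powr p * B\<^sup>2) * 16 powr (m - p)"])
    fix r :: real assume r: "0 < r" "r \<le> 1 / 8"
    then obtain N where N: "N > 0" "r \<le> 1 / (8 * real N)" "1 / real N \<le> 16 * r"
      by (rule ex_nat_inverse_scale)
    have "measure (difference_law \<mu>) (cball 0 r) \<le>
        measure (difference_law \<mu>) (bohr_set Basis (\<lambda>b. b) (1 / (8 * real N)))"
      using cball_subset_bohr_set_Basis[OF N(2)]
      by (intro difference.finite_measure_mono) (auto intro!: borel_closed closed_bohr_set)
    also have "\<dots> \<le> (4 / real N) ^ DIM('a) * (((m + 1) * real N) powr p * B\<^sup>2)"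
      unfolding m_def by (rule measure_difference_law_bohr_set_le[OF energy p(1) N(1)])
    also have "\<dots> = 4 ^ DIM('a) * ((m + 1) powr p * B\<^sup>2) * (1 / real N) powr (m - p)"
      using N(1) by (simp add: powr_mult power_divide powr_diff powr_divide powr_realpow m_def)
    also have "\<dots> \<le> 4 ^ DIM('a) * ((m + 1) powr p * B\<^sup>2) * (16 * r) powr (m - p)"
      using N p by (intro mult_left_mono powr_mono2) (auto simp: m_def)
    finally show "(\<integral>\<^sup>+x. emeasure \<mu> (cball x r) \<partial>\<mu>) \<le>
        ennreal (4 ^ DIM('a) * ((m + 1) powr p * B\<^sup>2) * 16 powr (m - p) *
            r powr (real DIM('a) - p))"
      using r by (simp add: difference.emeasure_eq_measure ennreal_leI powr_mult mult.assoc m_def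
          flip: emeasure_difference_law_cball)
  qed
qed

end

lemma hausdorff_dim_ge_if_lattice_energy_le:
  fixes \<mu> :: "'a::euclidean_space measure"
  assumes "prob_space \<mu>" "sets \<mu> = sets borel" "0 \<le> p" "p \<le> real DIM('a)"
    and "lattice_energy_le p (fourier_transform \<mu>) B" and E: "AE x in \<mu>. x \<in> E"
  shows "real DIM('a) - p \<le> hausdorff_dim E"
  unfolding hausdorff_dim_def
proof (rule cInf_greatest)
  show "{s. 0 \<le> s \<and> hausdorff_measure s E = 0} \<noteq> {}"
    using hausdorff_measure_DIM_plus_1[of E]
    by (intro ex_in_conv[THEN iffD1] exI[of _ "real DIM('a) + 1"]) simp
  obtain C where near: "\<And>r. 0 < r \<Longrightarrow> r \<le> 1 / 8 \<Longrightarrow>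
      (\<integral>\<^sup>+x. emeasure \<mu> (cball x r) \<partial>\<mu>) \<le> ennreal (C * r powr (real DIM('a) - p))"
    by (rule nn_integral_emeasure_cball_le[OF assms(1-5)]) (rule that)
  fix s assume s: "s \<in> {s. 0 \<le> s \<and> hausdorff_measure s E = 0}"
  show "real DIM('a) - p \<le> s"
  proof (rule ccontr)
    assume "\<not> ?thesis"
    then have "s < real DIM('a) - p" by simp
    then obtain G K where G: "G \<in> sets \<mu>" "measure \<mu> G > 0"
      "\<And>y r. y \<in> G \<Longrightarrow> 0 < r \<Longrightarrow> r \<le> 1 / 8 \<Longrightarrow> measure \<mu> (cball y r) \<le> K * r powr s"
      using s near frostman_subset[OF assms(1,2), of s "real DIM('a) - p" "1 / 8" C] by auto
    have "hausdorff_measure s E \<noteq> 0"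
      using s prob_space.finite_measure[OF assms(1)]
      by (intro mass_distribution_principle[OF _ assms(2) E G(1,2) _ _ G(3), of "1 / 8"]) auto
    then show False using s by simp
  qed
qed

section \<open>Modulation by limits of lattice polynomials\<close>

definition modulate :: "('a \<Rightarrow> real) \<Rightarrow> 'a measure \<Rightarrow> 'a measure" where
  "modulate F \<mu> = density \<mu> (\<lambda>x. ennreal (F x))"

lemma sets_modulate [simp]: "sets (modulate F \<mu>) = sets \<mu>"
  by (simp add: modulate_def)

definition fourier_diff :: "'a::euclidean_space measure \<Rightarrow> 'a measure \<Rightarrow> 'a \<Rightarrow> complex" where
  "fourier_diff \<nu> \<mu> \<xi> = fourier_transform \<nu> \<xi> - fourier_transform \<mu> \<xi>"

definition lattice_poly :: "('a::euclidean_space \<Rightarrow> complex) \<Rightarrow> 'a \<Rightarrow> complex" where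
  "lattice_poly b x = (\<Sum>l | b l \<noteq> 0. b l * unit_exp (x \<bullet> l))"

lemma continuous_on_lattice_poly: "continuous_on A (lattice_poly b)"
  unfolding lattice_poly_def[abs_def] by (intro continuous_intros)

definition nonzero_spectrum :: "('a::euclidean_space \<Rightarrow> complex) \<Rightarrow> 'a set" where
  "nonzero_spectrum b = {l. l \<noteq> 0 \<and> b l \<noteq> 0}"

definition spectral_energy :: "real \<Rightarrow> ('a::euclidean_space \<Rightarrow> complex) \<Rightarrow> real" where
  "spectral_energy p b = (\<Sum>l\<in>nonzero_spectrum b. (norm (b l))\<^sup>2 * \<langle>l\<rangle> powr (- p))"

lemma fourier_integral_lattice_poly:
  fixes M :: "'a::euclidean_space measure"
  assumes "finite_measure M" and sets: "sets M = sets borel" and "finite {l. b l \<noteq> 0}" "b 0 = 1"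
  shows "(LINT x|M. lattice_poly b x * unit_exp (- (x \<bullet> \<xi>))) =
    fourier_transform M \<xi> + (\<Sum>l\<in>nonzero_spectrum b. b l * fourier_transform M (\<xi> - l))"
proof -
  interpret finite_measure M by fact
  have integrable: "integrable M (\<lambda>x. b l * unit_exp (- (x \<bullet> (\<xi> - l))))" for l
    by (intro integrable_mult_right integrable_unit_exp) (simp cong: measurable_cong_sets add: sets)
  have "lattice_poly b x * unit_exp (- (x \<bullet> \<xi>)) = (\<Sum>l | b l \<noteq> 0. b l * unit_exp (- (x \<bullet> (\<xi> - l))))"
    for x
    by (simp add: lattice_poly_def sum_distrib_right inner_diff_right unit_exp_add[symmetric]
        mult.assoc)
  then have "(LINT x|M. lattice_poly b x * unit_exp (- (x \<bullet> \<xi>))) =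
      (\<Sum>l | b l \<noteq> 0. b l * fourier_transform M (\<xi> - l))"
    unfolding fourier_transform_unit_exp by (simp add: integrable)
  also have "{l. b l \<noteq> 0} = insert 0 (nonzero_spectrum b)"
    using assms(4) by (auto simp: nonzero_spectrum_def)
  finally show ?thesis using assms by (simp add: nonzero_spectrum_def)
qed

locale lattice_modulation =
  fixes F :: "'a::euclidean_space \<Rightarrow> real" and b :: "nat \<Rightarrow> 'a \<Rightarrow> complex" and B :: real
  assumes continuous: "continuous_on UNIV F" and nonneg: "0 \<le> F x"
    and finite_spectrum: "finite {l. b N l \<noteq> 0}" and spectrum: "{l. b N l \<noteq> 0} \<subseteq> int_lattice"
    and coeff_0: "b N 0 = 1"
    and tendsto: "(\<lambda>N. lattice_poly (b N) x) \<longlonglongrightarrow> of_real (F x)"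
    and bounded: "norm (lattice_poly (b N) x) \<le> B"
begin

lemma nonzero_spectrum: "finite (nonzero_spectrum (b N))" "nonzero_spectrum (b N) \<subseteq> int_lattice"
  using finite_spectrum[of N] spectrum[of N] by (auto simp: nonzero_spectrum_def)

lemma le_bound: "F x \<le> B"
  using Lim_bounded[OF tendsto_norm[OF tendsto[of x]], of 0 B] bounded nonneg[of x] by simp

context
  fixes \<mu> :: "'a measure"
  assumes finite_measure: "finite_measure \<mu>" and sets: "sets \<mu> = sets borel"
begin

lemma borel_measurable_modulation [measurable]: "F \<in> borel_measurable \<mu>"
  using borel_measurable_continuous_onI[OF continuous]
  by (simp add: measurable_cong_sets[OF sets refl])

lemma finite_measure_modulation: "finite_measure (modulate F \<mu>)"
proof
  interpret finite_measure \<mu> by (rule finite_measure)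
  have "emeasure (modulate F \<mu>) (space (modulate F \<mu>)) = (\<integral>\<^sup>+x. ennreal (F x) \<partial>\<mu>)"
    by (simp add: modulate_def emeasure_density)
  also have "\<dots> \<le> (\<integral>\<^sup>+x. ennreal B \<partial>\<mu>)" by (intro nn_integral_mono ennreal_leI le_bound)
  also have "\<dots> < \<top>" by (simp add: ennreal_mult_eq_top_iff flip: less_top)
  finally show "emeasure (modulate F \<mu>) (space (modulate F \<mu>)) \<noteq> \<infinity>" by simp
qed

lemma absolutely_continuous_modulate: "absolutely_continuous \<mu> (modulate F \<mu>)"
  unfolding modulate_def by (rule absolutely_continuousI_density) measurable

lemma AE_modulate_nonzero: "AE x in modulate F \<mu>. F x \<noteq> 0"
  unfolding modulate_def by (subst AE_density) (auto intro: AE_I2)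

lemma fourier_diff_modulate_tendsto:
  "(\<lambda>N. \<Sum>l\<in>nonzero_spectrum (b N). b N l * fourier_transform \<mu> (\<xi> - l)) \<longlonglongrightarrow>
      fourier_diff (modulate F \<mu>) \<mu> \<xi>"
proof -
  interpret finite_measure \<mu> by (rule finite_measure)
  have measurable [measurable]: "continuous_on UNIV g \<Longrightarrow> g \<in> borel_measurable \<mu>"
    for g :: "'a \<Rightarrow> complex"
    using borel_measurable_continuous_onI[of g] by (simp add: measurable_cong_sets[OF sets refl])
  have unit_exp: "continuous_on UNIV (\<lambda>x. unit_exp (- (x \<bullet> \<xi>)))" by (intro continuous_intros)
  have "(\<lambda>N. LINT x|\<mu>. lattice_poly (b N) x * unit_exp (- (x \<bullet> \<xi>))) \<longlonglongrightarrow>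
      (LINT x|\<mu>. of_real (F x) * unit_exp (- (x \<bullet> \<xi>)))"
  proof (rule integral_dominated_convergence[where w = "\<lambda>_. B"])
    show "AE x in \<mu>. (\<lambda>N. lattice_poly (b N) x * unit_exp (- (x \<bullet> \<xi>))) \<longlonglongrightarrow>
        complex_of_real (F x) * unit_exp (- (x \<bullet> \<xi>))"
      by (intro AE_I2 tendsto_intros tendsto)
    show "AE x in \<mu>. norm (lattice_poly (b N) x * unit_exp (- (x \<bullet> \<xi>))) \<le> B" for N
      using bounded by (simp add: norm_mult)
  qed (auto intro!: measurable continuous_intros continuous continuous_on_lattice_poly)
  also have "(LINT x|\<mu>. of_real (F x) * unit_exp (- (x \<bullet> \<xi>))) = fourier_transform (modulate F \<mu>) \<xi>"
    unfolding fourier_transform_unit_exp modulate_def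
    using measurable[OF unit_exp] nonneg
    by (subst integral_density) (auto simp: scaleR_conv_of_real)
  finally have
      "(\<lambda>N. fourier_transform \<mu> \<xi> +
          (\<Sum>l\<in>nonzero_spectrum (b N). b N l * fourier_transform \<mu> (\<xi> - l)))
      \<longlonglongrightarrow> fourier_transform (modulate F \<mu>) \<xi>"
    by (simp add: fourier_integral_lattice_poly[OF finite_measure sets finite_spectrum coeff_0])
  from tendsto_diff[OF this tendsto_const[of "fourier_transform \<mu> \<xi>"]] show ?thesis
    by (simp add: fourier_diff_def)
qed

context
  fixes C A :: real
  assumes decay: "decay_bound C A (fourier_transform \<mu>)"
begin

lemma norm_spectral_sum_le:
  "norm (\<Sum>l\<in>nonzero_spectrum (b N). b N l * fourier_transform \<mu> (\<xi> - l)) \<le>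
    C * (\<Sum>l\<in>nonzero_spectrum (b N). norm (b N l) * \<langle>\<xi> - l\<rangle> powr (- A))"
  unfolding sum_distrib_left
proof (intro order_trans[OF norm_sum] sum_mono)
  fix l
  have "norm (b N l) * norm (fourier_transform \<mu> (\<xi> - l)) \<le> norm (b N l) * (C * \<langle>\<xi> - l\<rangle> powr (- A))"
    by (intro mult_left_mono decay_boundD[OF decay]) auto
  then show "norm (b N l * fourier_transform \<mu> (\<xi> - l)) \<le> C * (norm (b N l) * \<langle>\<xi> - l\<rangle> powr (- A))"
    by (simp add: norm_mult mult_ac)
qed

lemma decay_bound_fourier_diff_modulate:
  assumes coeff: "\<And>N l. l \<noteq> 0 \<Longrightarrow> norm (b N l) \<le> \<theta> * \<langle>l\<rangle> powr (- t)" and "0 \<le> \<theta>"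
    and convolution: "\<And>L (\<xi>::'a). finite L \<Longrightarrow> L \<subseteq> int_lattice \<Longrightarrow>
      (\<Sum>l\<in>L. \<langle>l\<rangle> powr (- t) * \<langle>\<xi> - l\<rangle> powr (- A)) \<le> \<Lambda> * \<langle>\<xi>\<rangle> powr (- a)"
  shows "decay_bound (C * \<theta> * \<Lambda>) a (fourier_diff (modulate F \<mu>) \<mu>)"
proof (rule decay_bound_lim[OF decay_boundI fourier_diff_modulate_tendsto])
  fix N \<xi>
  have "0 \<le> C" using decay by (rule decay_bound_const_nonneg)
  have "norm (\<Sum>l\<in>nonzero_spectrum (b N). b N l * fourier_transform \<mu> (\<xi> - l)) \<le>
      C * (\<Sum>l\<in>nonzero_spectrum (b N). norm (b N l) * \<langle>\<xi> - l\<rangle> powr (- A))"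
    by (rule norm_spectral_sum_le)
  also have "\<dots> \<le> C * (\<Sum>l\<in>nonzero_spectrum (b N). \<theta> * \<langle>l\<rangle> powr (- t) * \<langle>\<xi> - l\<rangle> powr (- A))"
    using \<open>0 \<le> C\<close>
    by (intro mult_left_mono sum_mono mult_right_mono coeff) (auto simp: nonzero_spectrum_def)
  also have "\<dots> = C * (\<theta> * (\<Sum>l\<in>nonzero_spectrum (b N). \<langle>l\<rangle> powr (- t) * \<langle>\<xi> - l\<rangle> powr (- A)))"
    by (simp add: sum_distrib_left mult.assoc)
  also have "\<dots> \<le> C * (\<theta> * (\<Lambda> * \<langle>\<xi>\<rangle> powr (- a)))"
    using \<open>0 \<le> C\<close> \<open>0 \<le> \<theta>\<close> by (intro mult_left_mono convolution nonzero_spectrum)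
  finally show "norm (\<Sum>l\<in>nonzero_spectrum (b N). b N l * fourier_transform \<mu> (\<xi> - l)) \<le>
      C * \<theta> * \<Lambda> * \<langle>\<xi>\<rangle> powr (- a)" by (simp add: mult.assoc)
qed

lemma lattice_energy_le_fourier_diff_modulate:
  assumes energy: "\<And>N. spectral_energy p (b N) \<le> E\<^sup>2"
    and convolution: "\<And>L T (b :: 'a \<Rightarrow> real). finite L \<Longrightarrow> L \<subseteq> int_lattice \<Longrightarrow> finite T \<Longrightarrow>
        T \<subseteq> int_lattice \<Longrightarrow>
      (\<Sum>\<xi>\<in>T. (\<Sum>l\<in>L. b l * \<langle>\<xi> - l\<rangle> powr (- A))\<^sup>2 * \<langle>\<xi>\<rangle> powr (- p)) \<le>
          \<Lambda>\<^sup>2 * (\<Sum>l\<in>L. (b l)\<^sup>2 * \<langle>l\<rangle> powr (- p))"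
  shows "lattice_energy_le p (fourier_diff (modulate F \<mu>) \<mu>) (C * \<Lambda> * E)"
proof (rule lattice_energy_le_lim[OF lattice_energy_leI fourier_diff_modulate_tendsto])
  fix N and T :: "'a set" assume T: "finite T" "T \<subseteq> int_lattice"
  let ?g = "\<lambda>\<xi>. \<Sum>l\<in>nonzero_spectrum (b N). norm (b N l) * \<langle>\<xi> - l\<rangle> powr (- A)"
  have "(\<Sum>\<xi>\<in>T. (norm (\<Sum>l\<in>nonzero_spectrum (b N). b N l * fourier_transform \<mu> (\<xi> - l)))\<^sup>2 *
      \<langle>\<xi>\<rangle> powr (- p)) \<le>
      (\<Sum>\<xi>\<in>T. (C * ?g \<xi>)\<^sup>2 * \<langle>\<xi>\<rangle> powr (- p))"
    by (intro sum_mono mult_right_mono power_mono norm_spectral_sum_le) auto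
  also have "\<dots> = C\<^sup>2 * (\<Sum>\<xi>\<in>T. (?g \<xi>)\<^sup>2 * \<langle>\<xi>\<rangle> powr (- p))"
    by (simp only: power_mult_distrib mult.assoc sum_distrib_left[of _ _ T])
  also have "\<dots> \<le> C\<^sup>2 * (\<Lambda>\<^sup>2 * spectral_energy p (b N))"
    unfolding spectral_energy_def by (intro mult_left_mono convolution nonzero_spectrum T) simp
  also have "\<dots> \<le> C\<^sup>2 * (\<Lambda>\<^sup>2 * E\<^sup>2)" by (intro mult_left_mono energy) auto
  finally show
      "(\<Sum>\<xi>\<in>T. (norm (\<Sum>l\<in>nonzero_spectrum (b N). b N l * fourier_transform \<mu> (\<xi> - l)))\<^sup>2 *
          \<langle>\<xi>\<rangle> powr (- p)) \<le>
      (C * \<Lambda> * E)\<^sup>2" by (simp add: power_mult_distrib mult.assoc)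
qed

end

end

end

lemma decaying_measure_modulate:
  fixes \<mu> :: "'a::euclidean_space measure"
  assumes modulation: "lattice_modulation F b B" and \<mu>: "decaying_measure R A \<mu>" and "0 \<le> A"
    and "0 \<le> V" "\<And>N l. l \<noteq> 0 \<Longrightarrow> norm (b N l) \<le> V * \<langle>l\<rangle> powr (- (A + real DIM('a) + 1))"
  shows "decaying_measure R A (modulate F \<mu>)"
proof -
  interpret lattice_modulation F b B by (rule modulation)
  obtain C where finite: "finite_measure \<mu>" and sets: "sets \<mu> = sets borel"
    and bounded: "AE x in \<mu>. norm x \<le> R"
    and C: "decay_bound C A (fourier_transform \<mu>)" using \<mu> by (auto simp: decaying_measure_def)
  have "A + real DIM('a) + 1 > A + real DIM('a)" by simp
  then obtain \<Lambda> where \<Lambda>: "\<And>L (\<xi>::'a). finite L \<Longrightarrow> L \<subseteq> int_lattice \<Longrightarrow>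
      (\<Sum>l\<in>L. \<langle>l\<rangle> powr (- (A + real DIM('a) + 1)) * \<langle>\<xi> - l\<rangle> powr (- A)) \<le> \<Lambda> * \<langle>\<xi>\<rangle> powr (- A)"
    by (rule lattice_convolution_bound[OF \<open>0 \<le> A\<close>]) (rule that)
  have "decay_bound (C * V * \<Lambda>) A (fourier_diff (modulate F \<mu>) \<mu>)"
    by (rule decay_bound_fourier_diff_modulate[OF finite sets C assms(5,4) \<Lambda>])
  from decay_bound_add[OF C this] have
      "decay_bound (C + C * V * \<Lambda>) A (fourier_transform (modulate F \<mu>))"
    by (simp add: fourier_diff_def)
  moreover have "AE x in modulate F \<mu>. norm x \<le> R"
    by (rule absolutely_continuous_AE[OF _ absolutely_continuous_modulate[OF finite sets] bounded])
      simp
  ultimately show ?thesis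
    using finite_measure_modulation[OF finite sets] sets by (auto simp: decaying_measure_def)
qed

definition small_coeffs :: "real \<Rightarrow> real \<Rightarrow> real \<Rightarrow> ('a::euclidean_space \<Rightarrow> complex) \<Rightarrow> bool" where
  "small_coeffs a p \<theta> b \<longleftrightarrow> (\<forall>l. l \<noteq> 0 \<longrightarrow> norm (b l) \<le> \<theta> * \<langle>l\<rangle> powr (- a)) \<and>
     spectral_energy p b \<le> \<theta>\<^sup>2"

lemma small_modulation_perturbation:
  fixes \<mu> :: "'a::euclidean_space measure"
  assumes finite: "finite_measure \<mu>" and sets: "sets \<mu> = sets borel"
    and C: "decay_bound C A (fourier_transform \<mu>)"
    and "0 \<le> a" "0 \<le> p" "a + real DIM('a) < A" "p + real DIM('a) < A" "0 < \<eta>"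
  obtains \<theta> where "\<theta> > 0" and "\<And>F b B. lattice_modulation F b B \<Longrightarrow> \<forall>N. small_coeffs a p \<theta> (b N) \<Longrightarrow>
    decay_bound \<eta> a (fourier_diff (modulate F \<mu>) \<mu>) \<and>
        lattice_energy_le p (fourier_diff (modulate F \<mu>) \<mu>) \<eta>"
proof -
  obtain \<Lambda>\<^sub>a where \<Lambda>a: "\<Lambda>\<^sub>a > 0" "\<And>L (\<xi>::'a). finite L \<Longrightarrow> L \<subseteq> int_lattice \<Longrightarrow>
      (\<Sum>l\<in>L. \<langle>l\<rangle> powr (- a) * \<langle>\<xi> - l\<rangle> powr (- A)) \<le> \<Lambda>\<^sub>a * \<langle>\<xi>\<rangle> powr (- a)"
    by (rule lattice_convolution_bound[OF assms(4,6)]) (rule that)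
  obtain \<Lambda>\<^sub>p where \<Lambda>p: "\<Lambda>\<^sub>p > 0" "\<And>L T (b :: 'a \<Rightarrow> real).
      finite L \<Longrightarrow> L \<subseteq> int_lattice \<Longrightarrow> finite T \<Longrightarrow> T \<subseteq> int_lattice \<Longrightarrow>
      (\<Sum>\<xi>\<in>T. (\<Sum>l\<in>L. b l * \<langle>\<xi> - l\<rangle> powr (- A))\<^sup>2 * \<langle>\<xi>\<rangle> powr (- p)) \<le>
          \<Lambda>\<^sub>p\<^sup>2 * (\<Sum>l\<in>L. (b l)\<^sup>2 * \<langle>l\<rangle> powr (- p))"
    by (rule lattice_convolution_square_sum[OF assms(5,7)]) (rule that)
  have "0 \<le> C" using C by (rule decay_bound_const_nonneg)
  define \<theta> where "\<theta> = \<eta> / ((C + 1) * (\<Lambda>\<^sub>a + \<Lambda>\<^sub>p))"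
  have "\<theta> > 0" using \<open>0 < \<eta>\<close> \<open>0 \<le> C\<close> \<Lambda>a(1) \<Lambda>p(1) by (simp add: \<theta>_def)
  have small: "C * \<theta> * \<Lambda> \<le> \<eta>" if "0 \<le> \<Lambda>" "\<Lambda> \<le> \<Lambda>\<^sub>a + \<Lambda>\<^sub>p" for \<Lambda>
  proof -
    have "C * \<Lambda> \<le> (C + 1) * (\<Lambda>\<^sub>a + \<Lambda>\<^sub>p)" using \<open>0 \<le> C\<close> that by (intro mult_mono) auto
    then have "\<theta> * (C * \<Lambda>) \<le> \<theta> * ((C + 1) * (\<Lambda>\<^sub>a + \<Lambda>\<^sub>p))" using \<open>\<theta> > 0\<close> by simp
    also have "\<dots> = \<eta>" using \<open>0 \<le> C\<close> \<Lambda>a(1) \<Lambda>p(1) by (simp add: \<theta>_def)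
    finally show ?thesis by (simp add: mult_ac)
  qed
  show ?thesis
  proof (rule that[OF \<open>\<theta> > 0\<close>], rule conjI)
    fix F :: "'a \<Rightarrow> real" and b B
    assume modulation: "lattice_modulation F b B" and "\<forall>N. small_coeffs a p \<theta> (b N)"
    then have b: "l \<noteq> 0 \<Longrightarrow> norm (b N l) \<le> \<theta> * \<langle>l\<rangle> powr (- a)"
      and energy: "spectral_energy p (b N) \<le> \<theta>\<^sup>2" for N l
      by (auto simp: small_coeffs_def)
    interpret lattice_modulation F b B by (rule modulation)
    have "decay_bound (C * \<theta> * \<Lambda>\<^sub>a) a (fourier_diff (modulate F \<mu>) \<mu>)"
      using \<open>\<theta> > 0\<close> by (intro decay_bound_fourier_diff_modulate[OF finite sets C b _ \<Lambda>a(2)]) auto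
    then show "decay_bound \<eta> a (fourier_diff (modulate F \<mu>) \<mu>)"
      by (rule decay_bound_weaken) (use small[of \<Lambda>\<^sub>a] \<Lambda>a(1) \<Lambda>p(1) in auto)
    have "lattice_energy_le p (fourier_diff (modulate F \<mu>) \<mu>) (C * \<Lambda>\<^sub>p * \<theta>)"
      by (rule lattice_energy_le_fourier_diff_modulate[OF finite sets C energy \<Lambda>p(2)])
    then show "lattice_energy_le p (fourier_diff (modulate F \<mu>) \<mu>) \<eta>"
      by (rule lattice_energy_le_weaken)
        (use small[of \<Lambda>\<^sub>p] \<Lambda>a(1) \<Lambda>p(1) \<open>0 \<le> C\<close> \<open>\<theta> > 0\<close> in \<open>auto simp: mult_ac\<close>)
  qed
qed

section \<open>Averaging over a box of denominators\<close>

definition vec_box :: "('k \<Rightarrow> int set) \<Rightarrow> (int ^ 'k) set" where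
  "vec_box S = {v. \<forall>i. v $ i \<in> S i}"

lemma vec_box_image: "vec_box S = vec_lambda ` PiE UNIV S"
  by (auto simp: vec_box_def image_iff PiE_def intro!: bexI[of _ "vec_nth _"] split: if_splits)

lemma inj_vec_lambda: "inj_on vec_lambda A"
  by (auto simp: inj_on_def vec_lambda_inject)

lemma finite_vec_box: "(\<And>i. finite (S i)) \<Longrightarrow> finite (vec_box S)"
  unfolding vec_box_image by (intro finite_imageI finite_PiE) auto

lemma card_vec_box: "card (vec_box S :: (int ^ 'k) set) = (\<Prod>i\<in>UNIV. card (S i))"
  unfolding vec_box_image by (simp add: card_image inj_vec_lambda card_PiE)

lemma prod_sum_vec_box:
  fixes f :: "'k::finite \<Rightarrow> int \<Rightarrow> 'b::comm_semiring_1"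
  assumes "\<And>i. finite (S i)"
  shows "(\<Prod>i\<in>UNIV. \<Sum>k\<in>S i. f i k) = (\<Sum>v\<in>vec_box S. \<Prod>i\<in>UNIV. f i (v $ i))"
  unfolding vec_box_image using assms by (simp add: sum.reindex inj_vec_lambda prod_sum_PiE)

definition denominators :: "nat \<Rightarrow> (int ^ 'd) set" where
  "denominators M = vec_box (\<lambda>_. {int M..<2 * int M})"

lemma finite_denominators: "finite (denominators M)"
  unfolding denominators_def by (intro finite_vec_box) simp

lemma card_denominators: "card (denominators M :: (int ^ 'd) set) = M ^ CARD('d)"
  by (simp add: denominators_def card_vec_box)

lemma denominators_component: "q \<in> denominators M \<Longrightarrow> int M \<le> q $ j \<and> q $ j < 2 * int M"
  by (simp add: denominators_def vec_box_def)

lemma denominators_component_pos: "q \<in> denominators M \<Longrightarrow> M > 0 \<Longrightarrow> 0 < q $ j"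
  using denominators_component[of q M j] by linarith

lemma denominators_real_vec_bounds:
  assumes "q \<in> denominators M"
  shows "real M \<le> real_vec q $ j" "real_vec q $ j \<le> 2 * real M"
proof -
  have "real_of_int (int M) \<le> real_of_int (q $ j)" "real_of_int (q $ j) \<le> real_of_int (2 * int M)"
    using denominators_component[OF assms, of j] unfolding of_int_le_iff by simp_all
  then show "real M \<le> real_vec q $ j" "real_vec q $ j \<le> 2 * real M" by (simp_all add: real_vec_def)
qed

lemma norm_denominators_ge:
  assumes "q \<in> denominators M"
  shows "real M \<le> norm (real_vec q)"
  using denominators_real_vec_bounds(1)[OF assms] component_le_norm_cart[of "real_vec q"]
  by (meson abs_ge_self order_trans)

lemma norm_denominators_le:
  assumes "q \<in> denominators M"
  shows "norm (real_vec q :: real ^ 'd) \<le> 2 * real CARD('d) * real M"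
proof -
  have "norm (real_vec q :: real ^ 'd) \<le> (\<Sum>j\<in>UNIV. \<bar>real_vec q $ j\<bar>)" by (rule norm_le_l1_cart)
  also have "\<dots> \<le> (\<Sum>j\<in>(UNIV::'d set). 2 * real M)"
  proof (rule sum_mono)
    fix j show "\<bar>real_vec q $ j\<bar> \<le> 2 * real M"
      using denominators_real_vec_bounds[OF assms, of j] by linarith
  qed
  finally show ?thesis by simp
qed

definition outer_freq :: "(int ^ 'd) \<times> (int ^ 'n) \<Rightarrow> real ^ 'd ^ 'n" where
  "outer_freq z = outer (real_vec (snd z)) (real_vec (fst z))"

lemma outer_freq_component: "outer_freq z $ i $ j = of_int (snd z $ i * fst z $ j)"
  by (simp add: outer_freq_def outer_component real_vec_def)

lemma inner_outer_freq: "x \<bullet> outer_freq (q, k) = (\<Sum>i\<in>UNIV. of_int (k $ i) * (x *v real_vec q) $ i)"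
  unfolding outer_freq_def inner_outer fst_conv snd_conv
  by (subst inner_vec_def) (simp add: real_vec_def)

lemma outer_freq_int_lattice: "outer_freq z \<in> int_lattice"
  by (auto simp: int_lattice_def Basis_vec_def inner_axis outer_freq_component)

lemma norm_outer_freq: "norm (outer_freq z) = norm (real_vec (snd z)) * norm (real_vec (fst z))"
  by (simp add: outer_freq_def norm_outer)

definition frequency_pairs :: "nat \<Rightarrow> (int \<Rightarrow> complex) \<Rightarrow> ((int ^ 'd) \<times> (int ^ 'n)) set" where
  "frequency_pairs M c = denominators M \<times> vec_box (\<lambda>_. {k. c k \<noteq> 0})"

lemma finite_frequency_pairs: "finite {k. c k \<noteq> 0} \<Longrightarrow> finite (frequency_pairs M c)"
  unfolding frequency_pairs_def
  by (intro finite_cartesian_product finite_denominators finite_vec_box)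

abbreviation frequency_fibre ::
    "nat \<Rightarrow> (int \<Rightarrow> complex) \<Rightarrow> real ^ 'd ^ 'n \<Rightarrow> ((int ^ 'd) \<times> (int ^ 'n)) set" where
  "frequency_fibre M c l \<equiv> {z. z \<in> frequency_pairs M c \<and> outer_freq z = l}"

abbreviation mode_coeff :: "(int \<Rightarrow> complex) \<Rightarrow> int ^ 'n \<Rightarrow> complex" where
  "mode_coeff c k \<equiv> \<Prod>i\<in>UNIV. c (k $ i)"

definition outer_coeff :: "nat \<Rightarrow> (int \<Rightarrow> complex) \<Rightarrow> real ^ 'd ^ 'n \<Rightarrow> complex" where
  "outer_coeff M c l = (\<Sum>z\<in>frequency_fibre M c l. mode_coeff c (snd z)) / of_nat (M ^ CARD('d))"

lemma outer_coeff_support: "{l. outer_coeff M c l \<noteq> 0} \<subseteq> outer_freq ` frequency_pairs M c"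
proof
  fix l :: "real ^ 'd ^ 'n" assume "l \<in> {l. outer_coeff M c l \<noteq> 0}"
  then have "(\<Sum>z\<in>frequency_fibre M c l. mode_coeff c (snd z)) \<noteq> 0"
    by (auto simp: outer_coeff_def)
  then obtain z where "z \<in> frequency_fibre M c l"
    by (rule sum.not_neutral_contains_not_neutral)
  then show "l \<in> outer_freq ` frequency_pairs M c" by auto
qed

lemma lattice_poly_outer_coeff:
  fixes x :: "real ^ 'd ^ 'n"
  assumes finite: "finite {k. c k \<noteq> 0}"
  shows "lattice_poly (outer_coeff M c) x =
    (\<Sum>q\<in>denominators M. \<Prod>i\<in>UNIV. trig_poly c ((x *v real_vec q) $ i)) / of_nat (M ^ CARD('d))"
proof -
  let ?Z = "frequency_pairs M c :: ((int ^ 'd) \<times> (int ^ 'n)) set"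
  have finite_Z: "finite ?Z" using finite by (rule finite_frequency_pairs)
  have "(\<Prod>i\<in>UNIV. trig_poly c ((x *v real_vec q) $ i)) =
      (\<Sum>k\<in>vec_box (\<lambda>_. {k. c k \<noteq> 0}). mode_coeff c k * unit_exp (x \<bullet> outer_freq (q, k)))"
        for q :: "int ^ 'd"
    unfolding trig_poly_def prod_sum_vec_box[OF finite]
    by (simp add: prod.distrib inner_outer_freq unit_exp_sum)
  then have "(\<Sum>q\<in>denominators M. \<Prod>i\<in>UNIV. trig_poly c ((x *v real_vec q) $ i)) =
      (\<Sum>z\<in>?Z. mode_coeff c (snd z) * unit_exp (x \<bullet> outer_freq z))"
    by (simp add: frequency_pairs_def sum.cartesian_product case_prod_unfold)
  also have "\<dots> =
      (\<Sum>l\<in>outer_freq ` ?Z. \<Sum>z\<in>frequency_fibre M c l. mode_coeff c (snd z) *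
          unit_exp (x \<bullet> outer_freq z))"
    using finite_Z by (rule sum.image_gen)
  also have "\<dots> =
      (\<Sum>l\<in>outer_freq ` ?Z. (\<Sum>z\<in>frequency_fibre M c l. mode_coeff c (snd z)) * unit_exp (x \<bullet> l))"
    by (simp add: sum_distrib_right)
  finally have
      "(\<Sum>q\<in>denominators M. \<Prod>i\<in>UNIV. trig_poly c ((x *v real_vec q) $ i)) / of_nat (M ^ CARD('d)) =
      (\<Sum>l\<in>outer_freq ` ?Z. outer_coeff M c l * unit_exp (x \<bullet> l))"
    unfolding outer_coeff_def times_divide_eq_left sum_divide_distrib[symmetric] by simp
  also have "\<dots> = lattice_poly (outer_coeff M c) x"
    unfolding lattice_poly_def using outer_coeff_support finite_Z
    by (intro sum.mono_neutral_right) auto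
  finally show ?thesis by simp
qed

lemma outer_coeff_0:
  assumes "finite {k. c k \<noteq> 0}" "c 0 = 1" "M > 0"
  shows "outer_coeff M c (0 :: real ^ 'd ^ 'n) = 1"
proof -
  have "real_vec q \<noteq> 0" if "q \<in> denominators M" for q :: "int ^ 'd"
    using denominators_component_pos[OF that assms(3), of undefined] by auto
  then have "frequency_fibre M c (0 :: real ^ 'd ^ 'n) = denominators M \<times> {0}"
    using assms(2) by (auto simp: frequency_pairs_def outer_freq_def outer_eq_0_iff vec_box_def)
  moreover have "(\<Sum>z\<in>(denominators M :: (int ^ 'd) set) \<times> {0 :: int ^ 'n}. mode_coeff c (snd z)) =
      of_nat (card (denominators M :: (int ^ 'd) set))"
    using assms(2) by (simp add: sum.cartesian_product' sum.neutral_const)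
  ultimately show ?thesis using assms(3) by (simp add: outer_coeff_def card_denominators)
qed

lemma norm_lattice_poly_outer_coeff_le:
  fixes x :: "real ^ 'd ^ 'n"
  assumes "finite {k. c k \<noteq> 0}" "M > 0" and bound: "\<And>t. norm (trig_poly c t) \<le> B"
  shows "norm (lattice_poly (outer_coeff M c) x) \<le> B ^ CARD('n)"
proof -
  have "norm (\<Prod>i\<in>UNIV. trig_poly c ((x *v real_vec q) $ i)) \<le> B ^ CARD('n)" for q :: "int ^ 'd"
    using prod_mono[of "UNIV :: 'n set" "\<lambda>i. norm (trig_poly c ((x *v real_vec q) $ i))" "\<lambda>_. B"]
      bound
    by (simp add: prod_norm)
  then have "norm (\<Sum>q\<in>(denominators M :: (int ^ 'd) set). \<Prod>i\<in>UNIV.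
      trig_poly c ((x *v real_vec q) $ i)) \<le>
      real (M ^ CARD('d)) * B ^ CARD('n)"
    using sum_norm_bound[of "denominators M :: (int ^ 'd) set"]
      card_denominators[where ?'d = 'd, of M] by metis
  then show ?thesis
    using assms(2)
    by (simp add: lattice_poly_outer_coeff[OF assms(1)] norm_divide norm_power divide_simps
        mult.commute)
qed

definition denominator_nbhd :: "real \<Rightarrow> nat \<Rightarrow> (real ^ 'd ^ 'n) set" where
  "denominator_nbhd \<delta> M = (\<Union>q\<in>denominators M. resonant_nbhd (real_vec q) \<delta>)"

lemma closed_denominator_nbhd: "closed (denominator_nbhd \<delta> M)"
  unfolding denominator_nbhd_def by (intro closed_UN finite_denominators ballI closed_resonant_nbhd)

definition denominator_average :: "(real \<Rightarrow> real) \<Rightarrow> nat \<Rightarrow> real ^ 'd ^ 'n \<Rightarrow> real" where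
  "denominator_average \<psi> M x =
     (\<Sum>q\<in>denominators M. \<Prod>i\<in>UNIV. \<psi> ((x *v real_vec q) $ i)) / real (M ^ CARD('d))"

lemma continuous_on_denominator_average:
  assumes "continuous_on UNIV \<psi>" "M > 0"
  shows "continuous_on UNIV (denominator_average \<psi> M)"
  unfolding denominator_average_def[abs_def] using assms(2)
  by (intro continuous_intros
      continuous_on_compose2[OF assms(1) continuous_on_matrix_vector_component]) auto

lemma denominator_average_nonneg: "(\<And>t. 0 \<le> \<psi> t) \<Longrightarrow> 0 \<le> denominator_average \<psi> M x"
  unfolding denominator_average_def by (intro divide_nonneg_nonneg sum_nonneg prod_nonneg) auto

lemma denominator_average_support:
  fixes x :: "real ^ 'd ^ 'n"
  assumes "\<And>t. \<psi> t \<noteq> 0 \<Longrightarrow> infdist t \<int> \<le> \<delta>" and nonzero: "denominator_average \<psi> M x \<noteq> 0"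
  shows "x \<in> denominator_nbhd \<delta> M"
proof -
  have "(\<Sum>q\<in>(denominators M :: (int ^ 'd) set). \<Prod>i\<in>UNIV. \<psi> ((x *v real_vec q) $ i)) \<noteq> 0"
    using nonzero by (auto simp: denominator_average_def)
  then obtain q :: "int ^ 'd" where q: "q \<in> denominators M"
      "(\<Prod>i\<in>UNIV. \<psi> ((x *v real_vec q) $ i)) \<noteq> 0"
    by (rule sum.not_neutral_contains_not_neutral)
  then have "\<psi> ((x *v real_vec q) $ i) \<noteq> 0" for i by (simp add: prod_zero_iff)
  then show ?thesis using assms(1) q(1) by (auto simp: denominator_nbhd_def resonant_nbhd_def)
qed

lemma ex_lattice_modulation:
  assumes "0 < \<delta>" "\<delta> \<le> 1" "K > 0" "M > 0"
  obtains F :: "real ^ 'd ^ 'n \<Rightarrow> real" and c B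
  where "lattice_modulation F (\<lambda>N. outer_coeff M (c N)) B" "\<And>N. bump_coeffs K \<delta> (c N)"
    and "\<And>x. F x \<noteq> 0 \<Longrightarrow> x \<in> denominator_nbhd \<delta> M"
proof -
  obtain \<psi> :: "real \<Rightarrow> real" and c B
    where \<psi>: "continuous_on UNIV \<psi>" "\<And>t. 0 \<le> \<psi> t" "\<And>t. \<psi> t \<noteq> 0 \<Longrightarrow> infdist t \<int> \<le> \<delta>"
      and c: "\<And>N. bump_coeffs K \<delta> (c N)" "\<And>t. (\<lambda>N. trig_poly (c N) t) \<longlonglongrightarrow> of_real (\<psi> t)"
        "\<And>N t. norm (trig_poly (c N) t) \<le> B"
    by (rule periodic_bump[OF assms(1-3)]) (rule that)
  have coeffs: "finite {k. c N k \<noteq> 0}" "c N 0 = 1" for N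
    using c(1)[of N] by (auto simp: bump_coeffs_def)
  define F :: "real ^ 'd ^ 'n \<Rightarrow> real" where "F = denominator_average \<psi> M"
  have "lattice_modulation F (\<lambda>N. outer_coeff M (c N)) (B ^ CARD('n))"
  proof
    show "continuous_on UNIV F" unfolding F_def
      by (intro continuous_on_denominator_average \<psi>(1) assms(4))
    show "0 \<le> F x" for x unfolding F_def by (intro denominator_average_nonneg \<psi>(2))
    show "finite {l :: real ^ 'd ^ 'n. outer_coeff M (c N) l \<noteq> 0}" for N
      by (rule finite_subset[OF outer_coeff_support])
        (intro finite_imageI finite_frequency_pairs coeffs(1))
    show "{l :: real ^ 'd ^ 'n. outer_coeff M (c N) l \<noteq> 0} \<subseteq> int_lattice" for N
      using outer_coeff_support outer_freq_int_lattice by fastforce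
    show "outer_coeff M (c N) (0 :: real ^ 'd ^ 'n) = 1" for N
      by (intro outer_coeff_0 coeffs assms(4))
    show "(\<lambda>N. lattice_poly (outer_coeff M (c N)) x) \<longlonglongrightarrow> of_real (F x)" for x
      unfolding lattice_poly_outer_coeff[OF coeffs(1)] F_def denominator_average_def
        of_real_divide of_real_sum of_real_prod of_real_of_nat_eq
      using assms(4) by (intro tendsto_intros c(2)) auto
    show "norm (lattice_poly (outer_coeff M (c N)) x) \<le> B ^ CARD('n)" for N
      and x :: "real ^ 'd ^ 'n"
      by (intro norm_lattice_poly_outer_coeff_le coeffs assms(4) c(3))
  qed
  then show ?thesis
    using c(1) denominator_average_support[OF \<psi>(3)] unfolding F_def by (rule that)
qed

definition approx_radius :: "real \<Rightarrow> nat \<Rightarrow> real" where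
  "approx_radius \<tau> M = (2 * real M) powr (- \<tau>) / 2"

lemma approx_radius_pos: "M > 0 \<Longrightarrow> 0 < approx_radius \<tau> M"
  by (simp add: approx_radius_def)

lemma approx_radius_le_1:
  assumes "M > 0" "0 \<le> \<tau>"
  shows "approx_radius \<tau> M \<le> 1"
  using powr_mono2'[of "- \<tau>" 1 "2 * real M"] assms by (simp add: approx_radius_def)

lemma infinite_if_components_unbounded:
  fixes S :: "((int ^ 'd) \<times> 'b) set"
  assumes "\<And>m :: nat. \<exists>z\<in>S. int m < fst z $ j"
  shows "infinite S"
proof
  assume "finite S"
  obtain z where "z \<in> S" using assms by blast
  define m where "m = Max ((\<lambda>z. fst z $ j) ` S)"
  obtain z where "z \<in> S" "int (nat m) < fst z $ j" using assms by blast
  moreover have "fst z $ j \<le> m" unfolding m_def using \<open>finite S\<close> \<open>z \<in> S\<close> by (intro Max_ge) auto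
  ultimately show False by linarith
qed

lemma denominator_nbhd_approximation:
  fixes x :: "real ^ 'd ^ 'n"
  assumes x: "x \<in> denominator_nbhd (approx_radius \<tau> M) M" and "M > 0" "0 \<le> \<tau>"
  obtains q r where "q \<in> denominators M"
    "infnorm (x *v real_vec q - real_vec r) < infnorm (real_vec q) powr (- \<tau>)"
proof -
  obtain q :: "int ^ 'd" where q: "q \<in> denominators M" and
    "\<And>i. \<exists>r::int. \<bar>(x *v real_vec q) $ i - of_int r\<bar> \<le> approx_radius \<tau> M"
    using x unfolding denominator_nbhd_def resonant_nbhd_def infdist_Ints_le_iff by blast
  then obtain r where r: "\<And>i. \<bar>(x *v real_vec q) $ i - of_int (r i)\<bar> \<le> approx_radius \<tau> M" by metis
  have "q \<noteq> 0" using denominators_component_pos[OF q assms(2), of undefined] by auto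
  have "infnorm (real_vec q) \<le> 2 * real M"
  proof (rule infnorm_le_cart)
    fix j show "\<bar>real_vec q $ j\<bar> \<le> 2 * real M"
      using denominators_real_vec_bounds[OF q, of j] by linarith
  qed
  then have "(2 * real M) powr (- \<tau>) \<le> infnorm (real_vec q) powr (- \<tau>)"
    using infnorm_real_vec_ge_1[OF \<open>q \<noteq> 0\<close>] assms(3) by (intro powr_mono2') auto
  moreover have "infnorm (x *v real_vec q - real_vec (\<chi> i. r i)) \<le> approx_radius \<tau> M"
    by (rule infnorm_le_cart) (use r in \<open>simp add: real_vec_def\<close>)
  moreover have "2 * approx_radius \<tau> M = (2 * real M) powr (- \<tau>)" by (simp add: approx_radius_def)
  moreover have "0 < approx_radius \<tau> M" using assms(2) by (rule approx_radius_pos)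
  ultimately have "infnorm (x *v real_vec q - real_vec (\<chi> i. r i)) <
      infnorm (real_vec q) powr (- \<tau>)" by linarith
  then show ?thesis using q by (rule that[rotated])
qed

lemma well_approximable_if_denominator_nbhd:
  fixes x :: "real ^ 'd ^ 'n"
  assumes "0 \<le> \<tau>" and M: "\<And>k. M k > k"
    and x: "\<And>k. x \<in> denominator_nbhd (approx_radius \<tau> (M k)) (M k)"
  shows "x \<in> well_approximable \<tau>"
  unfolding well_approximable_def
proof (intro CollectI infinite_if_components_unbounded)
  fix k :: nat
  obtain q r where q: "q \<in> denominators (M k)"
    and r: "infnorm (x *v real_vec q - real_vec r) < infnorm (real_vec q) powr (- \<tau>)"
    using denominator_nbhd_approximation[OF x, of k] M[of k] assms(1) by auto
  have "int k < q $ j" for j using denominators_component[OF q, of j] M[of k] by linarith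
  moreover from this[of undefined] have "q \<noteq> 0" by auto
  ultimately show
      "\<exists>z\<in>{(q, r). q \<noteq> 0 \<and> infnorm (x *v real_vec q - real_vec r) <
          infnorm (real_vec q) powr (- \<tau>)}.
      int k < fst z $ undefined" using r by force
qed

definition bump_factor :: "nat \<Rightarrow> nat \<Rightarrow> real" where
  "bump_factor K n = (2 * (4 * real K) ^ K) ^ n"

lemma bump_factor_nonneg [simp]: "0 \<le> bump_factor K n"
  by (simp add: bump_factor_def)

lemma norm_prod_bump_coeffs_le:
  fixes k :: "int ^ 'n"
  assumes bump: "bump_coeffs K \<delta> c" and "0 < \<delta>" "k \<noteq> 0" "0 \<le> t" "t \<le> real K"
  shows "norm (mode_coeff c k) \<le> bump_factor K CARD('n) * (\<delta> * norm (real_vec k)) powr (- t)"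
proof -
  define P where "P = (\<Prod>i\<in>UNIV. 1 + \<delta> * \<bar>of_int (k $ i)\<bar> :: real)"
  have "\<delta> * norm (real_vec k) \<le> \<delta> * (\<Sum>i\<in>UNIV. \<bar>of_int (k $ i)\<bar>)"
    using norm_le_l1_cart[of "real_vec k"] assms(2)
    by (intro mult_left_mono) (simp_all add: real_vec_def)
  also have "\<dots> \<le> P" unfolding sum_distrib_left P_def using assms(2) by (intro sum_le_prod) auto
  finally have norm_le: "\<delta> * norm (real_vec k) \<le> P" .
  have "1 \<le> P" unfolding P_def using assms(2) by (intro prod_ge_1) auto
  have "norm (mode_coeff c k) \<le> (\<Prod>i\<in>UNIV. 2 * (4 * real K / (1 + \<delta> * \<bar>of_int (k $ i)\<bar>)) ^ K)"
    unfolding prod_norm[symmetric] using bump by (intro prod_mono) (auto simp: bump_coeffs_def)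
  also have "\<dots> = bump_factor K CARD('n) * (1 / P) ^ K"
    by (simp add: P_def bump_factor_def power_divide prod.distrib prod_dividef prod_power_distrib
        power_mult_distrib)
  also have "(1 / P) ^ K = P powr (- real K)"
    using \<open>1 \<le> P\<close> by (simp add: powr_minus_divide powr_realpow power_one_over)
  also have "\<dots> \<le> P powr (- t)" using \<open>1 \<le> P\<close> assms(5) by (intro powr_mono) auto
  also have "\<dots> \<le> (\<delta> * norm (real_vec k)) powr (- t)"
    using norm_le assms(2-4) by (intro powr_mono2') auto
  finally show ?thesis by (simp add: mult_left_mono)
qed

lemma card_positive_divisors_int:
  assumes "m \<noteq> 0"
  shows "card {a::int. 0 < a \<and> a dvd m} = card {a::nat. a dvd nat \<bar>m\<bar>}"
proof -
  have "{a::int. 0 < a \<and> a dvd m} = int ` {a::nat. a dvd nat \<bar>m\<bar>}"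
  proof (intro equalityI subsetI)
    fix a assume "a \<in> {a::int. 0 < a \<and> a dvd m}"
    then show "a \<in> int ` {a::nat. a dvd nat \<bar>m\<bar>}"
      by (intro image_eqI[of _ _ "nat a"]) (auto simp: nat_dvd_iff)
  next
    fix a assume "a \<in> int ` {a::nat. a dvd nat \<bar>m\<bar>}"
    then obtain a' where "a = int a'" "a' dvd nat \<bar>m\<bar>" by blast
    moreover from this have "a' \<noteq> 0" using assms by auto
    ultimately show "a \<in> {a::int. 0 < a \<and> a dvd m}" by (simp add: int_dvd_int_iff[symmetric])
  qed
  then show ?thesis by (simp add: card_image)
qed

lemma outer_freq_eqD:
  "outer_freq z = outer_freq z' \<Longrightarrow> snd z $ i * fst z $ j = snd z' $ i * fst z' $ j"
  unfolding of_int_eq_iff[where ?'a = real, symmetric] outer_freq_component[symmetric] by simp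

lemma inj_on_fst_frequency_fibre:
  assumes "M > 0"
  shows "inj_on fst (frequency_fibre M c l)" (is "inj_on fst ?R")
proof (rule inj_onI)
  fix z z' assume z: "z \<in> ?R" "z' \<in> ?R" "fst z = fst z'"
  have "fst z $ undefined > 0" using z(1) assms
    by (intro denominators_component_pos) (auto simp: frequency_pairs_def)
  moreover have "snd z $ i * fst z $ undefined = snd z' $ i * fst z $ undefined" for i
    using outer_freq_eqD[of z z' i undefined] z by simp
  ultimately show "z = z'" using z(3) by (simp add: prod_eq_iff vec_eq_iff)
qed

lemma matrix_entry_le_norm: "\<bar>l $ i $ j\<bar> \<le> norm l" for l :: "real ^ 'd ^ 'n"
  using component_le_norm_cart[of "l $ i" j] Finite_Cartesian_Product.norm_nth_le[of l i]
  by (rule order_trans)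

lemma card_frequency_fibre_le_prod:
  fixes z\<^sub>0 :: "(int ^ 'd) \<times> (int ^ 'n)"
  assumes "M > 0" and z0: "fst z\<^sub>0 \<in> denominators M" "snd z\<^sub>0 $ i \<noteq> 0"
  shows "card (frequency_fibre M c (outer_freq z\<^sub>0)) \<le>
    (\<Prod>j\<in>UNIV. card {a. 0 < a \<and> a dvd snd z\<^sub>0 $ i * fst z\<^sub>0 $ j})"
    (is "card ?R \<le> (\<Prod>j\<in>UNIV. card (?S j))")
proof -
  have "inj_on fst ?R" using \<open>M > 0\<close> by (rule inj_on_fst_frequency_fibre)
  moreover have "fst ` ?R \<subseteq> vec_box ?S"
  proof (intro image_subsetI)
    fix z assume z: "z \<in> ?R"
    have "fst z $ j dvd snd z\<^sub>0 $ i * fst z\<^sub>0 $ j" for j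
    proof -
      have "snd z $ i * fst z $ j = snd z\<^sub>0 $ i * fst z\<^sub>0 $ j"
        using z by (intro outer_freq_eqD) simp
      then show ?thesis by (rule subst) simp
    qed
    moreover have "0 < fst z $ j" for j
      using z \<open>M > 0\<close> by (intro denominators_component_pos) (auto simp: frequency_pairs_def)
    ultimately show "fst z \<in> vec_box ?S" by (simp add: vec_box_def)
  qed
  moreover have "finite (?S j)" for j
  proof -
    have "snd z\<^sub>0 $ i * fst z\<^sub>0 $ j \<noteq> 0"
      using z0(2) denominators_component_pos[OF z0(1) \<open>M > 0\<close>, of j] by simp
    from finite_divisors_int[OF this] show ?thesis by (rule rev_finite_subset) auto
  qed
  ultimately show ?thesis
    using card_inj_on_le[of fst ?R "vec_box ?S"] finite_vec_box[of ?S] by (simp add: card_vec_box)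
qed

lemma card_frequency_fibre_le:
  fixes l :: "real ^ 'd ^ 'n"
  assumes divisors: "\<And>n::nat. n > 0 \<Longrightarrow> real (card {a. a dvd n}) \<le> D * real n powr \<epsilon>"
    and "0 \<le> \<epsilon>" "0 \<le> D" "M > 0" "l \<noteq> 0"
  shows "real (card (frequency_fibre M c l)) \<le> (D * norm l powr \<epsilon>) ^ CARD('d)"
    (is "real (card ?R) \<le> _")
proof (cases "?R = {}")
  case False
  then obtain z where z: "fst z \<in> denominators M" "outer_freq z = l"
    by (auto simp: frequency_pairs_def)
  then have "snd z \<noteq> 0" using \<open>l \<noteq> 0\<close> by (auto simp: outer_freq_def)
  then obtain i where i: "snd z $ i \<noteq> 0" by (auto simp: vec_eq_iff)
  have "card ?R \<le> (\<Prod>j\<in>UNIV. card {a. 0 < a \<and> a dvd snd z $ i * fst z $ j})"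
    using card_frequency_fibre_le_prod[OF \<open>M > 0\<close> z(1) i, of c] by (simp only: z(2))
  from of_nat_mono[OF this]
  have "real (card ?R) \<le> (\<Prod>j\<in>UNIV. real (card {a. 0 < a \<and> a dvd snd z $ i * fst z $ j}))"
    by (simp only: of_nat_prod)
  also have "\<dots> \<le> (\<Prod>j\<in>(UNIV :: 'd set). D * norm l powr \<epsilon>)"
  proof (intro prod_mono conjI)
    fix j
    have nonzero: "snd z $ i * fst z $ j \<noteq> 0"
      using i denominators_component_pos[OF z(1) \<open>M > 0\<close>, of j] by simp
    have "real (nat \<bar>snd z $ i * fst z $ j\<bar>) = \<bar>l $ i $ j\<bar>"
      unfolding z(2)[symmetric] outer_freq_component by (simp flip: of_int_abs of_int_mult)
    also have "\<dots> \<le> norm l" by (rule matrix_entry_le_norm)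
    finally have entry: "real (nat \<bar>snd z $ i * fst z $ j\<bar>) \<le> norm l" .
    have "real (card {a. 0 < a \<and> a dvd snd z $ i * fst z $ j}) \<le>
        D * real (nat \<bar>snd z $ i * fst z $ j\<bar>) powr \<epsilon>"
      unfolding card_positive_divisors_int[OF nonzero] using nonzero by (intro divisors) simp
    also have "\<dots> \<le> D * norm l powr \<epsilon>"
      using entry assms(2,3) by (intro mult_left_mono powr_mono2) auto
    finally show "real (card {a. 0 < a \<and> a dvd snd z $ i * fst z $ j}) \<le> D * norm l powr \<epsilon>" .
  qed simp
  finally show ?thesis by simp
next
  case True
  then have "card ?R = 0" by (simp only: card.empty)
  then show ?thesis using assms(3) by simp
qed

lemma norm_outer_coeff_le_card:
  fixes l :: "real ^ 'd ^ 'n"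
  assumes bump: "bump_coeffs K \<delta> c" and "0 < \<delta>" "M > 0" "l \<noteq> 0" "0 \<le> t" "t \<le> real K"
  shows "norm (outer_coeff M c l) \<le> real (card (frequency_fibre M c l)) *
    (bump_factor K CARD('n) * (\<delta> * norm l / (2 * real CARD('d) * real M)) powr (- t)) /
        real M ^ CARD('d)"
proof -
  let ?R = "frequency_fibre M c l"
  let ?W = "bump_factor K CARD('n)"
  have "norm (mode_coeff c (snd z)) \<le> ?W * (\<delta> * norm l / (2 * real CARD('d) * real M)) powr (- t)"
    if z: "z \<in> ?R" for z
  proof -
    have q: "fst z \<in> denominators M" using z by (auto simp: frequency_pairs_def)
    have k: "snd z \<noteq> 0" using z \<open>l \<noteq> 0\<close> by (auto simp: outer_freq_def)
    have "norm l = norm (real_vec (snd z)) * norm (real_vec (fst z))"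
      using z norm_outer_freq[of z] by simp
    also have "\<dots> \<le> norm (real_vec (snd z)) * (2 * real CARD('d) * real M)"
      using norm_denominators_le[OF q] by (rule mult_left_mono) simp
    finally have "norm l / (2 * real CARD('d) * real M) \<le> norm (real_vec (snd z))"
      using \<open>M > 0\<close> by (simp add: pos_divide_le_eq)
    then have "\<delta> * (norm l / (2 * real CARD('d) * real M)) \<le> \<delta> * norm (real_vec (snd z))"
      using assms(2) by (intro mult_left_mono) auto
    then have "(\<delta> * norm (real_vec (snd z))) powr (- t) \<le>
        (\<delta> * norm l / (2 * real CARD('d) * real M)) powr (- t)"
      using assms by (intro powr_mono2') auto
    then have "?W * (\<delta> * norm (real_vec (snd z))) powr (- t) \<le>
        ?W * (\<delta> * norm l / (2 * real CARD('d) * real M)) powr (- t)"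
      by (intro mult_left_mono) auto
    with norm_prod_bump_coeffs_le[OF bump assms(2) k assms(5,6)] show ?thesis
      by (rule order_trans)
  qed
  then have "norm (\<Sum>z\<in>?R. mode_coeff c (snd z)) \<le>
      real (card ?R) * (?W * (\<delta> * norm l / (2 * real CARD('d) * real M)) powr (- t))"
    by (rule sum_norm_bound)
  then show ?thesis
    unfolding outer_coeff_def norm_divide norm_of_nat of_nat_power norm_power
    by (rule divide_right_mono) simp
qed

lemma norm_outer_coeff_le_powr:
  fixes l :: "real ^ 'd ^ 'n"
  assumes divisors: "\<And>n::nat. n > 0 \<Longrightarrow> real (card {a. a dvd n}) \<le> D * real n powr \<epsilon>"
    and "0 \<le> \<epsilon>" "0 \<le> D"
    and "M > 0" "l \<noteq> 0" "bump_coeffs K (approx_radius \<tau> M) c" "0 \<le> t" "t \<le> real K"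
  shows "norm (outer_coeff M c l) \<le> D ^ CARD('d) * bump_factor K CARD('n) *
    (2 powr \<tau> * 4 * real CARD('d)) powr t * real M powr ((1 + \<tau>) * t - real CARD('d)) *
    norm l powr (\<epsilon> * real CARD('d) - t)"
proof -
  define d where "d = real CARD('d)"
  let ?W = "bump_factor K CARD('n)"
  define Y where "Y = 2 powr \<tau> * 4 * d"
  let ?R = "frequency_fibre M c l"
  have "d > 0" by (simp add: d_def)
  have "real (card ?R) \<le> (D * norm l powr \<epsilon>) ^ CARD('d)"
    using assms(1-5) by (rule card_frequency_fibre_le)
  also have "\<dots> = D ^ CARD('d) * norm l powr (\<epsilon> * d)"
    using \<open>l \<noteq> 0\<close> by (simp add: power_mult_distrib powr_power d_def mult.commute)
  finally have card: "real (card ?R) \<le> D ^ CARD('d) * norm l powr (\<epsilon> * d)" .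
  have "approx_radius \<tau> M * norm l / (2 * d * real M) = norm l / (Y * real M powr (1 + \<tau>))"
    using \<open>M > 0\<close> \<open>d > 0\<close>
    by (simp add: approx_radius_def Y_def powr_mult powr_add powr_minus divide_simps)
  then have scale: "(approx_radius \<tau> M * norm l / (2 * d * real M)) powr (- t) =
      Y powr t * real M powr ((1 + \<tau>) * t) * norm l powr (- t)"
    using \<open>d > 0\<close> by (simp only: powr_minus_divide powr_divide powr_mult powr_powr) simp
  have "norm (outer_coeff M c l) \<le> real (card ?R) *
      (?W * (approx_radius \<tau> M * norm l / (2 * d * real M)) powr (- t)) / real M ^ CARD('d)"
    unfolding d_def by (intro norm_outer_coeff_le_card approx_radius_pos assms)
  also have "\<dots> \<le> (D ^ CARD('d) * norm l powr (\<epsilon> * d)) *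
      (?W * (approx_radius \<tau> M * norm l / (2 * d * real M)) powr (- t)) / real M ^ CARD('d)"
    by (intro divide_right_mono mult_right_mono card) auto
  also have "\<dots> =
      D ^ CARD('d) * ?W * Y powr t * real M powr ((1 + \<tau>) * t - d) * norm l powr (\<epsilon> * d - t)"
    unfolding scale
    using \<open>M > 0\<close> by (simp add: powr_diff powr_minus powr_realpow d_def divide_simps)
  finally show ?thesis by (simp add: Y_def d_def)
qed

lemma outer_coeff_decay:
  assumes "0 \<le> \<tau>" "0 \<le> t" "t + 1 \<le> real K" and e: "(1 + \<tau>) * t - real CARD('d) < e"
  obtains U where "0 \<le> U"
    and "\<And>M c (l :: real ^ 'd ^ 'n). M > 0 \<Longrightarrow> bump_coeffs K (approx_radius \<tau> M) c \<Longrightarrow>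
    l \<noteq> 0 \<Longrightarrow> norm (outer_coeff M c l) \<le> U * real M powr e * \<langle>l\<rangle> powr (- t)"
proof -
  define d where "d = real CARD('d)"
  define \<epsilon> where "\<epsilon> = min 1 ((e + d - (1 + \<tau>) * t) / (1 + \<tau>))"
  have "0 < (e + d - (1 + \<tau>) * t) / (1 + \<tau>)"
    using e assms(1) by (intro divide_pos_pos) (auto simp: d_def)
  then have \<epsilon>: "0 < \<epsilon>" "\<epsilon> \<le> 1" by (auto simp: \<epsilon>_def)
  have "(1 + \<tau>) * \<epsilon> \<le> (1 + \<tau>) * ((e + d - (1 + \<tau>) * t) / (1 + \<tau>))"
    using assms(1) by (intro mult_left_mono) (auto simp: \<epsilon>_def)
  then have exponent: "(1 + \<tau>) * (t + \<epsilon>) - d \<le> e" using assms(1) by (simp add: distrib_left)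
  have "d > 0" by (simp add: d_def)
  then have "\<epsilon> / d > 0" using \<epsilon>(1) by simp
  then obtain D where D: "D > 0"
      "\<And>n::nat. n > 0 \<Longrightarrow> real (card {a. a dvd n}) \<le> D * real n powr (\<epsilon> / d)"
    by (rule divisor_bound) (rule that)
  define V where "V = D ^ CARD('d) * bump_factor K CARD('n) * (2 powr \<tau> * 4 * d) powr (t + \<epsilon>)"
  have "0 \<le> V" using D(1) by (simp add: V_def)
  show ?thesis
  proof (rule that[of "V * 2 powr t"])
    show "0 \<le> V * 2 powr t" using \<open>0 \<le> V\<close> by simp
    fix M c and l :: "real ^ 'd ^ 'n"
    assume M: "M > 0" and bump: "bump_coeffs K (approx_radius \<tau> M) c" and "l \<noteq> 0"
    show "norm (outer_coeff M c l) \<le> V * 2 powr t * real M powr e * \<langle>l\<rangle> powr (- t)"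
    proof (cases "outer_coeff M c l = 0")
      case False
      then have "l \<in> int_lattice" using outer_coeff_support outer_freq_int_lattice by fastforce
      with \<open>l \<noteq> 0\<close> have "1 \<le> norm l" by (intro norm_ge_1_int_lattice)
      have "norm (outer_coeff M c l) \<le> V * real M powr ((1 + \<tau>) * (t + \<epsilon>) - d) * norm l powr (- t)"
        using norm_outer_coeff_le_powr[OF D(2) _ _ M \<open>l \<noteq> 0\<close> bump, of "t + \<epsilon>"] assms \<epsilon> D(1) \<open>d > 0\<close>
        by (simp add: V_def d_def)
      also have "\<dots> \<le> V * real M powr e * (2 powr t * \<langle>l\<rangle> powr (- t))"
        using M exponent \<open>0 \<le> V\<close> \<open>1 \<le> norm l\<close> assms(2)
        by (intro mult_mono mult_left_mono powr_mono norm_powr_le_bracket) auto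
      finally show ?thesis by (simp add: mult_ac)
    qed (use \<open>0 \<le> V\<close> in simp)
  qed
qed

lemma sum_norm_outer_coeff_le:
  fixes g :: "real ^ 'd ^ 'n \<Rightarrow> real"
  assumes "finite {k. c k \<noteq> 0}" and g: "\<And>l. 0 \<le> g l"
  shows "(\<Sum>l\<in>nonzero_spectrum (outer_coeff M c). norm (outer_coeff M c l) * g l) \<le>
    (\<Sum>z | z \<in> frequency_pairs M c \<and>
        outer_freq z \<noteq> 0. norm (mode_coeff c (snd z)) * g (outer_freq z)) /
      real (M ^ CARD('d))"
proof -
  let ?Z = "{z. z \<in> frequency_pairs M c \<and> outer_freq z \<noteq> (0 :: real ^ 'd ^ 'n)}"
  let ?w = "\<lambda>z :: (int ^ 'd) \<times> (int ^ 'n). norm (mode_coeff c (snd z)) / real (M ^ CARD('d))"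
  have finite_Z: "finite ?Z"
    by (rule finite_subset[OF _ finite_frequency_pairs[OF assms(1)]]) auto
  have support: "nonzero_spectrum (outer_coeff M c) \<subseteq> outer_freq ` ?Z"
    using outer_coeff_support[of M c] by (force simp: nonzero_spectrum_def)
  have coeff: "norm (outer_coeff M c l) \<le> (\<Sum>z | z \<in> ?Z \<and> outer_freq z = l. ?w z)" if "l \<noteq> 0"
    for l :: "real ^ 'd ^ 'n"
  proof -
    have "frequency_fibre M c l = {z. z \<in> ?Z \<and> outer_freq z = l}" using that by auto
    then show ?thesis
      unfolding outer_coeff_def norm_divide norm_of_nat sum_divide_distrib[symmetric]
      by (intro divide_right_mono) (simp_all add: norm_sum)
  qed
  have "(\<Sum>l\<in>nonzero_spectrum (outer_coeff M c). norm (outer_coeff M c l) * g l) \<le>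
      (\<Sum>l\<in>nonzero_spectrum (outer_coeff M c). (\<Sum>z | z \<in> ?Z \<and> outer_freq z = l. ?w z) * g l)"
    using g by (intro sum_mono mult_right_mono coeff) (auto simp: nonzero_spectrum_def)
  also have "\<dots> \<le> (\<Sum>l\<in>outer_freq ` ?Z. (\<Sum>z | z \<in> ?Z \<and> outer_freq z = l. ?w z) * g l)"
    using finite_Z g support by (intro sum_mono2 mult_nonneg_nonneg sum_nonneg) auto
  also have "\<dots> = (\<Sum>l\<in>outer_freq ` ?Z. \<Sum>z | z \<in> ?Z \<and> outer_freq z = l. ?w z * g (outer_freq z))"
    by (simp add: sum_distrib_right)
  also have "\<dots> = (\<Sum>z\<in>?Z. ?w z * g (outer_freq z))"
    using finite_Z by (rule sum.image_gen[symmetric])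
  finally show ?thesis by (simp add: sum_divide_distrib)
qed

lemma weighted_frequency_le:
  fixes z :: "(int ^ 'd) \<times> (int ^ 'n)"
  assumes bump: "bump_coeffs K (approx_radius \<tau> M) c" and M: "M > 0"
    and "0 \<le> p" "0 \<le> s" "s \<le> real K" and q: "fst z \<in> denominators M" and k: "snd z \<noteq> 0"
  shows "norm (mode_coeff c (snd z)) * \<langle>outer_freq z\<rangle> powr (- p) \<le>
    bump_factor K CARD('n) * 2 powr (\<tau> * s + s + (p + s)) * real M powr (\<tau> * s - p) *
      \<langle>real_vec (snd z)\<rangle> powr (- (p + s))"
proof -
  define v where "v = norm (real_vec (snd z))"
  have "1 \<le> v" unfolding v_def using k by (intro norm_ge_1_int_lattice real_vec_int_lattice) simp
  have "\<langle>outer_freq z\<rangle> powr (- p) \<le> (v * real M) powr (- p)"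
  proof (intro powr_mono2')
    have "v * real M \<le> norm (outer_freq z)"
      unfolding norm_outer_freq v_def by (intro mult_left_mono norm_denominators_ge q) simp
    then show "v * real M \<le> \<langle>outer_freq z\<rangle>" by (simp add: bracket_def)
  qed (use \<open>1 \<le> v\<close> M assms(3) in auto)
  moreover have "norm (mode_coeff c (snd z)) \<le>
      bump_factor K CARD('n) * (approx_radius \<tau> M * v) powr (- s)"
    unfolding v_def by (rule norm_prod_bump_coeffs_le[OF bump approx_radius_pos[OF M] k assms(4,5)])
  ultimately have "norm (mode_coeff c (snd z)) * \<langle>outer_freq z\<rangle> powr (- p) \<le>
      bump_factor K CARD('n) * (approx_radius \<tau> M * v) powr (- s) * (v * real M) powr (- p)"
    by (intro mult_mono) auto
  also have "(approx_radius \<tau> M * v) powr (- s) =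
      2 powr (\<tau> * s + s) * real M powr (\<tau> * s) * v powr (- s)"
    using M \<open>1 \<le> v\<close>
    by (simp add: approx_radius_def powr_mult powr_divide powr_powr powr_add powr_minus
        divide_simps)
  also have "bump_factor K CARD('n) * (2 powr (\<tau> * s + s) * real M powr (\<tau> * s) * v powr (- s)) *
      (v * real M) powr (- p) =
      bump_factor K CARD('n) * 2 powr (\<tau> * s + s) * real M powr (\<tau> * s - p) * v powr (- (p + s))"
    using M \<open>1 \<le> v\<close> by (simp add: powr_mult powr_diff powr_minus powr_add divide_simps)
  also have "\<dots> \<le> bump_factor K CARD('n) * 2 powr (\<tau> * s + s) * real M powr (\<tau> * s - p) *
      (2 powr (p + s) * \<langle>real_vec (snd z)\<rangle> powr (- (p + s)))"
    unfolding v_def using \<open>1 \<le> v\<close> assms(3,4)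
    by (intro mult_left_mono norm_powr_le_bracket) (auto simp: v_def)
  finally show ?thesis by (simp only: powr_add mult_ac)
qed

lemma sum_weighted_frequency_le:
  assumes M: "M > 0" and bump: "bump_coeffs K (approx_radius \<tau> M) c"
    and "0 \<le> p" "0 \<le> s" "s \<le> real K"
    and \<Lambda>: "\<And>T :: (int ^ 'n) set. finite T \<Longrightarrow> (\<Sum>k\<in>T. \<langle>real_vec k\<rangle> powr (- (p + s))) \<le> \<Lambda>"
  shows "(\<Sum>z | z \<in> (frequency_pairs M c :: ((int ^ 'd) \<times> (int ^ 'n)) set) \<and> outer_freq z \<noteq> 0.
      norm (mode_coeff c (snd z)) * \<langle>outer_freq z\<rangle> powr (- p)) / real (M ^ CARD('d)) \<le>
    bump_factor K CARD('n) * 2 powr (\<tau> * s + s + (p + s)) * real M powr (\<tau> * s - p) * \<Lambda>"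
proof -
  let ?Z = "{z :: (int ^ 'd) \<times> (int ^ 'n). z \<in> frequency_pairs M c \<and> outer_freq z \<noteq> 0}"
  let ?Q = "denominators M :: (int ^ 'd) set"
    and ?k = "vec_box (\<lambda>_. {k. c k \<noteq> 0}) :: (int ^ 'n) set"
  define X where "X =
      bump_factor K CARD('n) * 2 powr (\<tau> * s + s + (p + s)) * real M powr (\<tau> * s - p)"
  have "0 \<le> X" by (simp add: X_def)
  have finite: "finite {k. c k \<noteq> 0}" using bump by (simp add: bump_coeffs_def)
  have "(\<Sum>z\<in>?Z. norm (mode_coeff c (snd z)) * \<langle>outer_freq z\<rangle> powr (- p)) \<le>
      (\<Sum>z\<in>?Z. X * \<langle>real_vec (snd z)\<rangle> powr (- (p + s)))"
    unfolding X_def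
    by (intro sum_mono weighted_frequency_le assms(1-5))
      (auto simp: frequency_pairs_def outer_freq_def)
  also have "\<dots> \<le> (\<Sum>z\<in>?Q \<times> ?k. X * \<langle>real_vec (snd z)\<rangle> powr (- (p + s)))"
    using finite_frequency_pairs[OF finite] \<open>0 \<le> X\<close>
    by (intro sum_mono2) (auto simp: frequency_pairs_def)
  also have "\<dots> = real (M ^ CARD('d)) * (X * (\<Sum>k\<in>?k. \<langle>real_vec k\<rangle> powr (- (p + s))))"
    by (simp add: sum.cartesian_product' card_denominators sum_distrib_left)
  also have "\<dots> \<le> real (M ^ CARD('d)) * (X * \<Lambda>)"
    using finite \<open>0 \<le> X\<close> by (intro mult_left_mono \<Lambda> finite_vec_box) auto
  finally have
      "(\<Sum>z\<in>?Z. norm (mode_coeff c (snd z)) * \<langle>outer_freq z\<rangle> powr (- p)) / real (M ^ CARD('d)) \<le>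
          X * \<Lambda>"
    using M by (simp add: divide_le_eq mult.commute)
  then show ?thesis by (simp add: X_def)
qed

lemma sum_bracket_outer_coeff_le:
  assumes "0 \<le> p" "0 < \<epsilon>" "p \<le> real CARD('n)" "real CARD('n) - p + \<epsilon> \<le> real K"
  obtains U where "0 \<le> U" and "\<And>M c. M > 0 \<Longrightarrow> bump_coeffs K (approx_radius \<tau> M) c \<Longrightarrow>
    (\<Sum>l\<in>nonzero_spectrum (outer_coeff M c :: real ^ 'd ^ 'n \<Rightarrow> complex). norm (outer_coeff M c l) *
        \<langle>l\<rangle> powr (- p)) \<le>
      U * real M powr (\<tau> * (real CARD('n) - p + \<epsilon>) - p)"
proof -
  define s where "s = real CARD('n) - p + \<epsilon>"
  have s: "0 \<le> s" "s \<le> real K" using assms by (auto simp: s_def)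
  have "p + s > real CARD('n)" using assms(2) by (simp add: s_def)
  then obtain \<Lambda> where \<Lambda>: "\<Lambda> > 0" "\<And>T :: (int ^ 'n) set. finite T \<Longrightarrow>
      (\<Sum>k\<in>T. \<langle>real_vec k\<rangle> powr (- (p + s))) \<le> \<Lambda>"
    by (rule sum_real_vec_bracket_powr_bounded) (rule that)
  define V where "V = bump_factor K CARD('n) * 2 powr (\<tau> * s + s + (p + s))"
  show ?thesis
  proof (rule that[of "V * \<Lambda>"])
    show "0 \<le> V * \<Lambda>" using \<Lambda>(1) by (simp add: V_def)
    fix M c assume M: "M > 0" and bump: "bump_coeffs K (approx_radius \<tau> M) c"
    then have "finite {k. c k \<noteq> 0}" by (simp add: bump_coeffs_def)
    then have "(\<Sum>l\<in>nonzero_spectrum (outer_coeff M c :: real ^ 'd ^ 'n \<Rightarrow> complex).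
        norm (outer_coeff M c l) * \<langle>l\<rangle> powr (- p)) \<le>
        (\<Sum>z | z \<in> (frequency_pairs M c :: ((int ^ 'd) \<times> (int ^ 'n)) set) \<and> outer_freq z \<noteq> 0.
          norm (mode_coeff c (snd z)) * \<langle>outer_freq z\<rangle> powr (- p)) / real (M ^ CARD('d))"
      by (rule sum_norm_outer_coeff_le) simp
    also have "\<dots> \<le> V * real M powr (\<tau> * s - p) * \<Lambda>"
      unfolding V_def by (rule sum_weighted_frequency_le[OF M bump assms(1) s \<Lambda>(2)])
    finally show
        "(\<Sum>l\<in>nonzero_spectrum (outer_coeff M c :: real ^ 'd ^ 'n \<Rightarrow> complex).
            norm (outer_coeff M c l) * \<langle>l\<rangle> powr (- p)) \<le>
        V * \<Lambda> * real M powr (\<tau> * (real CARD('n) - p + \<epsilon>) - p)"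
      by (simp add: s_def mult_ac)
  qed
qed

lemma ex_energy_exponent:
  fixes \<tau> p d n :: real
  assumes "0 \<le> \<tau>" "n * \<tau> - d < p * (1 + \<tau>)"
  obtains \<epsilon> where "0 < \<epsilon>" "\<epsilon> \<le> 1" "(\<epsilon> - d) + (\<tau> * (n - p + \<epsilon>) - p) < 0"
proof -
  define gap where "gap = p * (1 + \<tau>) - (n * \<tau> - d)"
  define \<epsilon> where "\<epsilon> = min 1 (gap / (2 * (1 + \<tau>)))"
  have "gap > 0" using assms(2) by (simp add: gap_def)
  then have "0 < \<epsilon>" "\<epsilon> \<le> 1" using assms(1) by (auto simp: \<epsilon>_def)
  moreover have "\<epsilon> \<le> gap / (2 * (1 + \<tau>))" by (simp add: \<epsilon>_def)
  then have "\<epsilon> * (2 * (1 + \<tau>)) \<le> gap" using assms(1) by (simp add: pos_le_divide_eq)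
  moreover have "(\<epsilon> - d) + (\<tau> * (n - p + \<epsilon>) - p) = \<epsilon> * (2 * (1 + \<tau>)) / 2 - gap"
    by (simp add: gap_def algebra_simps)
  ultimately show ?thesis using \<open>gap > 0\<close> by (intro that[of \<epsilon>]) linarith+
qed

lemma outer_coeff_energy:
  assumes "0 \<le> \<tau>" "0 \<le> p" "p \<le> real CARD('n)" "real CARD('n) - p + 1 \<le> real K"
    and critical: "real CARD('n) * \<tau> - real CARD('d) < p * (1 + \<tau>)"
  obtains U e where "0 \<le> U" "e < 0" and "\<And>M c. M > 0 \<Longrightarrow> bump_coeffs K (approx_radius \<tau> M) c \<Longrightarrow>
    spectral_energy p (outer_coeff M c :: real ^ 'd ^ 'n \<Rightarrow> complex) \<le> U * real M powr e"
proof -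
  define d n where "d = real CARD('d)" and "n = real CARD('n)"
  obtain \<epsilon> where \<epsilon>: "0 < \<epsilon>" "\<epsilon> \<le> 1" and negative: "(\<epsilon> - d) + (\<tau> * (n - p + \<epsilon>) - p) < 0"
    by (rule ex_energy_exponent[OF assms(1) critical, folded d_def n_def]) (rule that)
  define e where "e = (\<epsilon> - d) + (\<tau> * (n - p + \<epsilon>) - p)"
  obtain U where U: "0 \<le> U" "\<And>M c (l :: real ^ 'd ^ 'n). M > 0 \<Longrightarrow>
      bump_coeffs K (approx_radius \<tau> M) c \<Longrightarrow>
      l \<noteq> 0 \<Longrightarrow> norm (outer_coeff M c l) \<le> U * real M powr (\<epsilon> - d) * \<langle>l\<rangle> powr (- 0)"
    by (rule outer_coeff_decay[of \<tau> 0 K "\<epsilon> - d"]) (use assms \<epsilon> in \<open>auto simp: d_def intro: that\<close>)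
  obtain V where V: "0 \<le> V" "\<And>M c. M > 0 \<Longrightarrow> bump_coeffs K (approx_radius \<tau> M) c \<Longrightarrow>
      (\<Sum>l\<in>nonzero_spectrum (outer_coeff M c :: real ^ 'd ^ 'n \<Rightarrow> complex). norm (outer_coeff M c l) *
          \<langle>l\<rangle> powr (- p)) \<le>
        V * real M powr (\<tau> * (n - p + \<epsilon>) - p)"
    by (rule sum_bracket_outer_coeff_le[of p \<epsilon> K \<tau>, folded n_def])
      (use assms \<epsilon> in \<open>auto simp: n_def intro: that\<close>)
  show ?thesis
  proof (rule that[of "U * V" e])
    show "0 \<le> U * V" using U(1) V(1) by simp
    fix M c assume M: "M > 0" and bump: "bump_coeffs K (approx_radius \<tau> M) c"
    let ?b = "outer_coeff M c :: real ^ 'd ^ 'n \<Rightarrow> complex"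
    have "spectral_energy p ?b \<le>
        (\<Sum>l\<in>nonzero_spectrum ?b. U * real M powr (\<epsilon> - d) * (norm (?b l) * \<langle>l\<rangle> powr (- p)))"
      unfolding spectral_energy_def
    proof (rule sum_mono)
      fix l assume "l \<in> nonzero_spectrum ?b"
      then have "norm (?b l) \<le> U * real M powr (\<epsilon> - d)"
        using U(2)[OF M bump, of l] by (simp add: nonzero_spectrum_def)
      then show "(norm (?b l))\<^sup>2 * \<langle>l\<rangle> powr (- p) \<le>
          U * real M powr (\<epsilon> - d) * (norm (?b l) * \<langle>l\<rangle> powr (- p))"
        unfolding power2_eq_square mult.assoc[of "norm (?b l)"] by (intro mult_right_mono) auto
    qed
    also have "\<dots> \<le> U * real M powr (\<epsilon> - d) * (V * real M powr (\<tau> * (n - p + \<epsilon>) - p))"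
      unfolding sum_distrib_left[symmetric] using U(1) by (intro mult_left_mono V(2) M bump) auto
    also have "\<dots> = U * V * real M powr e" by (simp add: e_def powr_add)
    finally show "spectral_energy p ?b \<le> U * V * real M powr e" .
  qed (use negative in \<open>simp add: e_def\<close>)
qed

section \<open>Multiplicative perturbation of a rapidly decaying measure\<close>

lemma eventually_mult_powr_less:
  fixes e :: real
  assumes "e < 0" "0 < \<theta>"
  shows "\<forall>\<^sub>F M in sequentially. U * real M powr e < \<theta>"
proof -
  have "(\<lambda>M. U * real M powr e) \<longlonglongrightarrow> U * 0"
    by (intro tendsto_intros tendsto_neg_powr[OF assms(1)] filterlim_real_sequentially)
  then show ?thesis using assms(2) by (intro order_tendstoD(2)) auto
qed

lemma ex_small_outer_coeffs:
  assumes "0 \<le> \<tau>" and a: "0 \<le> a" "(1 + \<tau>) * a < real CARD('d)" "a + 1 \<le> real K"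
    and p: "0 \<le> p" "p \<le> real CARD('n)" "real CARD('n) - p + 1 \<le> real K"
      "real CARD('n) * \<tau> - real CARD('d) < p * (1 + \<tau>)"
    and "0 < \<theta>"
  shows "\<exists>M>M\<^sub>0. \<forall>c. bump_coeffs K (approx_radius \<tau> M) c \<longrightarrow>
    small_coeffs a p \<theta> (outer_coeff M c :: real ^ 'd ^ 'n \<Rightarrow> complex)"
proof -
  define e where "e = ((1 + \<tau>) * a - real CARD('d)) / 2"
  have e: "e < 0" "(1 + \<tau>) * a - real CARD('d) < e" using a(2) by (auto simp: e_def field_simps)
  obtain U where U: "\<And>M c (l :: real ^ 'd ^ 'n). M > 0 \<Longrightarrow> bump_coeffs K (approx_radius \<tau> M) c \<Longrightarrow>
      l \<noteq> 0 \<Longrightarrow> norm (outer_coeff M c l) \<le> U * real M powr e * \<langle>l\<rangle> powr (- a)"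
    by (rule outer_coeff_decay[OF \<open>0 \<le> \<tau>\<close> a(1,3) e(2)]) (rule that)
  obtain E f where "f < 0" and E: "\<And>M c. M > 0 \<Longrightarrow> bump_coeffs K (approx_radius \<tau> M) c \<Longrightarrow>
      spectral_energy p (outer_coeff M c :: real ^ 'd ^ 'n \<Rightarrow> complex) \<le> E * real M powr f"
    by (rule outer_coeff_energy[OF \<open>0 \<le> \<tau>\<close> p]) (rule that)
  have "\<forall>\<^sub>F M in sequentially. M > M\<^sub>0 \<and> U * real M powr e < \<theta> \<and> E * real M powr f < \<theta>\<^sup>2"
    using \<open>0 < \<theta>\<close>
    by (intro eventually_conj eventually_gt_at_top eventually_mult_powr_less e \<open>f < 0\<close>) auto
  then obtain M where M: "M > M\<^sub>0" "U * real M powr e < \<theta>" "E * real M powr f < \<theta>\<^sup>2"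
    by (auto simp: eventually_sequentially)
  have "small_coeffs a p \<theta> (outer_coeff M c :: real ^ 'd ^ 'n \<Rightarrow> complex)"
    if bump: "bump_coeffs K (approx_radius \<tau> M) c" for c
    unfolding small_coeffs_def
  proof (intro conjI allI impI)
    have "M > 0" using M(1) by simp
    fix l :: "real ^ 'd ^ 'n" assume "l \<noteq> 0"
    have "norm (outer_coeff M c l) \<le> U * real M powr e * \<langle>l\<rangle> powr (- a)"
      by (intro U \<open>M > 0\<close> bump \<open>l \<noteq> 0\<close>)
    also have "\<dots> \<le> \<theta> * \<langle>l\<rangle> powr (- a)" using M(2) by (intro mult_right_mono) auto
    finally show "norm (outer_coeff M c l) \<le> \<theta> * \<langle>l\<rangle> powr (- a)" .
  next
    have "M > 0" using M(1) by simp
    then show "spectral_energy p (outer_coeff M c :: real ^ 'd ^ 'n \<Rightarrow> complex) \<le> \<theta>\<^sup>2"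
      using E[OF _ bump] M(3) by (intro order_trans[OF E[OF _ bump]]) auto
  qed
  with M(1) show ?thesis by blast
qed

lemma ex_small_modulation:
  assumes "0 \<le> \<tau>" and a: "0 \<le> a" "(1 + \<tau>) * a < real CARD('d)"
    and p: "0 \<le> p" "p \<le> real CARD('n)" "real CARD('n) * \<tau> - real CARD('d) < p * (1 + \<tau>)"
    and "0 \<le> t" "0 < \<theta>"
  obtains M F b B V where "M > M\<^sub>0" "lattice_modulation F b B"
    "\<And>x :: real ^ 'd ^ 'n. F x \<noteq> 0 \<Longrightarrow> x \<in> denominator_nbhd (approx_radius \<tau> M) M"
    "\<forall>N. small_coeffs a p \<theta> (b N)"
    "0 \<le> V" "\<And>N l. l \<noteq> 0 \<Longrightarrow> norm (b N l) \<le> V * \<langle>l\<rangle> powr (- t)"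
proof -
  define K where "K = nat \<lceil>a + t + real CARD('n) + 2\<rceil>"
  have "a + t + real CARD('n) + 2 \<le> real K" unfolding K_def by linarith
  then have K: "a + 1 \<le> real K" "t + 1 \<le> real K" "real CARD('n) - p + 1 \<le> real K" "K > 0"
    using a(1) p(1) \<open>0 \<le> t\<close> by linarith+
  obtain M where "M > M\<^sub>0" and small: "\<And>c. bump_coeffs K (approx_radius \<tau> M) c \<Longrightarrow>
      small_coeffs a p \<theta> (outer_coeff M c :: real ^ 'd ^ 'n \<Rightarrow> complex)"
    using ex_small_outer_coeffs[OF \<open>0 \<le> \<tau>\<close> a K(1) p(1,2) K(3) p(3) \<open>0 < \<theta>\<close>] by blast
  then have "M > 0" by simp
  have "(1 + \<tau>) * t - real CARD('d) < (1 + \<tau>) * t" by simp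
  then obtain V where V: "0 \<le> V" "\<And>M c (l :: real ^ 'd ^ 'n). M > 0 \<Longrightarrow>
      bump_coeffs K (approx_radius \<tau> M) c \<Longrightarrow>
      l \<noteq> 0 \<Longrightarrow> norm (outer_coeff M c l) \<le> V * real M powr ((1 + \<tau>) * t) * \<langle>l\<rangle> powr (- t)"
    by (rule outer_coeff_decay[OF \<open>0 \<le> \<tau>\<close> \<open>0 \<le> t\<close> K(2)]) (rule that)
  obtain F :: "real ^ 'd ^ 'n \<Rightarrow> real" and c B
    where F: "lattice_modulation F (\<lambda>N. outer_coeff M (c N)) B"
      and c: "\<And>N. bump_coeffs K (approx_radius \<tau> M) (c N)"
      and support: "\<And>x. F x \<noteq> 0 \<Longrightarrow> x \<in> denominator_nbhd (approx_radius \<tau> M) M"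
    by (rule ex_lattice_modulation[OF approx_radius_pos[OF \<open>M > 0\<close>]
          approx_radius_le_1[OF \<open>M > 0\<close> \<open>0 \<le> \<tau>\<close>] K(4) \<open>M > 0\<close>]) (rule that)
  show ?thesis
  proof (rule that[OF \<open>M > M\<^sub>0\<close> F support])
    show "\<forall>N. small_coeffs a p \<theta> (outer_coeff M (c N) :: real ^ 'd ^ 'n \<Rightarrow> complex)"
      using small[OF c] by blast
    show "0 \<le> V * real M powr ((1 + \<tau>) * t)" using V(1) by simp
    show "norm (outer_coeff M (c N) l) \<le> V * real M powr ((1 + \<tau>) * t) * \<langle>l\<rangle> powr (- t)"
      if "l \<noteq> 0" for N and l :: "real ^ 'd ^ 'n"
      by (intro V \<open>M > 0\<close> c that)
  qed
qed

lemma multiplicative_step: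
  fixes \<mu> :: "(real ^ 'd ^ 'n) measure"
  assumes "0 \<le> \<tau>" and a: "0 \<le> a" "(1 + \<tau>) * a < real CARD('d)"
    and p: "0 \<le> p" "p \<le> real CARD('n)" "real CARD('n) * \<tau> - real CARD('d) < p * (1 + \<tau>)"
    and A: "a + real DIM(real ^ 'd ^ 'n) < A" "p + real DIM(real ^ 'd ^ 'n) < A"
    and \<mu>: "decaying_measure R A \<mu>" and "0 < \<eta>"
  obtains M \<nu> where "M > M\<^sub>0" "decaying_measure R A \<nu>" "absolutely_continuous \<mu> \<nu>"
    "AE x in \<nu>. x \<in> denominator_nbhd (approx_radius \<tau> M) M"
    "decay_bound \<eta> a (fourier_diff \<nu> \<mu>)" "lattice_energy_le p (fourier_diff \<nu> \<mu>) \<eta>"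
proof -
  have finite: "finite_measure \<mu>" and sets: "sets \<mu> = sets borel"
    using \<mu> by (auto simp: decaying_measure_def)
  obtain C where C: "decay_bound C A (fourier_transform \<mu>)"
    using \<mu> by (auto simp: decaying_measure_def)
  obtain \<theta> where "\<theta> > 0"
    and small: "\<And>F b B. lattice_modulation F b B \<Longrightarrow> \<forall>N. small_coeffs a p \<theta> (b N) \<Longrightarrow>
      decay_bound \<eta> a (fourier_diff (modulate F \<mu>) \<mu>) \<and>
          lattice_energy_le p (fourier_diff (modulate F \<mu>) \<mu>) \<eta>"
    by (rule small_modulation_perturbation[OF finite sets C a(1) p(1) A \<open>0 < \<eta>\<close>]) (rule that)
  have "0 \<le> A" using A(1) a(1) by linarith
  then have "0 \<le> A + real DIM(real ^ 'd ^ 'n) + 1" by simp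
  then obtain M F b B V where M: "M > M\<^sub>0" and modulation: "lattice_modulation F b B"
    and support: "\<And>x :: real ^ 'd ^ 'n. F x \<noteq> 0 \<Longrightarrow> x \<in> denominator_nbhd (approx_radius \<tau> M) M"
    and b: "\<forall>N. small_coeffs a p \<theta> (b N)"
    and V: "0 \<le> V" "\<And>N l. l \<noteq> 0 \<Longrightarrow> norm (b N l) \<le>
        V * \<langle>l\<rangle> powr (- (A + real DIM(real ^ 'd ^ 'n) + 1))"
    by (rule ex_small_modulation[OF \<open>0 \<le> \<tau>\<close> a p _ \<open>\<theta> > 0\<close>]) (rule that)
  show ?thesis
  proof (rule that[OF M])
    show "decaying_measure R A (modulate F \<mu>)"
      by (rule decaying_measure_modulate[OF modulation \<mu> \<open>0 \<le> A\<close> V])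
    show "absolutely_continuous \<mu> (modulate F \<mu>)"
      by (rule lattice_modulation.absolutely_continuous_modulate[OF modulation finite sets])
    show "AE x in modulate F \<mu>. x \<in> denominator_nbhd (approx_radius \<tau> M) M"
      using lattice_modulation.AE_modulate_nonzero[OF modulation finite sets]
      by eventually_elim (rule support)
  qed (use small[OF modulation b] in auto)
qed

section \<open>Limits of multiplicative perturbations\<close>

lemma decay_bound_telescope:
  assumes "\<And>k. decay_bound ((1 / 2) ^ (k + 2)) a (fourier_diff (\<mu> (Suc k)) (\<mu> k))"
  shows "decay_bound (1 / 2) a (fourier_diff (\<mu> k) (\<mu> 0))"
proof -
  have "decay_bound (1 / 2 - (1 / 2) ^ (k + 1)) a (fourier_diff (\<mu> k) (\<mu> 0))"
  proof (induction k)
    case (Suc k)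
    from decay_bound_add[OF this assms[of k]] show ?case by (simp add: fourier_diff_def)
  qed (simp add: decay_bound_def fourier_diff_def)
  then show ?thesis by (rule decay_bound_weaken) auto
qed

lemma lattice_energy_le_telescope:
  assumes "\<And>k. lattice_energy_le p (fourier_diff (\<mu> (Suc k)) (\<mu> k)) ((1 / 2) ^ (k + 2))"
  shows "lattice_energy_le p (fourier_diff (\<mu> k) (\<mu> 0)) (1 / 2)"
proof -
  have half: "(1 / 2 :: real) ^ (k + 1) \<le> 1 / 2" for k
    using power_decreasing[of 1 "k + 1" "1 / 2 :: real"] by simp
  have "lattice_energy_le p (fourier_diff (\<mu> k) (\<mu> 0)) (1 / 2 - (1 / 2) ^ (k + 1))"
  proof (induction k)
    case (Suc k)
    from lattice_energy_le_add[OF this assms[of k]] half[of k] show ?case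
      by (simp add: fourier_diff_def)
  qed (simp add: lattice_energy_le_def fourier_diff_def)
  then show ?thesis by (rule lattice_energy_le_weaken) (use half[of k] in auto)
qed

definition normalize_measure :: "'a measure \<Rightarrow> 'a measure" where
  "normalize_measure \<mu> = modulate (\<lambda>_. 1 / measure \<mu> (space \<mu>)) \<mu>"

lemma sets_normalize_measure [simp]: "sets (normalize_measure \<mu>) = sets \<mu>"
  by (simp add: normalize_measure_def)

lemma prob_space_normalize_measure:
  assumes "finite_measure \<mu>" "0 < measure \<mu> (space \<mu>)"
  shows "prob_space (normalize_measure \<mu>)"
proof
  interpret finite_measure \<mu> by fact
  have "emeasure (normalize_measure \<mu>) (space (normalize_measure \<mu>)) =
      ennreal (1 / measure \<mu> (space \<mu>)) * ennreal (measure \<mu> (space \<mu>))"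
    by (simp add: normalize_measure_def modulate_def emeasure_density_const emeasure_eq_measure)
  also have "\<dots> = 1" using assms(2) by (simp flip: ennreal_mult'')
  finally show "emeasure (normalize_measure \<mu>) (space (normalize_measure \<mu>)) = 1" .
qed

lemma fourier_transform_normalize_measure:
  assumes "sets \<mu> = sets borel"
  shows "fourier_transform (normalize_measure \<mu>) \<xi> =
      fourier_transform \<mu> \<xi> / of_real (measure \<mu> (space \<mu>))"
proof -
  have "(\<lambda>x. unit_exp (- (x \<bullet> \<xi>))) \<in> borel_measurable \<mu>"
    unfolding measurable_cong_sets[OF assms refl] by measurable
  then show ?thesis
    unfolding fourier_transform_unit_exp normalize_measure_def modulate_def
    by (subst integral_density) (auto simp: scaleR_conv_of_real)
qed

lemma norm_fourier_transform_normalize_measure_le: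
  assumes "sets \<mu> = sets borel" "1 / 2 \<le> measure \<mu> (space \<mu>)"
  shows "norm (fourier_transform (normalize_measure \<mu>) \<xi>) \<le> 2 * norm (fourier_transform \<mu> \<xi>)"
proof -
  have "norm (fourier_transform (normalize_measure \<mu>) \<xi>) =
      norm (fourier_transform \<mu> \<xi>) / measure \<mu> (space \<mu>)"
    by (simp add: fourier_transform_normalize_measure[OF assms(1)] norm_divide)
  also have "\<dots> \<le> norm (fourier_transform \<mu> \<xi>) / (1 / 2)"
    using assms(2) by (intro divide_left_mono) auto
  finally show ?thesis by simp
qed

lemma AE_normalize_measure: "AE x in \<mu>. P x \<Longrightarrow> AE x in normalize_measure \<mu>. P x"
  unfolding normalize_measure_def modulate_def by (subst AE_density) auto

lemma ex_normalized_limit: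
  fixes \<mu> :: "nat \<Rightarrow> 'a::euclidean_space measure"
  assumes \<mu>: "\<And>k. decaying_measure R A (\<mu> k)" and mass: "\<And>k. 1 / 2 \<le> measure (\<mu> k) (space (\<mu> k))"
    and decay: "\<And>k. decay_bound C a (fourier_transform (\<mu> k))"
    and energy: "\<And>k. lattice_energy_le p (fourier_transform (\<mu> k)) E"
  obtains \<nu> where "prob_space \<nu>" "sets \<nu> = sets borel" "compact (measure_support \<nu>)"
    "decay_bound (2 * C) a (fourier_transform \<nu>)"
    "lattice_energy_le p (fourier_transform \<nu>) (2 * E)"
    "\<And>S. closed S \<Longrightarrow> (\<forall>\<^sub>F k in sequentially. AE x in \<mu> k. x \<in> S) \<Longrightarrow> measure_support \<nu> \<subseteq> S"
proof -
  define \<pi> where "\<pi> k = normalize_measure (\<mu> k)" for k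
  have finite: "finite_measure (\<mu> k)" and sets: "sets (\<mu> k) = sets borel" for k
    using \<mu>[of k] by (auto simp: decaying_measure_def)
  have bounded: "AE x in \<pi> k. norm x \<le> R" for k
    unfolding \<pi>_def by (rule AE_normalize_measure) (use \<mu>[of k] in \<open>simp add: decaying_measure_def\<close>)
  have sets_\<pi>: "sets (\<pi> k) = sets borel" for k by (simp add: \<pi>_def sets)
  have prob: "prob_space (\<pi> k)" for k
    unfolding \<pi>_def using mass[of k] by (intro prob_space_normalize_measure finite) linarith
  have fourier_le: "norm (fourier_transform (\<pi> k) \<xi>) \<le> 2 * norm (fourier_transform (\<mu> k) \<xi>)" for k \<xi>
    unfolding \<pi>_def by (rule norm_fourier_transform_normalize_measure_le[OF sets mass])
  obtain \<nu> r where \<nu>: "prob_space \<nu>" "sets \<nu> = sets borel" and r: "strict_mono (r :: nat \<Rightarrow> nat)"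
    and weak: "converges_weakly (\<lambda>k. \<pi> (r k)) \<nu>"
    by (rule weak_compactness[OF prob sets_\<pi> bounded]) (rule that)
  have support: "measure_support \<nu> \<subseteq> S"
    if "closed S" "\<forall>\<^sub>F k in sequentially. AE x in \<pi> (r k). x \<in> S" for S
    using that by (intro measure_support_subset \<nu> converges_weakly_AE_closed[OF \<nu> prob weak])
  show ?thesis
  proof (rule that[OF \<nu>])
    have "measure_support \<nu> \<subseteq> cball 0 R" using bounded by (intro support) auto
    then show "compact (measure_support \<nu>)"
      using closed_measure_support bounded_subset[OF bounded_cball] compact_eq_bounded_closed
      by blast
    show "decay_bound (2 * C) a (fourier_transform \<nu>)"
      by (rule decay_bound_lim[OF decay_bound_scale[OF decay fourier_le]])
        (use converges_weakly_fourier_transform[OF weak] in auto)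
    show "lattice_energy_le p (fourier_transform \<nu>) (2 * E)"
      by (rule lattice_energy_le_lim[OF lattice_energy_le_scale[OF energy fourier_le]
            converges_weakly_fourier_transform[OF weak]])
    fix S :: "'a set" assume S: "closed S" "\<forall>\<^sub>F k in sequentially. AE x in \<mu> k. x \<in> S"
    from S(2) have "\<forall>\<^sub>F k in sequentially. AE x in \<pi> k. x \<in> S"
      unfolding \<pi>_def by (rule eventually_mono) (rule AE_normalize_measure)
    then show "measure_support \<nu> \<subseteq> S"
      using S(1) r
      by (intro support) (auto simp: filterlim_subseq intro: eventually_compose_filterlim)
  qed
qed

lemma limit_of_perturbations:
  fixes \<mu> :: "nat \<Rightarrow> 'a::euclidean_space measure"
  assumes "prob_space (\<mu> 0)" and \<mu>: "\<And>k. decaying_measure R A (\<mu> k)"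
    and A: "real DIM('a) < A" "a \<le> A" and "0 \<le> p"
    and ac: "\<And>k. absolutely_continuous (\<mu> k) (\<mu> (Suc k))"
    and decay: "\<And>k. decay_bound ((1 / 2) ^ (k + 2)) a (fourier_diff (\<mu> (Suc k)) (\<mu> k))"
    and energy: "\<And>k. lattice_energy_le p (fourier_diff (\<mu> (Suc k)) (\<mu> k)) ((1 / 2) ^ (k + 2))"
    and S: "\<And>k. closed (S k)" "\<And>k. AE x in \<mu> (Suc k). x \<in> S k"
  obtains \<nu> C D where "prob_space \<nu>" "sets \<nu> = sets borel" "compact (measure_support \<nu>)"
    "measure_support \<nu> \<subseteq> (\<Inter>k. S k)"
    "decay_bound C a (fourier_transform \<nu>)" "lattice_energy_le p (fourier_transform \<nu>) D"
proof -
  obtain C where C: "decay_bound C A (fourier_transform (\<mu> 0))"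
    using \<mu>[of 0] by (auto simp: decaying_measure_def)
  obtain E where E: "0 \<le> E" "lattice_energy_le p (fourier_transform (\<mu> 0)) E"
    by (rule decay_bound_imp_lattice_energy_le[OF C A(1) \<open>0 \<le> p\<close>]) (rule that)
  note from_0 = decay_bound_telescope[OF decay] lattice_energy_le_telescope[OF energy]
  have mass: "1 / 2 \<le> measure (\<mu> k) (space (\<mu> k))" for k
  proof -
    have "norm (complex_of_real (measure (\<mu> k) (space (\<mu> k)) - 1)) \<le> 1 / 2"
      using decay_boundD[OF from_0(1)[of k], of 0] prob_space.prob_space[OF assms(1)]
      by (simp add: fourier_diff_def fourier_transform_0)
    then show ?thesis unfolding norm_of_real by linarith
  qed
  have decay': "decay_bound (C + 1 / 2) a (fourier_transform (\<mu> k))" for k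
    using decay_bound_add[OF decay_bound_weaken[OF C A(2) order_refl] from_0(1)[of k]]
    by (simp add: fourier_diff_def)
  have energy': "lattice_energy_le p (fourier_transform (\<mu> k)) (E + 1 / 2)" for k
    using lattice_energy_le_add[OF E(2) from_0(2)[of k] E(1)] by (simp add: fourier_diff_def)
  have AE_S: "AE x in \<mu> k. x \<in> S j" if "Suc j \<le> k" for j k
    using that
  proof (induction k rule: dec_induct)
    case (step k)
    have "sets (\<mu> (Suc k)) = sets (\<mu> k)" using \<mu> by (simp add: decaying_measure_def)
    then show ?case using ac step.IH by (rule absolutely_continuous_AE)
  qed (rule S(2))
  obtain \<nu> where \<nu>: "prob_space \<nu>" "sets \<nu> = sets borel" "compact (measure_support \<nu>)"
    "decay_bound (2 * (C + 1 / 2)) a (fourier_transform \<nu>)"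
    "lattice_energy_le p (fourier_transform \<nu>) (2 * (E + 1 / 2))"
    and support: "\<And>S. closed S \<Longrightarrow> (\<forall>\<^sub>F k in sequentially. AE x in \<mu> k. x \<in> S) \<Longrightarrow>
        measure_support \<nu> \<subseteq> S"
    by (rule ex_normalized_limit[OF \<mu> mass decay' energy']) (rule that)
  have "measure_support \<nu> \<subseteq> S j" for j
    using AE_S[of j] by (intro support S) (auto simp: eventually_sequentially)
  then show ?thesis by (intro that[OF \<nu>(1-3) _ \<nu>(4,5)]) auto
qed

lemma ex_perturbation_sequence:
  fixes \<mu>\<^sub>0 :: "(real ^ 'd ^ 'n) measure"
  assumes \<tau>: "0 \<le> \<tau>" and a: "0 \<le> a" "(1 + \<tau>) * a < real CARD('d)"
    and p: "0 \<le> p" "p \<le> real CARD('n)" "real CARD('n) * \<tau> - real CARD('d) < p * (1 + \<tau>)"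
    and A: "a + real DIM(real ^ 'd ^ 'n) < A" "p + real DIM(real ^ 'd ^ 'n) < A"
    and \<mu>0: "decaying_measure R A \<mu>\<^sub>0"
  obtains \<mu> M where "\<mu> 0 = \<mu>\<^sub>0" "\<And>k. decaying_measure R A (\<mu> k)" "\<And>k :: nat. k < M k"
    "\<And>k. absolutely_continuous (\<mu> k) (\<mu> (Suc k))"
    "\<And>k. AE x in \<mu> (Suc k). x \<in> denominator_nbhd (approx_radius \<tau> (M k)) (M k)"
    "\<And>k. decay_bound ((1 / 2) ^ (k + 2)) a (fourier_diff (\<mu> (Suc k)) (\<mu> k))"
    "\<And>k. lattice_energy_le p (fourier_diff (\<mu> (Suc k)) (\<mu> k)) ((1 / 2) ^ (k + 2))"
proof -
  define step where "step k s s' \<longleftrightarrow> snd s < snd s' \<and> absolutely_continuous (fst s) (fst s') \<and>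
      (AE x in fst s'. x \<in> denominator_nbhd (approx_radius \<tau> (snd s')) (snd s')) \<and>
      decay_bound ((1 / 2) ^ (k + 2)) a (fourier_diff (fst s') (fst s)) \<and>
      lattice_energy_le p (fourier_diff (fst s') (fst s)) ((1 / 2) ^ (k + 2))"
    for k and s s' :: "(real ^ 'd ^ 'n) measure \<times> nat"
  have "\<exists>f. \<forall>k. (decaying_measure R A (fst (f k)) \<and> (k = 0 \<longrightarrow> f k = (\<mu>\<^sub>0, 0))) \<and>
      step k (f k) (f (Suc k))"
  proof (rule dependent_nat_choice)
    show "\<exists>s. decaying_measure R A (fst s) \<and> ((0::nat) = 0 \<longrightarrow> s = (\<mu>\<^sub>0, 0 :: nat))" using \<mu>0 by auto
    fix s :: "(real ^ 'd ^ 'n) measure \<times> nat" and k :: nat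
    assume "decaying_measure R A (fst s) \<and> (k = 0 \<longrightarrow> s = (\<mu>\<^sub>0, 0))"
    then have s: "decaying_measure R A (fst s)" by blast
    have "(0 :: real) < (1 / 2) ^ (k + 2)" by simp
    then obtain M \<nu> where "M > snd s" "decaying_measure R A \<nu>" "absolutely_continuous (fst s) \<nu>"
      "AE x in \<nu>. x \<in> denominator_nbhd (approx_radius \<tau> M) M"
      "decay_bound ((1 / 2) ^ (k + 2)) a (fourier_diff \<nu> (fst s))"
      "lattice_energy_le p (fourier_diff \<nu> (fst s)) ((1 / 2) ^ (k + 2))"
      by (rule multiplicative_step[OF \<tau> a p A s]) (rule that)
    then show "\<exists>s'. (decaying_measure R A (fst s') \<and> (Suc k = 0 \<longrightarrow> s' = (\<mu>\<^sub>0, 0))) \<and> step k s s'"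
      by (intro exI[of _ "(\<nu>, M)"]) (auto simp only: step_def fst_conv snd_conv)
  qed
  then obtain f where f: "\<And>k. decaying_measure R A (fst (f k))"
    "f 0 = (\<mu>\<^sub>0, 0)" "\<And>k. step k (f k) (f (Suc k))"
    by metis
  have "strict_mono (\<lambda>k. snd (f k))" using f(3) by (simp add: strict_mono_Suc_iff step_def)
  then have "k < snd (f (Suc k))" for k using seq_suble[of "\<lambda>k. snd (f k)" "Suc k"] by simp
  then show ?thesis
    using f by (intro that[of "\<lambda>k. fst (f k)" "\<lambda>k. snd (f (Suc k))"]) (simp_all add: step_def)
qed

lemma ex_measure_on_well_approximable:
  assumes \<tau>: "0 \<le> \<tau>" and a: "0 \<le> a" "(1 + \<tau>) * a < real CARD('d)"
    and p: "0 \<le> p" "p \<le> real CARD('n)" "real CARD('n) * \<tau> - real CARD('d) < p * (1 + \<tau>)"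
  obtains \<nu> C D where "\<nu> \<in> prob_measures_on (well_approximable \<tau> :: (real ^ 'd ^ 'n) set)"
    "decay_bound C a (fourier_transform \<nu>)" "lattice_energy_le p (fourier_transform \<nu>) D"
proof -
  define m where "m = real DIM(real ^ 'd ^ 'n)"
  define A where "A = real (nat \<lceil>a + p + m + 1\<rceil>)"
  have "a + p + m + 1 \<le> A" unfolding A_def by linarith
  moreover have "0 \<le> m" by (simp add: m_def)
  ultimately have A: "a + real DIM(real ^ 'd ^ 'n) < A" "p + real DIM(real ^ 'd ^ 'n) < A"
      "real DIM(real ^ 'd ^ 'n) < A" "a \<le> A"
    using a(1) p(1) unfolding m_def[symmetric] by linarith+
  obtain \<mu>\<^sub>0 :: "(real ^ 'd ^ 'n) measure" and R where
    \<mu>0: "prob_space \<mu>\<^sub>0" "decaying_measure R A \<mu>\<^sub>0"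
    unfolding A_def using ex_decaying_measure by blast
  obtain \<mu> M where start: "\<mu> 0 = \<mu>\<^sub>0" and \<mu>: "\<And>k. decaying_measure R A (\<mu> k)"
    and M: "\<And>k :: nat. k < M k"
    and ac: "\<And>k. absolutely_continuous (\<mu> k) (\<mu> (Suc k))"
    and near: "\<And>k. AE x in \<mu> (Suc k). x \<in> denominator_nbhd (approx_radius \<tau> (M k)) (M k)"
    and decay: "\<And>k. decay_bound ((1 / 2) ^ (k + 2)) a (fourier_diff (\<mu> (Suc k)) (\<mu> k))"
    and energy: "\<And>k. lattice_energy_le p (fourier_diff (\<mu> (Suc k)) (\<mu> k)) ((1 / 2) ^ (k + 2))"
    by (rule ex_perturbation_sequence[OF \<tau> a p A(1,2) \<mu>0(2)]) (rule that)
  obtain \<nu> :: "(real ^ 'd ^ 'n) measure"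
    and C D where \<nu>: "prob_space \<nu>" "sets \<nu> = sets borel" "compact (measure_support \<nu>)"
    "measure_support \<nu> \<subseteq> (\<Inter>k. denominator_nbhd (approx_radius \<tau> (M k)) (M k))"
    "decay_bound C a (fourier_transform \<nu>)" "lattice_energy_le p (fourier_transform \<nu>) D"
    by (rule limit_of_perturbations[OF \<mu>0(1)[folded start] \<mu> A(3,4) p(1) ac decay energy
        closed_denominator_nbhd near])
      (rule that)
  have "measure_support \<nu> \<subseteq> well_approximable \<tau>"
    using \<nu>(4) by (intro subsetI well_approximable_if_denominator_nbhd[OF \<tau> M]) blast
  then have "\<nu> \<in> prob_measures_on (well_approximable \<tau>)"
    using \<nu>(1-3) by (simp add: prob_measures_on_def)
  then show ?thesis using \<nu>(5,6) by (rule that)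
qed

section \<open>The Fourier dimension of the well approximable matrices\<close>

lemma ex_decay_bound_fourier_iff:
  fixes \<mu> :: "'a::euclidean_space measure"
  assumes "prob_space \<mu>" "0 \<le> \<sigma>"
  shows "(\<exists>C. \<forall>\<xi>. \<xi> \<noteq> 0 \<longrightarrow> norm (fourier_transform \<mu> \<xi>) \<le> C * norm \<xi> powr (- \<sigma>)) \<longleftrightarrow>
    (\<exists>C. decay_bound C \<sigma> (fourier_transform \<mu>))"
proof (intro iffI; elim exE)
  fix C assume C: "\<forall>\<xi>. \<xi> \<noteq> 0 \<longrightarrow> norm (fourier_transform \<mu> \<xi>) \<le> C * norm \<xi> powr (- \<sigma>)"
  have "decay_bound (max 1 \<bar>C\<bar> * 2 powr \<sigma>) \<sigma> (fourier_transform \<mu>)"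
  proof (rule decay_boundI)
    fix \<xi> :: 'a
    have "norm (fourier_transform \<mu> \<xi>) \<le> max 1 \<bar>C\<bar> * (2 powr \<sigma> * \<langle>\<xi>\<rangle> powr (- \<sigma>))"
    proof (cases "1 \<le> norm \<xi>")
      case True
      then have "\<xi> \<noteq> 0" by auto
      with C have "norm (fourier_transform \<mu> \<xi>) \<le> C * norm \<xi> powr (- \<sigma>)" by blast
      also have "\<dots> \<le> max 1 \<bar>C\<bar> * norm \<xi> powr (- \<sigma>)" by (intro mult_right_mono) auto
      also have "\<dots> \<le> max 1 \<bar>C\<bar> * (2 powr \<sigma> * \<langle>\<xi>\<rangle> powr (- \<sigma>))"
        using True assms(2) by (intro mult_left_mono norm_powr_le_bracket) auto
      finally show ?thesis .
    next
      case False
      then have "\<langle>\<xi>\<rangle> \<le> 2" by (simp add: bracket_def)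
      then have "2 powr (- \<sigma>) \<le> \<langle>\<xi>\<rangle> powr (- \<sigma>)" using assms(2) by (intro powr_mono2') auto
      then have "2 powr \<sigma> * 2 powr (- \<sigma>) \<le> 2 powr \<sigma> * \<langle>\<xi>\<rangle> powr (- \<sigma>)" by (rule mult_left_mono) simp
      then have "1 * 1 \<le> max 1 \<bar>C\<bar> * (2 powr \<sigma> * \<langle>\<xi>\<rangle> powr (- \<sigma>))"
        by (intro mult_mono) (auto simp flip: powr_add)
      then show ?thesis using norm_fourier_transform_le_1[OF assms(1), of \<xi>] by simp
    qed
    then show "norm (fourier_transform \<mu> \<xi>) \<le> max 1 \<bar>C\<bar> * 2 powr \<sigma> * \<langle>\<xi>\<rangle> powr (- \<sigma>)"
      by (simp add: mult.assoc)
  qed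
  then show "\<exists>C. decay_bound C \<sigma> (fourier_transform \<mu>)" ..
next
  fix C assume C: "decay_bound C \<sigma> (fourier_transform \<mu>)"
  have "norm (fourier_transform \<mu> \<xi>) \<le> C * norm \<xi> powr (- \<sigma>)" if "\<xi> \<noteq> 0" for \<xi>
  proof -
    have "\<langle>\<xi>\<rangle> powr (- \<sigma>) \<le> norm \<xi> powr (- \<sigma>)"
      using assms(2) that by (intro powr_mono2') (auto simp: bracket_def)
    then have "C * \<langle>\<xi>\<rangle> powr (- \<sigma>) \<le> C * norm \<xi> powr (- \<sigma>)"
      using decay_bound_const_nonneg[OF C] by (rule mult_left_mono)
    then show ?thesis using decay_boundD[OF C, of \<xi>] by linarith
  qed
  then show "\<exists>C. \<forall>\<xi>. \<xi> \<noteq> 0 \<longrightarrow> norm (fourier_transform \<mu> \<xi>) \<le> C * norm \<xi> powr (- \<sigma>)" by blast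
qed

context
  fixes \<mu> :: "'a::euclidean_space measure"
  assumes prob: "prob_space \<mu>"
begin

lemma fourier_dim_measure_eq_Sup:
  "fourier_dim_measure \<mu> =
      Sup {s \<in> {0..real DIM('a)}. \<exists>C. decay_bound C (s / 2) (fourier_transform \<mu>)}"
proof -
  have "(\<exists>C. \<forall>\<xi>. \<xi> \<noteq> 0 \<longrightarrow> norm (fourier_transform \<mu> \<xi>) \<le> C * norm \<xi> powr (- s / 2)) \<longleftrightarrow>
      (\<exists>C. decay_bound C (s / 2) (fourier_transform \<mu>))" if "0 \<le> s" for s
    using ex_decay_bound_fourier_iff[OF prob, of "s / 2"] that by simp
  then show ?thesis unfolding fourier_dim_measure_def by (metis (lifting) atLeastAtMost_iff)
qed

lemma fourier_dim_measure_ge: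
  assumes "decay_bound C (s / 2) (fourier_transform \<mu>)" "0 \<le> s" "s \<le> real DIM('a)"
  shows "s \<le> fourier_dim_measure \<mu>"
  unfolding fourier_dim_measure_eq_Sup
  using assms by (intro cSup_upper bdd_aboveI[of _ "real DIM('a)"]) auto

lemma fourier_dim_measure_le:
  assumes "\<And>s C. 0 \<le> s \<Longrightarrow> s \<le> real DIM('a) \<Longrightarrow> decay_bound C (s / 2) (fourier_transform \<mu>) \<Longrightarrow> s \<le> D"
  shows "fourier_dim_measure \<mu> \<le> D"
  unfolding fourier_dim_measure_eq_Sup
proof (rule cSup_least)
  have "decay_bound 1 0 (fourier_transform \<mu>)"
    using norm_fourier_transform_le_1[OF prob] by (intro decay_boundI) simp
  then show "{s \<in> {0..real DIM('a)}. \<exists>C. decay_bound C (s / 2) (fourier_transform \<mu>)} \<noteq> {}"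
    by (intro ex_in_conv[THEN iffD1] exI[of _ 0]) auto
qed (use assms in auto)

end

lemma fourier_dim_ge:
  fixes E :: "'a::euclidean_space set"
  assumes "\<mu> \<in> prob_measures_on E"
  shows "fourier_dim_measure \<mu> \<le> fourier_dim E"
proof -
  have "fourier_dim_measure \<nu> \<le> real DIM('a)" if "\<nu> \<in> prob_measures_on E" for \<nu>
    using that by (intro fourier_dim_measure_le) (auto simp: prob_measures_on_def)
  then have "bdd_above (insert 0 (fourier_dim_measure ` prob_measures_on E))"
    by (intro bdd_aboveI[of _ "real DIM('a)"]) auto
  then show ?thesis unfolding fourier_dim_def using assms by (intro cSup_upper) auto
qed

lemma decay_exponent_le:
  fixes \<mu> :: "(real ^ 'd ^ 'n) measure"
  assumes \<tau>: "\<tau> > real CARD('d) / real CARD('n)" and \<mu>: "\<mu> \<in> prob_measures_on (well_approximable \<tau>)"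
    and decay: "decay_bound C \<sigma> (fourier_transform \<mu>)"
  shows "\<sigma> \<le> real CARD('d) / (1 + \<tau>)"
proof (rule ccontr)
  assume exceeds: "\<not> ?thesis"
  have prob: "prob_space \<mu>" and sets: "sets \<mu> = sets borel"
    and support: "measure_support \<mu> \<subseteq> well_approximable \<tau>"
    using \<mu> by (auto simp: prob_measures_on_def)
  have "0 < real CARD('d) / real CARD('n)" by simp
  then have "0 < \<tau>" using \<tau> by linarith
  moreover have "real CARD('d) < \<tau> * real CARD('n)" using \<tau> by (simp add: pos_divide_less_eq)
  ultimately have "real CARD('d) / (1 + \<tau>) < real CARD('n)"
    by (simp add: pos_divide_less_eq distrib_right mult.commute[of "real CARD('n)"])
  then have "real CARD('d) / (1 + \<tau>) < min \<sigma> (real CARD('n))" using exceeds by simp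
  moreover have "decay_bound C (min \<sigma> (real CARD('n))) (fourier_transform \<mu>)"
    using decay by (rule decay_bound_weaken) auto
  ultimately have "AE x in \<mu>. x \<notin> well_approximable \<tau>"
    by (intro AE_not_well_approximable[OF \<tau> prob sets]) auto
  moreover have "AE x in \<mu>. x \<in> well_approximable \<tau>"
    using AE_measure_support[OF sets] by eventually_elim (use support in blast)
  ultimately have "AE x in \<mu>. False" by eventually_elim simp
  then show False using prob_space.AE_False[OF prob] by simp
qed

context
  fixes \<tau> d n :: real and E :: "(real ^ 'd ^ 'n) set"
  defines "d \<equiv> real CARD('d)" and "n \<equiv> real CARD('n)" and "E \<equiv> well_approximable \<tau>"
  assumes \<tau>: "\<tau> > d / n"
begin

lemma dimensions_ge_1: "1 \<le> d" "1 \<le> n"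
  by (auto simp: d_def n_def Suc_le_eq)

lemma \<tau>_pos: "0 < \<tau>" and d_less: "d < n * \<tau>"
proof -
  show "d < n * \<tau>" using \<tau> dimensions_ge_1 by (simp add: pos_divide_less_eq mult.commute)
  have "0 < d / n" using dimensions_ge_1 by simp
  then show "0 < \<tau>" using \<tau> by linarith
qed

lemma critical_exponent_less: "(n * \<tau> - d) / (1 + \<tau>) < n"
  using \<tau>_pos dimensions_ge_1 by (simp add: pos_divide_less_eq algebra_simps)

lemma ex_measure_above_critical:
  assumes "0 \<le> a" "(1 + \<tau>) * a < d" "(n * \<tau> - d) / (1 + \<tau>) < p" "p < n"
  obtains \<nu> C B where "\<nu> \<in> prob_measures_on E" "decay_bound C a (fourier_transform \<nu>)"
    "lattice_energy_le p (fourier_transform \<nu>) B" "0 \<le> p"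
proof -
  have "0 \<le> (n * \<tau> - d) / (1 + \<tau>)" using \<tau>_pos d_less by simp
  then have "0 \<le> p" using assms(3) by linarith
  have "n * \<tau> - d < p * (1 + \<tau>)" using assms(3) \<tau>_pos by (simp add: pos_divide_less_eq)
  with assms \<tau>_pos \<open>0 \<le> p\<close> obtain \<nu> C B where "\<nu> \<in> prob_measures_on E"
    "decay_bound C a (fourier_transform \<nu>)" "lattice_energy_le p (fourier_transform \<nu>) B"
    unfolding E_def d_def n_def
    by (metis ex_measure_on_well_approximable[where ?'d = 'd and ?'n = 'n, of \<tau> a p] less_imp_le)
  then show ?thesis using \<open>0 \<le> p\<close> by (rule that)
qed

lemma fourier_dim_well_approximable_le: "fourier_dim E \<le> 2 * d / (1 + \<tau>)"
  unfolding fourier_dim_def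
proof (rule cSup_least)
  fix x assume "x \<in> insert 0 (fourier_dim_measure ` prob_measures_on E)"
  then consider (zero) "x = 0" | (measure) \<mu> where "\<mu> \<in> prob_measures_on E" "x =
      fourier_dim_measure \<mu>" by blast
  then show "x \<le> 2 * d / (1 + \<tau>)"
  proof cases
    case (measure \<mu>)
    have "fourier_dim_measure \<mu> \<le> 2 * d / (1 + \<tau>)"
    proof (rule fourier_dim_measure_le)
      show "prob_space \<mu>" using measure by (simp add: prob_measures_on_def)
      fix s C assume "decay_bound C (s / 2) (fourier_transform \<mu>)"
      then have "s / 2 \<le> d / (1 + \<tau>)"
        unfolding d_def
        by (rule decay_exponent_le[OF \<tau>[unfolded d_def n_def] measure(1)[unfolded E_def]])
      then show "s \<le> 2 * d / (1 + \<tau>)" by (simp add: mult.commute)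
    qed
    then show ?thesis using measure by simp
  qed (use \<tau>_pos dimensions_ge_1 in simp)
qed simp

lemma fourier_dim_well_approximable_ge: "2 * d / (1 + \<tau>) \<le> fourier_dim E"
proof (rule dense_le)
  fix x assume "x < 2 * d / (1 + \<tau>)"
  define s where "s = max 0 x"
  have s: "0 \<le> s" "s < 2 * d / (1 + \<tau>)"
    using \<open>x < 2 * d / (1 + \<tau>)\<close> \<tau>_pos dimensions_ge_1 by (auto simp: s_def)
  obtain p where p: "(n * \<tau> - d) / (1 + \<tau>) < p" "p < n"
    using dense[OF critical_exponent_less] by blast
  have "(1 + \<tau>) * (s / 2) < d" using s \<tau>_pos by (simp add: pos_less_divide_eq mult.commute)
  with s(1) obtain \<nu> C where \<nu>: "\<nu> \<in> prob_measures_on E"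
      "decay_bound C (s / 2) (fourier_transform \<nu>)"
    by - (rule ex_measure_above_critical[OF _ _ p, of "s / 2"], auto)
  have "2 * d \<le> n * d * (1 + \<tau>)"
  proof -
    have "2 \<le> n * (1 + \<tau>)" using d_less dimensions_ge_1 by (simp add: distrib_left)
    then have "d * 2 \<le> d * (n * (1 + \<tau>))" using dimensions_ge_1 by (intro mult_left_mono) auto
    then show ?thesis by (simp add: mult_ac)
  qed
  then have "2 * d / (1 + \<tau>) \<le> n * d" using \<tau>_pos by (simp add: pos_divide_le_eq)
  then have "s \<le> fourier_dim_measure \<nu>"
    using \<nu> s by (intro fourier_dim_measure_ge) (auto simp: prob_measures_on_def n_def d_def)
  then show "x \<le> fourier_dim E" using fourier_dim_ge[OF \<nu>(1)] by (simp add: s_def)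
qed

lemma hausdorff_dim_well_approximable_ge: "n * (d - 1) + (n + d) / (1 + \<tau>) \<le> hausdorff_dim E"
proof -
  have dim: "real DIM(real ^ 'd ^ 'n) = n * d" by (simp add: n_def d_def)
  have "n * 1 \<le> n * d" using dimensions_ge_1 by (intro mult_left_mono) auto
  have "n * d - hausdorff_dim E \<le> (n * \<tau> - d) / (1 + \<tau>)"
  proof (rule dense_ge_bounded[OF critical_exponent_less])
    fix p assume p: "(n * \<tau> - d) / (1 + \<tau>) < p" "p < n"
    have "(1 + \<tau>) * 0 < d" using dimensions_ge_1 by simp
    then obtain \<nu> B where \<nu>: "\<nu> \<in> prob_measures_on E" "lattice_energy_le p (fourier_transform \<nu>) B"
        "0 \<le> p"
      by (rule ex_measure_above_critical[OF order_refl _ p]) (rule that)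
    have measure: "prob_space \<nu>" "sets \<nu> = sets borel" "measure_support \<nu> \<subseteq> E"
      using \<nu>(1) by (auto simp: prob_measures_on_def)
    have "AE x in \<nu>. x \<in> E" using AE_measure_support[OF measure(2)]
      by eventually_elim (use measure(3) in blast)
    moreover have "p \<le> real DIM(real ^ 'd ^ 'n)"
      unfolding dim using p(2) \<open>n * 1 \<le> n * d\<close> by linarith
    ultimately have "real DIM(real ^ 'd ^ 'n) - p \<le> hausdorff_dim E"
      using \<nu> measure by (intro hausdorff_dim_ge_if_lattice_energy_le)
    then show "n * d - hausdorff_dim E \<le> p" unfolding dim by linarith
  qed
  moreover have "n - (n * \<tau> - d) / (1 + \<tau>) = (n + d) / (1 + \<tau>)"
    using \<tau>_pos by (simp add: field_simps)
  ultimately show ?thesis by (simp add: algebra_simps)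
qed

end

lemma less_hausdorff_dim_formula:
  fixes d n :: nat and \<tau> :: real
  assumes "1 \<le> d" "1 \<le> n" "\<not> (n = 1 \<and> d = 1)" "0 < \<tau>"
  shows "2 * real d / (1 + \<tau>) < real n * (real d - 1) + (real n + real d) / (1 + \<tau>)"
proof -
  have nonneg: "0 \<le> real d * (real n - 1)" "0 \<le> (real d - 1) * real n * \<tau>" using assms by auto
  have "0 < real d * (real n - 1) \<or> 0 < (real d - 1) * real n * \<tau>" using assms by auto
  then have "0 < real d * (real n - 1) + (real d - 1) * real n * \<tau>" using nonneg by linarith
  then have "2 * real d < real n * (real d - 1) * (1 + \<tau>) + (real n + real d)"
    by (simp add: algebra_simps)
  then have "2 * real d / (1 + \<tau>) < (real n * (real d - 1) * (1 + \<tau>) + (real n + real d)) / (1 + \<tau>)"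
    using assms(4) by (intro divide_strict_right_mono) auto
  then show ?thesis using assms(4) by (simp add: add_divide_distrib)
qed

theorem theorem1:
  fixes \<tau> :: real
  assumes "\<tau> > real CARD('d) / real CARD('n)"
  shows "fourier_dim (well_approximable \<tau> :: (real ^ 'd ^ 'n) set) = 2 * real CARD('d) / (1 + \<tau>) \<and>
    (\<not> (CARD('n) = 1 \<and> CARD('d) = 1) \<longrightarrow>
       \<not> salem_set (well_approximable \<tau> :: (real ^ 'd ^ 'n) set))"
proof (intro conjI impI)
  let ?E = "well_approximable \<tau> :: (real ^ 'd ^ 'n) set"
  show fourier: "fourier_dim ?E = 2 * real CARD('d) / (1 + \<tau>)"
    using fourier_dim_well_approximable_le[OF assms] fourier_dim_well_approximable_ge[OF assms]
    by (rule antisym)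
  assume "\<not> (CARD('n) = 1 \<and> CARD('d) = 1)"
  then have "fourier_dim ?E <
      real CARD('n) * (real CARD('d) - 1) + (real CARD('n) + real CARD('d)) / (1 + \<tau>)"
    unfolding fourier using \<tau>_pos[OF assms]
    by (intro less_hausdorff_dim_formula) (auto simp: Suc_le_eq)
  also have "\<dots> \<le> hausdorff_dim ?E" by (rule hausdorff_dim_well_approximable_ge[OF assms])
  finally show "\<not> salem_set ?E" by (simp add: salem_set_def)
qed

end
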